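(* Let $n\ge 2$ and let $g:[0,\infty)^n\to\mathbb{R}$ be a continuous function such that $g(t)=0$ for every $t\in\partial_1^n$. The following conditions are equivalent: (i) For any $d\in\mathbb{N}$ and discrete measures $\mu_i$ in $\mathbb{R}^d$, $1\le i\le n$, such that $\mu_i(\mathbb{R}^d)=0$ for at least two indices $i$, it holds that $$\int_{(\mathbb{R}^d)^n}\int_{(\mathbb{R}^d)^n} g(\|x_1-y_1\|^2,\ldots,\|x_n-y_n\|^2)\,d\Big[\mathop{\times}_{i=1}^n\mu_i\Big](x)\,d\Big[\mathop{\times}_{i=1}^n\mu_i\Big](y)\ge 0.$$ (ii) For any $d\in\mathbb{N}$ and discrete probability $P$ in $(\mathbb{R}^d)^n$ with marginals $P_i$ in $\mathbb{R}^d$, it holds that $$\int_{(\mathbb{R}^d)^n}\int_{(\mathbb{R}^d)^n} g(\|x_1-y_1\|^2,\ldots,\|x_n-y_n\|^2)\,d\Big[P-\mathop{\times}_{i=1}^nP_i\Big](x)\,d\Big[P-\mathop{\times}_{i=1}^nP_i\Big](y)\ge 0.$$ (iii) The function $g$ is PDI$_{2,n}^\infty$. (iv) The function $g$ can be represented, for $t\in[0,\infty)^n$, as $$g(t)=\sum_{i<j}\psi^{i,j}(t_i,t_j)+\int_{[0,\infty)^n\setminus\partial_2^n}\Big(e^{-r\cdot t}-\sum_{i=1}^n e^{-r_it_i}+n-1\Big)\frac{p_2^n(\vec 1+r)}{p_2^n(r)}\,d\eta(r),$$ where the measure $\eta\in\mathfrak{M}([0,\infty)^n\setminus\partial_2^n)$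 is nonnegative and the functions $\psi^{i,j}:[0,\infty)^2\to\mathbb{R}$ are Bernstein functions of order $2$ in $(0,\infty)^2$ that are zero on $\partial_1^2$. Further, the representation is unique. (v) The function $g$ is a Bernstein function of order $2$ in $(0,\infty)^n$.
   Context: A discrete measure is a finite real linear combination of Dirac measures. $\mathfrak{M}(A)$ denotes the finite (signed) Borel measures on $A$. For $0\le k\le n$: $\partial_{k-1}^n:=\{r\in[0,\infty)^n:\ |\{i: r_i>0\}|<k\}$; thus $\partial_1^n$ is the set of points with at most one positive coordinate, $\partial_2^n$ with at most two. For nonempty sets $X_1,\dots,X_n$, $\mathcal{M}_k(\prod_i X_i)$ is the space of discrete measures $\mu$ in $\prod_{i}X_i$ such that $\mu(\prod_{i=1}^nA_i)=0$ for all $A_i\subset X_i$ with $|\{i: A_i=X_i\}|\ge n-k+1$. A function $g:[0,\infty)^n\to\mathbb{R}$ is PDI$_{k,n}^\infty$ (positive definite independent of order $k$ in all Euclidean spaces) if for every $d\in\mathbb{N}$ and $\mu\in\mathcal{M}_k((\mathbb{R}^d)^n)$, where $(\mathbb{R}^d)^n$ is viewed as a product of $n$ copies of $\mathbb{R}^d$, $$\int_{(\mathbb{R}^d)^n}\int_{(\mathbb{R}^d)^n}(-1)^kg(\|u_1-v_1\|^2,\ldots,\|u_n-v_n\|^2)\,d\mu(u)\,d\mu(v)\ge 0.$$ $p_k^n(r)=\sum_{1\le i_1<\dots<i_k\le n}r_{i_1}\cdots r_{i_k}$ is the elementary symmetric polynomial, $\vec 1=(1,\dots,1)$. A function $h:(0,\infty)^n\to\mathbb{R}$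 is completely monotone with $n$ variables if $h\in C^\infty((0,\infty)^n)$ and $(-1)^{|\alpha|}\partial^\alpha h\ge 0$ on $(0,\infty)^n$ for all $\alpha\in\mathbb{Z}_+^n$. A function is a Bernstein function of order $k$ in $(0,\infty)^n$ if it (or its restriction to $(0,\infty)^n$) is in $C^\infty((0,\infty)^n)$ and for every $F\subset\{1,\dots,n\}$ with $|F|=k$ the derivative $\partial^{\vec 1_F}g$ (one derivative in each variable indexed by $F$) is completely monotone with $n$ variables. *)

theory Defs
  imports "HOL-Analysis.Analysis" "HOL-Library.Poly_Mapping"
begin

section \<open>Discrete measures\<close>

text \<open>
  A discrete measure is a finite real linear combination of Dirac measures.  It is determined by its
  point masses, a finitely supported function, so it is represented by an element of
  \<open>'a \<Rightarrow>\<^sub>0 real\<close>; \<open>Poly_Mapping.single x c\<close> is \<open>c\<close> times the Dirac measure at \<open>x\<close>, and sums and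
  differences of measures are those of \<open>'a \<Rightarrow>\<^sub>0 real\<close>.
\<close>

type_synonym 'a dmeasure = "'a \<Rightarrow>\<^sub>0 real"

definition dmeasures_in :: "'a set \<Rightarrow> 'a dmeasure set" where
  "dmeasures_in X = {\<mu>. Poly_Mapping.keys \<mu> \<subseteq> X}"

definition dmeas :: "'a dmeasure \<Rightarrow> 'a set \<Rightarrow> real" where
  "dmeas \<mu> A = (\<Sum>x\<in>Poly_Mapping.keys \<mu> \<inter> A. Poly_Mapping.lookup \<mu> x)"

definition dint :: "'a dmeasure \<Rightarrow> ('a \<Rightarrow> real) \<Rightarrow> real" where
  "dint \<mu> f = (\<Sum>x\<in>Poly_Mapping.keys \<mu>. Poly_Mapping.lookup \<mu> x * f x)"

definition dprobs_in :: "'a set \<Rightarrow> 'a dmeasure set" where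
  "dprobs_in X = {P \<in> dmeasures_in X. (\<forall>x. 0 \<le> Poly_Mapping.lookup P x) \<and> dmeas P X = 1}"

definition dprod_meas :: "('n::finite \<Rightarrow> 'a dmeasure) \<Rightarrow> ('n \<Rightarrow> 'a) dmeasure" where
  "dprod_meas \<mu> = (\<Sum>x\<in>(\<Pi>\<^sub>E i\<in>UNIV. Poly_Mapping.keys (\<mu> i)).
      Poly_Mapping.single x (\<Prod>i\<in>UNIV. Poly_Mapping.lookup (\<mu> i) (x i)))"

text \<open>Push-forward under the \<open>i\<close>-th coordinate projection.\<close>

definition dmarginal :: "('n \<Rightarrow> 'a) dmeasure \<Rightarrow> 'n \<Rightarrow> 'a dmeasure" where
  "dmarginal P i = (\<Sum>x\<in>Poly_Mapping.keys P. Poly_Mapping.single (x i) (Poly_Mapping.lookup P x))"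

text \<open>
  The space \<open>\<M>\<^sub>k(\<Prod>\<^sub>i X\<^sub>i)\<close>.  The inequality is \<open>card {i. A i = X i} \<ge> CARD('n) - k + 1\<close>, written
  without truncated subtraction.
\<close>

definition M_space :: "nat \<Rightarrow> ('n::finite \<Rightarrow> 'a set) \<Rightarrow> ('n \<Rightarrow> 'a) dmeasure set" where
  "M_space k X = {\<mu> \<in> dmeasures_in (\<Pi>\<^sub>E i\<in>UNIV. X i).
     \<forall>A. (\<forall>i. A i \<subseteq> X i) \<and> card {i. A i = X i} + k \<ge> CARD('n) + 1
         \<longrightarrow> dmeas \<mu> (\<Pi>\<^sub>E i\<in>UNIV. A i) = 0}"


section \<open>Kernels of squared distances in all Euclidean spaces\<close>

text \<open>
  The dimension \<open>d\<close> is quantified inside the conditions, so \<open>\<real>\<^sup>d\<close> is the carrier of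
  \<open>Euclidean_space d\<close>, that is, the sequences vanishing from index \<open>d\<close> on.
\<close>

abbreviation Rd :: "nat \<Rightarrow> (nat \<Rightarrow> real) set" where
  "Rd d \<equiv> topspace (Euclidean_space d)"

abbreviation Rd_pow :: "nat \<Rightarrow> ('n::finite \<Rightarrow> nat \<Rightarrow> real) set" where
  "Rd_pow d \<equiv> (\<Pi>\<^sub>E i\<in>UNIV. Rd d)"

definition sqdists :: "nat \<Rightarrow> ('n \<Rightarrow> nat \<Rightarrow> real) \<Rightarrow> ('n \<Rightarrow> nat \<Rightarrow> real) \<Rightarrow> real^'n" where
  "sqdists d u v = (\<chi> i. (L2_set (\<lambda>l. u i l - v i l) {..<d})\<^sup>2)"

definition dist_energy ::
    "nat \<Rightarrow> (real^'n::finite \<Rightarrow> real) \<Rightarrow> ('n \<Rightarrow> nat \<Rightarrow> real) dmeasure \<Rightarrow> real" where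
  "dist_energy d g \<mu> = dint \<mu> (\<lambda>v. dint \<mu> (\<lambda>u. g (sqdists d u v)))"

definition PDI :: "nat \<Rightarrow> (real^'n::finite \<Rightarrow> real) \<Rightarrow> bool" where
  "PDI k g \<longleftrightarrow> (\<forall>d\<ge>1. \<forall>\<mu>\<in>M_space k (\<lambda>i. Rd d).
     dist_energy d (\<lambda>t. (-1)^k * g t) \<mu> \<ge> 0)"


section \<open>Orthants, completely monotone and Bernstein functions\<close>

definition orthant :: "(real^'n) set" where
  "orthant = {t. \<forall>i. 0 \<le> t $ i}"

definition pos_orthant :: "(real^'n) set" where
  "pos_orthant = {t. \<forall>i. 0 < t $ i}"

text \<open>\<open>orthant_bdry m\<close> is \<open>\<partial>\<^sub>m\<^sup>n\<close>, the points with at most \<open>m\<close> positive coordinates.\<close>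

definition orthant_bdry :: "nat \<Rightarrow> (real^'n::finite) set" where
  "orthant_bdry m = {r \<in> orthant. card {i. 0 < r $ i} < m + 1}"

definition partial :: "'n::finite \<Rightarrow> (real^'n \<Rightarrow> real) \<Rightarrow> real^'n \<Rightarrow> real" where
  "partial i f = (\<lambda>x. frechet_derivative f (at x) (axis i 1))"

text \<open>The derivative for the multi-index \<open>\<alpha>\<close>, iterated in the order of the coordinates.\<close>

definition multi_partial ::
    "('n \<Rightarrow> nat) \<Rightarrow> (real^'n::{finite,linorder} \<Rightarrow> real) \<Rightarrow> real^'n::{finite,linorder} \<Rightarrow> real" where
  "multi_partial \<alpha> f = foldr (\<lambda>i. partial i ^^ \<alpha> i) (sorted_list_of_set UNIV) f"

text \<open>Continuous differentiability of order \<open>m\<close>, meant for open sets \<open>S\<close>.\<close>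

primrec C_diff_on :: "nat \<Rightarrow> (real^'n::finite) set \<Rightarrow> (real^'n \<Rightarrow> real) \<Rightarrow> bool" where
  "C_diff_on 0 S f \<longleftrightarrow> continuous_on S f"
| "C_diff_on (Suc m) S f \<longleftrightarrow>
     (\<forall>x\<in>S. f differentiable at x) \<and> (\<forall>i. C_diff_on m S (partial i f))"

definition smooth_on :: "(real^'n::finite) set \<Rightarrow> (real^'n \<Rightarrow> real) \<Rightarrow> bool" where
  "smooth_on S f \<longleftrightarrow> (\<forall>m. C_diff_on m S f)"

definition completely_monotone :: "(real^'n::{finite,linorder} \<Rightarrow> real) \<Rightarrow> bool" where
  "completely_monotone h \<longleftrightarrow> smooth_on pos_orthant h \<and>
     (\<forall>\<alpha>. \<forall>x\<in>pos_orthant. (-1) ^ (\<Sum>i\<in>UNIV. \<alpha> i) * multi_partial \<alpha> h x \<ge> 0)"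

definition bernstein :: "nat \<Rightarrow> (real^'n::{finite,linorder} \<Rightarrow> real) \<Rightarrow> bool" where
  "bernstein k g \<longleftrightarrow> smooth_on pos_orthant g \<and>
     (\<forall>F. card F = k \<longrightarrow> completely_monotone (multi_partial (\<lambda>i. if i \<in> F then 1 else 0) g))"


section \<open>The integral representation\<close>

definition elem_sym :: "nat \<Rightarrow> real^'n::finite \<Rightarrow> real" where
  "elem_sym k r = (\<Sum>F | card F = k. \<Prod>i\<in>F. r $ i)"

text \<open>
  The measure \<open>\<eta>\<close> lives on the subspace \<open>orthant - orthant_bdry 2\<close> (which is empty if \<open>n = 2\<close>).
  Integrability is part of the representation because the Bochner integral of a non-integrable
  function is \<open>0\<close>.  The values \<open>\<psi> i j\<close> for \<open>i \<ge> j\<close> and off \<open>orthant\<close> are irrelevant.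
\<close>

definition represents ::
    "('n \<Rightarrow> 'n \<Rightarrow> real^2 \<Rightarrow> real) \<Rightarrow> (real^'n::{finite,linorder}) measure \<Rightarrow>
      (real^'n::{finite,linorder} \<Rightarrow> real) \<Rightarrow> bool"
where
  "represents \<psi> \<eta> g \<longleftrightarrow>
     (\<forall>i j. i < j \<longrightarrow> bernstein 2 (\<psi> i j) \<and> (\<forall>s\<in>orthant_bdry 1. \<psi> i j s = 0)) \<and>
     finite_measure \<eta> \<and>
     sets \<eta> = sets (restrict_space borel (orthant - orthant_bdry 2)) \<and>
     (\<forall>t\<in>orthant.
        let K = (\<lambda>r. (exp (- (r \<bullet> t)) - (\<Sum>i\<in>UNIV. exp (- (r $ i * t $ i))) + real CARD('n) - 1)
                     * (elem_sym 2 (1 + r) / elem_sym 2 r))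
        in integrable \<eta> K \<and>
           g t = (\<Sum>(i, j) | i < j. \<psi> i j (vector [t $ i, t $ j])) + integral\<^sup>L \<eta> K)"

end

theory Submission
  imports Defs "HOL-Probability.Probability" "HOL-Real_Asymp.Real_Asymp"
begin

text \<open>
  All conditions are compared with one condition on finite differences.  Let \<open>E\<^sub>s\<close> be the translation by
  \<open>s \<ge> 0\<close> in direction \<open>i\<close>.  The function \<open>g\<close> is called \<open>mixed_alternating\<close> if every product of operators
  \<open>1 - E\<^sub>s\<close> that uses at least two different directions maps \<open>g\<close> to a function that is nonnegative on the
  closed orthant.

  Why energies give differences: the energy of \<open>\<delta>\<^sub>0 - \<delta>\<^sub>x\<close>, with \<open>x\<close> of length \<open>sqrt s\<close> in a
  new coordinate, is twice the operator \<open>1 - E\<^sub>s\<close>, and many points at mutual squared distance \<open>t\<close> give the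
  evaluation at \<open>t\<close> up to a diagonal term that disappears in the limit.  Products of such measures therefore
  produce all the differences (\<open>mixed_alternating_if_products\<close>).  Products with two factors of mass zero and
  the differences \<open>P - \<Times>P\<^sub>i\<close> annihilate the functions of one coordinate.  Conversely, a measure that does so
  is a multiple of some \<open>P - \<Times>P\<^sub>i\<close>: add a small multiple of it to a uniform product
  measure (\<open>PDI_two_if_centred_probs\<close>).

  Why differences give the representation: two steps in the directions \<open>i \<noteq> j\<close> turn \<open>g\<close> into a function all
  of whose differences alternate, and such a continuous function is the Laplace transform of a finite measure
  (\<open>laplace_representation\<close>).  This follows from the Hausdorff moment problem on the cube, whose solution is
  a limit of explicit point masses; compactness comes from Helly's theorem on the line and a space-filling
  curve.  So for each pair there is a measure \<open>\<rho>\<^sub>i\<^sub>j\<close> whose integrals give all mixed differences of \<open>g\<close> in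
  \<open>i\<close> and \<open>j\<close> (\<open>mixed_difference_measure\<close>), and \<open>g\<close>, being zero on the axes, is a telescoping sum of such
  differences (\<open>pair_decomposition\<close>).  Uniqueness of the Laplace transform shows that the \<open>\<rho>\<^sub>i\<^sub>j\<close> are
  compatible.  On the points with at least three positive coordinates they come from one measure \<open>\<eta>\<close>;
  outside this set \<open>\<rho>\<^sub>i\<^sub>j\<close> lives on the \<open>(i, j)\<close>-plane and yields \<open>\<psi>\<^sup>i\<^sup>j\<close>.

  The way back: the kernels under the integrals are Gaussian up to functions of one coordinate, so their
  energies are nonnegative; they are smooth, so \<open>g\<close> is smooth; and for smooth functions signs of derivatives
  are signs of differences (\<open>bernstein_iff_mixed_alternating_pos\<close>).  The measure \<open>\<eta>\<close> is determined by
  differences in three directions, which annihilate every \<open>\<psi>\<^sup>i\<^sup>j\<close>.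
\<close>


section \<open>The group algebra of discrete measures\<close>

lemma dint_superset:
  assumes "finite A" "Poly_Mapping.keys \<mu> \<subseteq> A"
  shows "dint \<mu> f = (\<Sum>x\<in>A. Poly_Mapping.lookup \<mu> x * f x)"
  unfolding dint_def by (rule sum.mono_neutral_left) (use assms in \<open>auto simp: in_keys_iff\<close>)

lemma dint_zero [simp]: "dint 0 f = 0"
  by (simp add: dint_def)

lemma dint_single [simp]: "dint (Poly_Mapping.single x c) f = c * f x"
  by (subst dint_superset[of "{x}"]) auto

lemma dint_add: "dint (\<mu> + \<nu>) f = dint \<mu> f + dint \<nu> f"
proof -
  let ?A = "Poly_Mapping.keys \<mu> \<union> Poly_Mapping.keys \<nu>"
  have "Poly_Mapping.keys (\<mu> + \<nu>) \<subseteq> ?A" by (rule keys_add)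
  then show ?thesis
    by (simp add: dint_superset[of ?A] lookup_add algebra_simps sum.distrib)
qed

lemma dint_uminus: "dint (- \<mu>) f = - dint \<mu> f"
  using dint_add[of \<mu> "- \<mu>" f] by simp

lemma dint_diff: "dint (\<mu> - \<nu>) f = dint \<mu> f - dint \<nu> f"
  using dint_add[of \<mu> "- \<nu>" f] by (simp add: dint_uminus)

lemma dint_sum: "dint (sum \<mu> I) f = (\<Sum>i\<in>I. dint (\<mu> i) f)"
  by (induction I rule: infinite_finite_induct) (auto simp: dint_add)

lemma dint_fun_add: "dint \<mu> (\<lambda>x. f x + g x) = dint \<mu> f + dint \<mu> g"
  by (simp add: dint_def algebra_simps sum.distrib)

lemma dint_fun_diff: "dint \<mu> (\<lambda>x. f x - g x) = dint \<mu> f - dint \<mu> g"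
  by (simp add: dint_def algebra_simps sum_subtractf)

lemma dint_fun_sum: "dint \<mu> (\<lambda>x. \<Sum>i\<in>I. f i x) = (\<Sum>i\<in>I. dint \<mu> (f i))"
  unfolding dint_def by (simp add: sum_distrib_left) (rule sum.swap)

lemma dint_fun_mult: "dint \<mu> (\<lambda>x. c * f x) = c * dint \<mu> f"
  by (simp add: dint_def sum_distrib_left mult_ac)

lemma dint_cong: "(\<And>x. x \<in> Poly_Mapping.keys \<mu> \<Longrightarrow> f x = g x) \<Longrightarrow> dint \<mu> f = dint \<mu> g"
  by (simp add: dint_def)

lemma dmeasure_expand: "\<mu> = (\<Sum>x\<in>Poly_Mapping.keys \<mu>. Poly_Mapping.single x (Poly_Mapping.lookup \<mu> x))"
proof (rule poly_mapping_eqI)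
  fix y
  show "Poly_Mapping.lookup \<mu> y = Poly_Mapping.lookup (\<Sum>x\<in>Poly_Mapping.keys \<mu>. Poly_Mapping.single x (Poly_Mapping.lookup \<mu> x)) y"
    by (auto simp: lookup_sum lookup_single when_def in_keys_iff)
qed

definition dirac :: "'a::zero \<Rightarrow> 'a dmeasure" where
  "dirac t = Poly_Mapping.single t 1"

text \<open>
  Convolution with \<open>step i s\<close> is the negative difference operator in direction \<open>i\<close>; the sign makes every factor
  nonnegative on the functions \<open>exp (- (r \<bullet> t))\<close>.
\<close>

definition step :: "'n \<Rightarrow> real \<Rightarrow> (real^'n::finite) dmeasure" where
  "step i s = 1 - dirac (axis i s)"

lemma dint_dirac [simp]: "dint (dirac t) f = f t"
  by (simp add: dirac_def)

lemma dirac_add: "dirac (s + t) = dirac s * dirac (t :: 'a::monoid_add)"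
  by (simp add: dirac_def mult_single)

lemma dirac_zero [simp]: "dirac (0 :: 'a::monoid_add) = 1"
  by (simp add: dirac_def)

lemma dirac_sum: "dirac (\<Sum>i\<in>I. t i) = (\<Prod>i\<in>I. dirac (t i :: 'a::comm_monoid_add))"
  by (induction I rule: infinite_finite_induct) (auto simp: dirac_add)

lemma dirac_axis_power: "dirac (axis i (real k * s)) = dirac (axis i s :: real^'n::finite) ^ k"
proof (induction k)
  case (Suc k)
  have "axis i (real (Suc k) * s) = axis i s + axis i (real k * s)"
    by (simp add: vec_eq_iff axis_def algebra_simps)
  then show ?case by (simp add: dirac_add Suc)
qed (simp add: axis_def flip: zero_vec_def)

text \<open>
  The product on \<open>'a \<Rightarrow>\<^sub>0 real\<close> is convolution.  With it, compositions of translations and differences become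
  products in a commutative ring, and identities between them become ring identities.
\<close>

lemma dint_mult: "dint (\<mu> * \<nu>) f = dint \<mu> (\<lambda>s. dint \<nu> (\<lambda>t. f (s + t)))"
  for \<mu> \<nu> :: "('a::monoid_add) dmeasure"
proof -
  have "\<mu> * \<nu> = (\<Sum>x\<in>Poly_Mapping.keys \<mu>. \<Sum>y\<in>Poly_Mapping.keys \<nu>.
      Poly_Mapping.single (x + y) (Poly_Mapping.lookup \<mu> x * Poly_Mapping.lookup \<nu> y))"
    using arg_cong2[OF dmeasure_expand[of \<mu>] dmeasure_expand[of \<nu>], of "(*)"]
    by (simp add: sum_product mult_single)
  then show ?thesis
    by (simp add: dint_sum) (simp add: dint_def sum_distrib_left mult_ac)
qed

lemma dint_dirac_mult: "dint (dirac t * \<nu>) f = dint \<nu> (\<lambda>s. f (t + s))"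
  by (simp add: dint_mult)

lemma dint_conv: "dint \<mu> (\<lambda>t. dint (dirac t * \<nu>) f) = dint (\<mu> * \<nu>) f"
  by (simp add: dint_dirac_mult dint_mult)

lemma dint_one [simp]: "dint 1 f = f (0 :: 'a::monoid_add)"
  using dint_dirac[of "0 :: 'a" f] by simp

lemma dint_step_mult: "dint (step i s * \<nu>) f = dint \<nu> (\<lambda>t. f t - f (axis i s + t))"
  by (simp add: step_def left_diff_distrib dint_diff dint_dirac_mult dint_fun_diff)

abbreviation steps :: "('n \<times> real) list \<Rightarrow> (real^'n::finite) dmeasure" where
  "steps L \<equiv> prod_list (map (\<lambda>(i, s). step i s) L)"

abbreviation two_coordinates :: "('n \<times> real) list \<Rightarrow> bool" where
  "two_coordinates L \<equiv> \<exists>i j. i \<noteq> j \<and> i \<in> fst ` set L \<and> j \<in> fst ` set L"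

text \<open>
  The condition through which all others are compared.  It refers to neither derivatives nor integrals and makes
  sense on the closed orthant.
\<close>

definition mixed_alternating :: "(real^'n::finite \<Rightarrow> real) \<Rightarrow> bool" where
  "mixed_alternating g \<longleftrightarrow> (\<forall>t\<in>orthant. \<forall>L. (\<forall>(i, s)\<in>set L. 0 \<le> s) \<longrightarrow>
     (two_coordinates L) \<longrightarrow> 0 \<le> dint (dirac t * steps L) g)"

lemma steps_of_powers:
  obtains L where "steps L = (\<Prod>i\<in>(UNIV::'n::finite set). step i h ^ p i)" "\<forall>(i, s)\<in>set L. s = h"
proof -
  have "\<exists>L. steps L = (\<Prod>i\<in>A. step i h ^ p i) \<and> (\<forall>(i, s)\<in>set L. s = h)" if "finite A" for A :: "'n set"
    using that
  proof (induction A rule: finite_induct)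
    case empty
    then show ?case by (intro exI[of _ "[]"]) simp
  next
    case (insert i A)
    then obtain L where L: "steps L = (\<Prod>i\<in>A. step i h ^ p i)" "\<forall>(i, s)\<in>set L. s = h" by blast
    have rep: "steps (replicate (p i) (i, h)) = step i h ^ p i"
      by (simp add: map_replicate prod_list_replicate)
    have "steps (replicate (p i) (i, h) @ L) = (\<Prod>i\<in>insert i A. step i h ^ p i)"
      using L(1) insert.hyps by (simp del: map_replicate add: rep)
    moreover have "\<forall>x\<in>set (replicate (p i) (i, h) @ L). case x of (i, s) \<Rightarrow> s = h"
      using L(2) by (auto split: if_splits)
    ultimately show ?case by blast
  qed
  from this[OF finite[of UNIV]] obtain L where "steps L = (\<Prod>i\<in>UNIV. step i h ^ p i)" "\<forall>(i, s)\<in>set L. s = h" by metis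
  then show thesis by (rule that)
qed


section \<open>A space-filling curve and weak compactness on the cube\<close>

text \<open>
  A function of period \<open>2\<close> that is \<open>0\<close> on \<open>[0, 1/3]\<close> and \<open>1\<close> on \<open>[2/3, 1]\<close>: it reads the leading ternary digit
  of a point of the Cantor set, and does so continuously.
\<close>

definition wave :: "real \<Rightarrow> real" where
  "wave x = max 0 (min 1 (1/2 - cos (pi * x)))"

lemma wave_bounds: "0 \<le> wave x" "wave x \<le> 1"
  by (auto simp: wave_def)

lemma continuous_on_wave: "continuous_on A wave"
  unfolding wave_def by (intro continuous_intros)

lemma wave_periodic: "wave (2 * real m + x) = wave x"
proof -
  have "cos (pi * (2 * real m + x)) = cos (pi * x + real m * (2 * pi))"
    by (simp add: algebra_simps)
  also have "\<dots> = cos (pi * x)"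
    using cos_2npi[of m] sin_2npi[of m] by (simp add: cos_add mult_ac)
  finally show ?thesis by (simp add: wave_def)
qed

lemma wave_low: "wave x = 0" if "0 \<le> x" "x \<le> 1/3"
proof -
  have "cos (pi / 3) \<le> cos (pi * x)"
    using that by (intro cos_monotone_0_pi_le) (auto simp: mult.commute field_simps)
  then show ?thesis by (simp add: cos_60 wave_def)
qed

lemma wave_high: "wave x = 1" if "2/3 \<le> x" "x \<le> 1"
proof -
  have "cos (pi / 3) \<le> cos (pi * (1 - x))"
    using that by (intro cos_monotone_0_pi_le) (auto simp: mult.commute field_simps)
  also have "\<dots> = - cos (pi * x)"
    by (simp add: algebra_simps cos_diff)
  finally show ?thesis by (simp add: cos_60 wave_def)
qed

text \<open>
  Greedy expansion: \<open>r k\<close> is the remainder after \<open>k\<close> digits, scaled back to the unit interval.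
\<close>

lemma binary_digits:
  fixes y :: real
  assumes "0 \<le> y" "y \<le> 1"
  obtains b :: "nat \<Rightarrow> real" where "\<And>k. b k = 0 \<or> b k = 1" "(\<lambda>k. b k / 2 ^ Suc k) sums y"
proof -
  define r where "r = rec_nat y (\<lambda>_ r. if r \<ge> 1/2 then 2 * r - 1 else 2 * r)"
  define b :: "nat \<Rightarrow> real" where "b k = (if r k \<ge> 1/2 then 1 else 0)" for k
  have r0: "r 0 = y" and rS: "r (Suc k) = 2 * r k - b k" for k
    by (auto simp: r_def b_def)
  have r: "0 \<le> r k \<and> r k \<le> 1" for k
    by (induction k) (use assms in \<open>auto simp: r0 rS b_def\<close>)
  have partial_sum: "(\<Sum>k<m. b k / 2 ^ Suc k) = y - r m / 2 ^ m" for m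
    by (induction m) (auto simp: r0 rS field_simps)
  have "(\<lambda>m. r m * (1/2) ^ m) \<longlonglongrightarrow> 0"
  proof (rule tendsto_sandwich[OF _ _ tendsto_const])
    show "(\<lambda>m. (1/2::real) ^ m) \<longlonglongrightarrow> 0" by (rule LIMSEQ_realpow_zero) auto
  qed (use r in \<open>auto intro!: always_eventually mult_left_le_one_le\<close>)
  then have "(\<lambda>m. y - r m * (1/2) ^ m) \<longlonglongrightarrow> y - 0"
    by (intro tendsto_intros)
  then have "(\<lambda>k. b k / 2 ^ Suc k) sums y"
    unfolding sums_def partial_sum by (simp add: power_one_over divide_simps)
  then show thesis by (intro that[of b]) (auto simp: b_def)
qed

text \<open>
  Take \<open>x\<close> with ternary digits \<open>2 b\<^sub>k\<close>.  Multiplication by \<open>3\<^sup>m\<close> shifts the digits and adds an even integer,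
  which \<open>wave\<close> does not see; what remains starts with the digit \<open>2 b\<^sub>m\<close>.
\<close>

lemma wave_reads_digits:
  fixes b :: "nat \<Rightarrow> real"
  assumes b: "\<And>k. b k = 0 \<or> b k = 1"
  obtains x where "0 \<le> x" "x \<le> 1" "\<And>m. wave (3 ^ m * x) = b m"
proof -
  have summ: "summable (\<lambda>k. 2 * b (m + k) * (1/3) ^ Suc k)" for m
  proof (rule summable_comparison_test')
    show "summable (\<lambda>k. (1/3::real) ^ k)" by (rule summable_geometric) auto
    show "norm (2 * b (m + k) * (1/3) ^ Suc k) \<le> (1/3) ^ k" for k
      using b[of "m + k"] by auto
  qed
  define x where "x m = suminf (\<lambda>k. 2 * b (m + k) * (1/3) ^ Suc k)" for m
  have step: "x m = (2 * b m + x (Suc m)) / 3" for m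
  proof -
    have "x m = 2 * b m / 3 + suminf (\<lambda>k. 2 * b (m + Suc k) * (1/3) ^ Suc (Suc k))"
      unfolding x_def using suminf_split_head[OF summ[of m]] by simp
    also have "suminf (\<lambda>k. 2 * b (m + Suc k) * (1/3) ^ Suc (Suc k)) = suminf (\<lambda>k. (1/3) * (2 * b (Suc m + k) * (1/3) ^ Suc k))"
      by (intro suminf_cong) simp
    also have "\<dots> = x (Suc m) / 3"
      unfolding x_def using suminf_mult[OF summ[of "Suc m"], of "1/3"] by simp
    finally show ?thesis by simp
  qed
  have x_nonneg: "0 \<le> x m" for m
    unfolding x_def using b by (intro suminf_nonneg[OF summ]) (metis mult_nonneg_nonneg order.refl zero_le_numeral zero_le_one zero_le_power zero_le_divide_1_iff)
  have x_le: "x m \<le> 1" for m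
  proof -
    have "(\<lambda>k. (2/3) * (1/3::real) ^ k) sums ((2/3) * (1 / (1 - 1/3)))"
      by (intro sums_mult geometric_sums) auto
    then have s: "(\<lambda>k. 2 * (1/3::real) ^ Suc k) sums 1" by simp
    have "x m \<le> suminf (\<lambda>k. 2 * (1/3::real) ^ Suc k)"
      unfolding x_def
    proof (intro suminf_le summ)
      show "summable (\<lambda>k. 2 * (1/3::real) ^ Suc k)" using s by (simp add: sums_iff)
      show "2 * b (m + k) * (1/3) ^ Suc k \<le> 2 * (1/3) ^ Suc k" for k using b[of "m + k"] by auto
    qed
    also have "\<dots> = 1" using s by (simp add: sums_iff)
    finally show ?thesis .
  qed
  have expand: "\<exists>N::nat. 3 ^ m * x 0 = 2 * real N + x m" for m
  proof (induction m)
    case 0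
    show ?case by (intro exI[of _ 0]) simp
  next
    case (Suc m)
    then obtain N where N: "3 ^ m * x 0 = 2 * real N + x m" by blast
    have "3 ^ Suc m * x 0 = 2 * (3 * real N + b m) + x (Suc m)"
    proof -
      have "3 ^ Suc m * x 0 = 3 * (2 * real N + x m)" by (simp add: N[symmetric])
      then show ?thesis using step[of m] by simp
    qed
    moreover have "\<exists>d::nat. b m = real d" using b[of m] by (metis of_nat_0 of_nat_1)
    ultimately obtain d where "3 ^ Suc m * x 0 = 2 * (3 * real N + real d) + x (Suc m)" by metis
    then show ?case by (intro exI[of _ "3 * N + d"]) simp
  qed
  have "wave (3 ^ m * x 0) = b m" for m
  proof -
    obtain N where "3 ^ m * x 0 = 2 * real N + x m" using expand by blast
    then have "wave (3 ^ m * x 0) = wave (x m)" by (simp add: wave_periodic)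
    also have "\<dots> = b m"
      using b[of m] x_nonneg[of "Suc m"] x_le[of "Suc m"] step[of m]
      by (auto intro!: wave_low wave_high)
    finally show ?thesis .
  qed
  then show thesis using x_nonneg x_le by (intro that[of "x 0"])
qed

text \<open>
  Schoenberg's space-filling curve.  The binary digits of all coordinates are stored as ternary digits of one
  number, the \<open>k\<close>-th digit of coordinate \<open>i\<close> at place \<open>to_nat (i, k)\<close>.
\<close>

definition space_filling :: "real \<Rightarrow> real^'n::finite" where
  "space_filling x = (\<chi> i. suminf (\<lambda>k. wave (3 ^ to_nat (i, k) * x) / 2 ^ Suc k))"

lemma dyadic_dominated:
  fixes c :: "nat \<Rightarrow> real"
  assumes "\<And>k. 0 \<le> c k" "\<And>k. c k \<le> 1"
  shows "summable (\<lambda>k. c k / 2 ^ Suc k)" "0 \<le> suminf (\<lambda>k. c k / 2 ^ Suc k)" "suminf (\<lambda>k. c k / 2 ^ Suc k) \<le> 1"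
proof -
  have s: "(\<lambda>k. 1 / 2 ^ Suc k :: real) sums 1"
    using power_half_series by (simp add: power_one_over)
  show sm: "summable (\<lambda>k. c k / 2 ^ Suc k)"
  proof (rule summable_comparison_test')
    show "summable (\<lambda>k. 1 / 2 ^ Suc k :: real)" using s by (simp add: sums_iff)
    show "norm (c k / 2 ^ Suc k) \<le> 1 / 2 ^ Suc k" for k
      using assms[of k] by (simp add: divide_right_mono)
  qed
  show "0 \<le> suminf (\<lambda>k. c k / 2 ^ Suc k)" using assms by (intro suminf_nonneg sm) auto
  have "suminf (\<lambda>k. c k / 2 ^ Suc k) \<le> suminf (\<lambda>k. 1 / 2 ^ Suc k)"
    using assms s by (intro suminf_le sm) (auto simp: sums_iff divide_right_mono)
  then show "suminf (\<lambda>k. c k / 2 ^ Suc k) \<le> 1" using s by (simp add: sums_iff)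
qed

lemma space_filling_in_cube: "0 \<le> space_filling x $ i" "space_filling x $ i \<le> 1"
  unfolding space_filling_def using dyadic_dominated[of "\<lambda>k. wave (3 ^ to_nat (i, k) * x)"]
  by (simp_all add: wave_bounds)

lemma continuous_on_space_filling: "continuous_on UNIV (space_filling :: real \<Rightarrow> real^'n::finite)"
proof -
  have "continuous_on UNIV (\<lambda>x. suminf (\<lambda>k. wave (3 ^ to_nat (i, k) * x) / 2 ^ Suc k))" for i :: 'n
  proof (rule uniform_limit_theorem[OF _ Weierstrass_m_test[where M = "\<lambda>k. 1 / 2 ^ Suc k"]])
    show "\<forall>\<^sub>F m in sequentially. continuous_on UNIV (\<lambda>x. \<Sum>k<m. wave (3 ^ to_nat (i, k) * x) / 2 ^ Suc k)"
      by (intro always_eventually allI continuous_intros continuous_on_compose2[OF continuous_on_wave]) auto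
    show "norm (wave (3 ^ to_nat (i, k) * x) / 2 ^ Suc k) \<le> 1 / 2 ^ Suc k" for k x
      using wave_bounds by (simp add: divide_right_mono)
    show "summable (\<lambda>k. 1 / 2 ^ Suc k :: real)"
      using power_half_series by (simp add: power_one_over sums_iff)
  qed auto
  then show ?thesis unfolding space_filling_def by (intro continuous_on_vec_lambda)
qed

text \<open>
  Places that code no pair \<open>(i, k)\<close> get the digit \<open>0\<close>.
\<close>

lemma space_filling_onto:
  fixes z :: "real^'n::finite"
  assumes "\<And>i. 0 \<le> z $ i" "\<And>i. z $ i \<le> 1"
  obtains x where "0 \<le> x" "x \<le> 1" "space_filling x = z"
proof -
  have "\<exists>b :: nat \<Rightarrow> real. (\<forall>k. b k = 0 \<or> b k = 1) \<and> (\<lambda>k. b k / 2 ^ Suc k) sums (z $ i)" for i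
    using binary_digits[OF assms(1)[of i] assms(2)[of i]] by metis
  then obtain b :: "'n \<Rightarrow> nat \<Rightarrow> real" where b: "\<And>i k. b i k = 0 \<or> b i k = 1"
    and s: "\<And>i. (\<lambda>k. b i k / 2 ^ Suc k) sums (z $ i)"
    by metis
  define c where "c m = (if m \<in> range (to_nat :: 'n \<times> nat \<Rightarrow> nat) then case_prod b (from_nat m) else 0)" for m
  have "c m = 0 \<or> c m = 1" for m
    using b by (auto simp: c_def split: prod.split)
  then obtain x where x: "0 \<le> x" "x \<le> 1" "\<And>m. wave (3 ^ m * x) = c m"
    using wave_reads_digits by blast
  have "space_filling x = z"
    unfolding space_filling_def x(3) using s by (simp add: c_def vec_eq_iff sums_iff)
  then show thesis using x that by blast
qed

text \<open>
  Point masses on the cube can be lifted to the interval along the space-filling curve.  There Helly's selection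
  theorem yields a weakly convergent subsequence, and the curve carries its limit back to the cube.
\<close>

lemma cube_weak_compactness:
  fixes A :: "nat \<Rightarrow> 'a set" and w :: "nat \<Rightarrow> 'a \<Rightarrow> real" and pt :: "nat \<Rightarrow> 'a \<Rightarrow> real^'n::finite"
  assumes fin: "\<And>N. finite (A N)"
    and cube: "\<And>N z i. z \<in> A N \<Longrightarrow> 0 \<le> pt N z $ i \<and> pt N z $ i \<le> 1"
    and w: "\<And>N z. z \<in> A N \<Longrightarrow> 0 \<le> w N z" "\<And>N. (\<Sum>z\<in>A N. w N z) = 1"
  obtains M :: "(real^'n) measure" and r :: "nat \<Rightarrow> nat" where "prob_space M" "sets M = sets borel" "strict_mono r"
    "AE z in M. \<forall>i. 0 \<le> z $ i \<and> z $ i \<le> 1"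
    "\<And>f. continuous_on UNIV f \<Longrightarrow> (\<lambda>N. \<Sum>z\<in>A (r N). w (r N) z * f (pt (r N) z)) \<longlonglongrightarrow> integral\<^sup>L M f"
proof -
  have "\<exists>x. 0 \<le> x \<and> x \<le> 1 \<and> space_filling x = z" if "\<forall>i. 0 \<le> z $ i \<and> z $ i \<le> 1" for z :: "real^'n"
    using space_filling_onto[of z] that by metis
  then obtain s where s: "\<And>z :: real^'n. \<forall>i. 0 \<le> z $ i \<and> z $ i \<le> 1 \<Longrightarrow> 0 \<le> s z \<and> s z \<le> 1 \<and> space_filling (s z) = z"
    by metis
  have sA: "0 \<le> s (pt N z)" "s (pt N z) \<le> 1" "space_filling (s (pt N z)) = pt N z" if "z \<in> A N" for z N
    using s[of "pt N z"] cube[OF that] by auto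
  \<comment> \<open>the point masses, moved to the unit interval along the section \<open>s\<close> of the curve\<close>
  define \<nu> where "\<nu> N = distr (point_measure (A N) (\<lambda>z. ennreal (w N z))) borel (\<lambda>z. s (pt N z))" for N
  have emeas: "emeasure (\<nu> N) B = (\<Sum>z | z \<in> A N \<and> s (pt N z) \<in> B. ennreal (w N z))" if "B \<in> sets borel" for N B
  proof -
    have "emeasure (\<nu> N) B = emeasure (point_measure (A N) (\<lambda>z. ennreal (w N z))) ((\<lambda>z. s (pt N z)) -` B \<inter> A N)"
      unfolding \<nu>_def using that by (subst emeasure_distr) (auto simp: space_point_measure)
    also have "\<dots> = (\<Sum>z\<in>(\<lambda>z. s (pt N z)) -` B \<inter> A N. ennreal (w N z))"
      by (rule emeasure_point_measure_finite) (use fin in auto)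
    also have "(\<lambda>z. s (pt N z)) -` B \<inter> A N = {z. z \<in> A N \<and> s (pt N z) \<in> B}" by auto
    finally show ?thesis .
  qed
  have full: "emeasure (\<nu> N) B = 1" if "B \<in> sets borel" "{0..1} \<subseteq> B" for N B
  proof -
    have "{z. z \<in> A N \<and> s (pt N z) \<in> B} = A N" using sA that(2) by (auto simp: subset_iff)
    then show ?thesis using emeas[OF that(1), of N] w by (simp add: sum_ennreal)
  qed
  have rd: "real_distribution (\<nu> N)" for N
    unfolding real_distribution_def real_distribution_axioms_def
    by (auto simp: \<nu>_def intro!: prob_spaceI) (use full[of UNIV N] in \<open>simp add: \<nu>_def\<close>)
  have "tight \<nu>"
    unfolding tight_def
  proof (intro conjI allI impI rd)
    fix \<epsilon> :: real assume "\<epsilon> > 0"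
    then show "\<exists>a b. a < b \<and> (\<forall>n. 1 - \<epsilon> < measure (\<nu> n) {a<..b})"
      by (intro exI[of _ "-1"] exI[of _ 1]) (auto simp: measure_def full[OF _ subset_trans[OF _ subset_refl]] subset_iff)
  qed
  from tight_imp_convergent_subsubsequence[OF this strict_mono_id]
  obtain r L where r: "strict_mono (r :: nat \<Rightarrow> nat)" and L: "real_distribution L" and conv: "weak_conv_m (\<nu> \<circ> r) L"
    by (auto simp: id_def o_def)
  interpret L: real_distribution L by (rule L)
  have [measurable]: "(space_filling :: real \<Rightarrow> real^'n) \<in> borel \<rightarrow>\<^sub>M borel"
    by (rule borel_measurable_continuous_onI[OF continuous_on_space_filling])
  have [measurable]: "(space_filling :: real \<Rightarrow> real^'n) \<in> L \<rightarrow>\<^sub>M borel"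
    by simp
  define M where "M = distr L borel (space_filling :: real \<Rightarrow> real^'n)"
  show thesis
  proof
    show "prob_space M" unfolding M_def by (rule L.prob_space_distr) simp
    show "sets M = sets borel" by (simp add: M_def)
    show "strict_mono r" by (rule r)
    have "AE x in L. \<forall>i. 0 \<le> (space_filling x :: real^'n) $ i \<and> (space_filling x :: real^'n) $ i \<le> 1"
      by (intro AE_I2) (auto simp: space_filling_in_cube)
    then show "AE z in M. \<forall>i. 0 \<le> z $ i \<and> z $ i \<le> 1"
      unfolding M_def by (subst AE_distr_iff) auto
    fix f :: "real^'n \<Rightarrow> real" assume f: "continuous_on UNIV f"
    have [measurable]: "f \<in> borel_measurable borel" by (rule borel_measurable_continuous_onI[OF f])
    have comp: "compact (cbox 0 1 :: (real^'n) set)" by (rule compact_cbox)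
    have "bounded (f ` cbox 0 1)"
      by (rule compact_imp_bounded[OF compact_continuous_image[OF continuous_on_subset[OF f] comp]]) auto
    then obtain C where C: "\<And>z. z \<in> cbox 0 1 \<Longrightarrow> norm (f z) \<le> C"
      unfolding bounded_iff by auto
    have "(\<lambda>N. integral\<^sup>L ((\<nu> \<circ> r) N) (\<lambda>x. f (space_filling x))) \<longlonglongrightarrow> integral\<^sup>L L (\<lambda>x. f (space_filling x))"
    proof (rule weak_conv_imp_integral_bdd_continuous_conv[OF _ L conv])
      show "real_distribution ((\<nu> \<circ> r) N)" for N using rd by simp
      have "continuous_on UNIV (\<lambda>x. f (space_filling x))"
        by (rule continuous_on_compose2[OF f continuous_on_space_filling]) auto
      then show "isCont (\<lambda>x. f (space_filling x)) x" for x
        by (simp add: continuous_on_eq_continuous_at)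
      show "norm (f (space_filling x)) \<le> C" for x
        by (rule C) (auto simp: mem_box_cart space_filling_in_cube)
    qed
    moreover have "integral\<^sup>L (\<nu> N) (\<lambda>x. f (space_filling x)) = (\<Sum>z\<in>A N. w N z * f (pt N z))" for N
    proof -
      have "integral\<^sup>L (\<nu> N) (\<lambda>x. f (space_filling x)) = (\<Sum>z\<in>A N. w N z *\<^sub>R f (space_filling (s (pt N z))))"
        unfolding \<nu>_def by (subst integral_distr) (auto simp: lebesgue_integral_point_measure_finite fin w)
      then show ?thesis by (simp add: sA)
    qed
    ultimately show "(\<lambda>N. \<Sum>z\<in>A (r N). w (r N) z * f (pt (r N) z)) \<longlonglongrightarrow> integral\<^sup>L M f"
      unfolding M_def by (subst integral_distr) auto
  qed
qed


section \<open>The Hausdorff moment problem on the cube\<close>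

text \<open>
  The Bernstein operator reproduces falling factorials: up to the constant \<open>N choose m\<close> it sends
  \<open>k choose m\<close> to \<open>x\<^sup>m\<close> without error.  This is an identity in every commutative ring.
\<close>

lemma choose_weighted_bernstein_sum:
  fixes x :: "'r::comm_ring_1"
  assumes "m \<le> N"
  shows "(\<Sum>k\<le>N. of_nat ((N choose k) * (k choose m)) * (x ^ k * (1 - x) ^ (N - k))) = of_nat (N choose m) * x ^ m"
proof -
  have "(\<Sum>k\<le>N. of_nat ((N choose k) * (k choose m)) * (x ^ k * (1 - x) ^ (N - k)))
      = (\<Sum>k\<in>{m..N}. of_nat ((N choose k) * (k choose m)) * (x ^ k * (1 - x) ^ (N - k)))"
    by (rule sum.mono_neutral_right) (auto simp: not_le binomial_eq_0)
  also have "\<dots> = (\<Sum>k\<in>{m..N}. of_nat (N choose m) * x ^ m * (of_nat ((N - m) choose (k - m)) * (x ^ (k - m) * (1 - x) ^ (N - k))))"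
  proof (rule sum.cong)
    fix k assume k: "k \<in> {m..N}"
    have "x ^ k = x ^ m * x ^ (k - m)" using k by (simp flip: power_add)
    moreover have "(N choose k) * (k choose m) = (N choose m) * ((N - m) choose (k - m))"
      using k by (intro choose_mult) auto
    ultimately show "of_nat ((N choose k) * (k choose m)) * (x ^ k * (1 - x) ^ (N - k))
      = of_nat (N choose m) * x ^ m * (of_nat ((N - m) choose (k - m)) * (x ^ (k - m) * (1 - x) ^ (N - k)))"
      by (simp only: of_nat_mult) (simp add: mult_ac)
  qed simp
  also have "\<dots> = of_nat (N choose m) * x ^ m * (\<Sum>k\<in>{m..N}. of_nat ((N - m) choose (k - m)) * (x ^ (k - m) * (1 - x) ^ (N - k)))"
    by (simp add: sum_distrib_left)
  also have "(\<Sum>k\<in>{m..N}. of_nat ((N - m) choose (k - m)) * (x ^ (k - m) * (1 - x) ^ (N - k)))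
      = (\<Sum>l\<le>N - m. of_nat ((N - m) choose l) * x ^ l * (1 - x) ^ (N - m - l))"
    by (rule sum.reindex_bij_witness[of _ "\<lambda>l. l + m" "\<lambda>k. k - m"]) (use assms in \<open>auto simp: mult_ac\<close>)
  also have "\<dots> = (x + (1 - x)) ^ (N - m)" by (rule binomial_ring[symmetric])
  finally show ?thesis by simp
qed

lemma binomial_right_mono: "k \<le> N \<Longrightarrow> k choose m \<le> N choose m"
proof (induction N)
  case (Suc N)
  then show ?case by (cases "k = Suc N"; cases m) (auto intro: trans_le_add2)
qed simp

text \<open>
  Falling factorials approximate powers, uniformly in \<open>k\<close>.
\<close>

lemma choose_ratio_approx:
  assumes "k \<le> N" "m < N"
  shows "\<bar>real (k choose m) / real (N choose m) - (real k / real N) ^ m\<bar> \<le> real (m\<^sup>2) / real (N - m)"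
  using assms(2)
proof (induction m)
  case (Suc m)
  define b where "b m = real (k choose m) / real (N choose m)" for m
  have step: "real (j choose Suc m) = real (j choose m) * (real j - real m) / real (Suc m)" for j
  proof (cases "m \<le> j")
    case True
    have "Suc m * (j choose Suc m) = (j - m) * (j choose m)"
      by (metis binomial_absorb_comp binomial_absorption mult.commute True Suc_times_binomial_eq diff_Suc_1 binomial_absorption)
    then have "real (Suc m) * real (j choose Suc m) = (real j - real m) * real (j choose m)"
      using True by (metis of_nat_diff of_nat_mult)
    then show ?thesis by (simp add: field_simps)
  qed (simp add: binomial_eq_0)
  have b1: "b (Suc m) = b m * ((real k - real m) / (real N - real m))"
    using Suc.prems unfolding b_def step by simp
  have b01: "0 \<le> b m" "b m \<le> 1"
    using assms(1) Suc.prems binomial_right_mono[of k N m] by (auto simp: b_def divide_simps)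
  have diff: "(real k - real m) / (real N - real m) - real k / real N = - (real m * (real N - real k) / (real N * (real N - real m)))"
    using Suc.prems by (simp add: divide_simps) (simp add: algebra_simps)
  have small: "\<bar>(real k - real m) / (real N - real m) - real k / real N\<bar> \<le> real m / (real N - real m)"
  proof -
    have "real m * (real N - real k) / (real N * (real N - real m)) \<le> real m * real N / (real N * (real N - real m))"
      using Suc.prems by (intro divide_right_mono mult_left_mono) auto
    then show ?thesis using Suc.prems assms(1) unfolding diff by (simp add: abs_mult)
  qed
  have "b (Suc m) - (real k / real N) ^ Suc m
      = b m * ((real k - real m) / (real N - real m) - real k / real N) + (b m - (real k / real N) ^ m) * (real k / real N)"
    unfolding b1 by (simp add: algebra_simps)
  also have "\<bar>\<dots>\<bar> \<le> 1 * (real m / (real N - real m)) + (real (m\<^sup>2) / real (N - m)) * 1"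
    using b01 small Suc.IH[folded b_def] Suc.prems assms(1)
    by (intro order_trans[OF abs_triangle_ineq] add_mono; unfold abs_mult; intro mult_mono) auto
  also have "\<dots> = real (m * (m + 1)) / (real N - real m)"
    using Suc.prems by (simp add: of_nat_diff add_divide_distrib[symmetric] power2_eq_square algebra_simps)
  also have "\<dots> \<le> real ((Suc m)\<^sup>2) / (real N - real (Suc m))"
    using Suc.prems by (intro frac_le) (auto simp: power2_eq_square algebra_simps)
  finally show ?case using Suc.prems by (simp add: of_nat_diff b_def)
qed simp

text \<open>
  The numbers \<open>\<Lambda> (\<Prod>\<^sub>i (N choose k\<^sub>i) x\<^sub>i\<^bsup>k\<^sub>i\<^esup> (1 - x\<^sub>i)\<^bsup>N - k\<^sub>i\<^esup>)\<close> are nonnegative weights of total mass \<open>\<Lambda> 1\<close>.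
  Placed at the points \<open>k / N\<close>, they form measures whose moments converge to those prescribed, because the moments
  with respect to falling factorials are already exact.  The \<open>x\<^sub>i\<close> lie in an arbitrary commutative ring, so that
  translation operators can be inserted for them.
\<close>

lemma hausdorff_moment:
  fixes \<Lambda> :: "'r::comm_ring_1 \<Rightarrow> real" and x :: "'n::finite \<Rightarrow> 'r"
  assumes add: "\<And>a b. \<Lambda> (a + b) = \<Lambda> a + \<Lambda> b"
    and pos: "\<And>k p. 0 \<le> \<Lambda> (\<Prod>i\<in>UNIV. x i ^ k i * (1 - x i) ^ p i)"
  obtains M :: "(real^'n) measure" where "finite_measure M" "sets M = sets borel"
    "AE z in M. \<forall>i. 0 \<le> z $ i \<and> z $ i \<le> 1"
    "\<And>m. (\<integral>z. (\<Prod>i\<in>UNIV. (z $ i) ^ m i) \<partial>M) = \<Lambda> (\<Prod>i\<in>UNIV. x i ^ m i)"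
proof -
  have zero: "\<Lambda> 0 = 0" using add[of 0 0] by simp
  have sum: "\<Lambda> (sum f I) = (\<Sum>i\<in>I. \<Lambda> (f i))" for f :: "('n \<Rightarrow> nat) \<Rightarrow> 'r" and I
    by (induction I rule: infinite_finite_induct) (auto simp: zero add)
  have mult: "\<Lambda> (of_nat c * y) = real c * \<Lambda> y" for c y
    by (induction c) (auto simp: zero add algebra_simps)
  define K where "K N = (\<Pi>\<^sub>E i\<in>(UNIV::'n set). {..N::nat})" for N
  define w where "w N k = real (\<Prod>i\<in>UNIV. N choose k i) * \<Lambda> (\<Prod>i\<in>UNIV. x i ^ k i * (1 - x i) ^ (N - k i))" for N and k :: "'n \<Rightarrow> nat"
  have finK: "finite (K N)" for N by (simp add: K_def finite_PiE)
  have w_nonneg: "0 \<le> w N k" for N k unfolding w_def by (intro mult_nonneg_nonneg pos) (rule of_nat_0_le_iff)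
  \<comment> \<open>exact moments with respect to the functions \<open>k choose m\<close>, before passing to the limit\<close>
  have repr: "\<Lambda> (\<Prod>i\<in>UNIV. x i ^ m i) = (\<Sum>k\<in>K N. w N k * (\<Prod>i\<in>UNIV. real (k i choose m i) / real (N choose m i)))"
    if m: "\<And>i. m i \<le> N" for m N
  proof -
    have "real (\<Prod>i\<in>UNIV. N choose m i) * \<Lambda> (\<Prod>i\<in>UNIV. x i ^ m i) = \<Lambda> (\<Prod>i\<in>UNIV. of_nat (N choose m i) * x i ^ m i)"
      by (simp only: mult[symmetric] prod.distrib of_nat_prod[symmetric])
    also have "(\<Prod>i\<in>UNIV. of_nat (N choose m i) * x i ^ m i)
       = (\<Prod>i\<in>UNIV. \<Sum>k\<le>N. of_nat ((N choose k) * (k choose m i)) * (x i ^ k * (1 - x i) ^ (N - k)))"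
      by (intro prod.cong choose_weighted_bernstein_sum[symmetric] m refl)
    also have "\<dots> = (\<Sum>k\<in>K N. \<Prod>i\<in>UNIV. of_nat ((N choose k i) * (k i choose m i)) * (x i ^ k i * (1 - x i) ^ (N - k i)))"
      unfolding K_def by (intro prod_sum_PiE) auto
    also have "\<Lambda> \<dots> = (\<Sum>k\<in>K N. real (\<Prod>i\<in>UNIV. (N choose k i) * (k i choose m i)) * \<Lambda> (\<Prod>i\<in>UNIV. x i ^ k i * (1 - x i) ^ (N - k i)))"
      unfolding sum by (simp only: mult[symmetric]) (simp add: prod.distrib)
    also have "\<dots> = (\<Sum>k\<in>K N. w N k * (\<Prod>i\<in>UNIV. real (k i choose m i)))"
      by (simp add: w_def prod.distrib mult_ac)
    finally have "\<Lambda> (\<Prod>i\<in>UNIV. x i ^ m i) = (\<Sum>k\<in>K N. w N k * (\<Prod>i\<in>UNIV. real (k i choose m i))) / (\<Prod>i\<in>UNIV. real (N choose m i))"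
      using m by (simp add: nonzero_eq_divide_eq mult.commute binomial_eq_0_iff not_less)
    then show ?thesis by (simp add: sum_divide_distrib prod_dividef)
  qed
  have total: "(\<Sum>k\<in>K N. w N k) = \<Lambda> 1" for N
    using repr[of "\<lambda>_. 0" N] by simp
  show thesis
  proof (cases "\<Lambda> 1 = 0")
    case True
    have "w N k = 0" if "k \<in> K N" for N k
      using total[of N] True w_nonneg that finK by (simp add: sum_nonneg_eq_0_iff)
    then have "\<Lambda> (\<Prod>i\<in>UNIV. x i ^ m i) = 0" for m
      using repr[of m "Max (range m)"] by simp
    then show thesis by (intro that[of "null_measure borel"]) (auto simp: finite_measureI AE_iff_null null_sets_def)
  next
    case False
    then have pos1: "0 < \<Lambda> 1" using total[of 0] sum_nonneg[of "K 0" "w 0"] w_nonneg by force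
    have cube: "0 \<le> (\<chi> i. real (k i) / real N) $ i \<and> (\<chi> i. real (k i) / real N) $ i \<le> 1" if "k \<in> K N" for N k and i :: 'n
      using that by (auto simp: K_def PiE_iff divide_simps)
    obtain M :: "(real^'n) measure" and r :: "nat \<Rightarrow> nat" where M: "prob_space M" "sets M = sets borel" "strict_mono r"
      "AE z in M. \<forall>i. 0 \<le> z $ i \<and> z $ i \<le> 1" and
      lim: "\<And>f. continuous_on UNIV f \<Longrightarrow>
        (\<lambda>N. \<Sum>k\<in>K (r N). (w (r N) k / \<Lambda> 1) * f (\<chi> i. real (k i) / real (r N))) \<longlonglongrightarrow> integral\<^sup>L M f"
    proof (rule cube_weak_compactness[of K "\<lambda>N k. (\<chi> i. real (k i) / real N)" "\<lambda>N k. w N k / \<Lambda> 1"])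
      show "(\<Sum>k\<in>K N. w N k / \<Lambda> 1) = 1" for N
        using total[of N] False by (simp flip: sum_divide_distrib)
    qed (use finK cube w_nonneg pos1 in auto)
    have moment: "(\<integral>z. (\<Prod>i\<in>UNIV. (z $ i) ^ m i) \<partial>M) = \<Lambda> (\<Prod>i\<in>UNIV. x i ^ m i) / \<Lambda> 1" for m
    proof -
      let ?S = "\<lambda>N. \<Sum>k\<in>K N. (w N k / \<Lambda> 1) * (\<Prod>i\<in>UNIV. (real (k i) / real N) ^ m i)"
      let ?e = "\<lambda>N. \<Sum>i\<in>UNIV. real ((m i)\<^sup>2) / (real N - real (m i))"
      have bound: "\<bar>?S N - \<Lambda> (\<Prod>i\<in>UNIV. x i ^ m i) / \<Lambda> 1\<bar> \<le> ?e N" if N: "Max (range m) < N" for N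
      proof -
        have mi: "m i < N" for i by (rule le_less_trans[OF Max_ge N]) auto
        have "?S N - \<Lambda> (\<Prod>i\<in>UNIV. x i ^ m i) / \<Lambda> 1
          = (\<Sum>k\<in>K N. (w N k / \<Lambda> 1) * ((\<Prod>i\<in>UNIV. (real (k i) / real N) ^ m i) - (\<Prod>i\<in>UNIV. real (k i choose m i) / real (N choose m i))))"
          using repr[of m N] mi by (simp add: less_imp_le right_diff_distrib sum_subtractf sum_divide_distrib)
        also have "\<bar>\<dots>\<bar> \<le> (\<Sum>k\<in>K N. (w N k / \<Lambda> 1) * ?e N)"
        proof (rule order_trans[OF sum_abs], rule sum_mono)
          fix k assume k: "k \<in> K N"
          have ki: "k i \<le> N" for i using k by (auto simp: K_def PiE_iff)
          have ratio01: "real (k i) / real N \<le> 1" "real (k i choose m i) / real (N choose m i) \<le> 1" for i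
            using ki[of i] mi[of i] binomial_right_mono[OF ki[of i], of "m i"] by (auto simp: divide_simps)
          have "\<bar>(\<Prod>i\<in>UNIV. (real (k i) / real N) ^ m i) - (\<Prod>i\<in>UNIV. real (k i choose m i) / real (N choose m i))\<bar>
             \<le> (\<Sum>i\<in>UNIV. \<bar>(real (k i) / real N) ^ m i - real (k i choose m i) / real (N choose m i)\<bar>)"
            using norm_prod_diff[of UNIV "\<lambda>i. (real (k i) / real N) ^ m i" "\<lambda>i. real (k i choose m i) / real (N choose m i)"]
              ki mi ratio01 by (auto simp: power_le_one)
          also have "\<dots> \<le> ?e N"
          proof (rule sum_mono)
            fix i
            show "\<bar>(real (k i) / real N) ^ m i - real (k i choose m i) / real (N choose m i)\<bar> \<le> real ((m i)\<^sup>2) / (real N - real (m i))"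
              using choose_ratio_approx[OF ki[of i] mi[of i]] mi[of i] by (simp add: of_nat_diff abs_minus_commute)
          qed
          finally show "\<bar>(w N k / \<Lambda> 1) * ((\<Prod>i\<in>UNIV. (real (k i) / real N) ^ m i) - (\<Prod>i\<in>UNIV. real (k i choose m i) / real (N choose m i)))\<bar> \<le> (w N k / \<Lambda> 1) * ?e N"
            unfolding abs_mult using w_nonneg[of N k] pos1 by (simp add: mult_left_mono divide_right_mono)
        qed
        also have "\<dots> = ?e N"
          using total[of N] False by (simp flip: sum_distrib_right sum_divide_distrib)
        finally show ?thesis .
      qed
      have e0: "?e \<longlonglongrightarrow> 0"
        by (rule tendsto_null_sum) real_asymp
      have "(\<lambda>N. ?S N - \<Lambda> (\<Prod>i\<in>UNIV. x i ^ m i) / \<Lambda> 1) \<longlonglongrightarrow> 0"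
        by (rule Lim_null_comparison[OF _ e0]) (use bound in \<open>auto simp del: Max_less_iff simp: eventually_sequentially Suc_le_eq intro!: exI[of _ "Suc (Max (range m))"]\<close>)
      then have "?S \<longlonglongrightarrow> \<Lambda> (\<Prod>i\<in>UNIV. x i ^ m i) / \<Lambda> 1"
        by (simp add: LIM_zero_iff)
      then have "(?S \<circ> r) \<longlonglongrightarrow> \<Lambda> (\<Prod>i\<in>UNIV. x i ^ m i) / \<Lambda> 1"
        by (rule LIMSEQ_subseq_LIMSEQ[OF _ M(3)])
      moreover have "(?S \<circ> r) \<longlonglongrightarrow> (\<integral>z. (\<Prod>i\<in>UNIV. (z $ i) ^ m i) \<partial>M)"
        using lim[of "\<lambda>z. \<Prod>i\<in>UNIV. (z $ i) ^ m i"] by (simp add: o_def continuous_intros)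
      ultimately show ?thesis by (rule LIMSEQ_unique[rotated])
    qed
    interpret M: prob_space M by (rule M)
    note [measurable_cong] = M(2)
    show thesis
    proof
      show "finite_measure (density M (\<lambda>_. ennreal (\<Lambda> 1)))"
        by (intro finite_measureI) (auto simp: emeasure_density nn_integral_cmult_indicator M.emeasure_space_1 ennreal_mult_eq_top_iff)
      show "sets (density M (\<lambda>_. ennreal (\<Lambda> 1))) = sets borel" by (simp add: M)
      show "AE z in density M (\<lambda>_. ennreal (\<Lambda> 1)). \<forall>i. 0 \<le> z $ i \<and> z $ i \<le> 1"
        using M(4) by (subst AE_density) auto
      show "(\<integral>z. (\<Prod>i\<in>UNIV. (z $ i) ^ m i) \<partial>density M (\<lambda>_. ennreal (\<Lambda> 1))) = \<Lambda> (\<Prod>i\<in>UNIV. x i ^ m i)" for m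
        using moment[of m] pos1 by (subst integral_density) auto
    qed
  qed
qed


section \<open>Uniqueness of the Laplace transform\<close>

inductive monomial_sum :: "(real^'n::finite \<Rightarrow> real) \<Rightarrow> bool" where
  monomial: "monomial_sum (\<lambda>z. c * (\<Prod>i\<in>UNIV. (z $ i) ^ m i))"
| add: "monomial_sum f \<Longrightarrow> monomial_sum g \<Longrightarrow> monomial_sum (\<lambda>z. f z + g z)"

lemma monomial_sum_mult:
  assumes "monomial_sum f" "monomial_sum g"
  shows "monomial_sum (\<lambda>z. f z * g z)"
  using assms
proof (induction arbitrary: g rule: monomial_sum.induct)
  case (monomial c m)
  from monomial show ?case
  proof (induction rule: monomial_sum.induct)
    case (monomial d k)
    have "(\<lambda>z. (c * (\<Prod>i\<in>UNIV. (z $ i) ^ m i)) * (d * (\<Prod>i\<in>UNIV. (z $ i) ^ k i)))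
        = (\<lambda>z. (c * d) * (\<Prod>i\<in>UNIV. (z $ i) ^ (m i + k i)))"
      by (auto simp: power_add prod.distrib mult_ac)
    then show ?case by (simp only: monomial_sum.monomial)
  qed (simp add: distrib_left monomial_sum.add)
qed (simp add: distrib_right monomial_sum.add)

lemma monomial_sum_approx:
  fixes f :: "real^'n::finite \<Rightarrow> real"
  assumes "continuous_on (cbox 0 1) f" "0 < e"
  obtains p where "monomial_sum p" "\<And>z. z \<in> cbox 0 1 \<Longrightarrow> \<bar>f z - p z\<bar> < e"
proof -
  have "\<exists>p. monomial_sum p \<and> (\<forall>z\<in>cbox 0 1. \<bar>f z - p z\<bar> < e)"
  proof (rule Stone_Weierstrass_HOL[where P = monomial_sum])
    show "monomial_sum (\<lambda>z. c)" for c
      using monomial_sum.monomial[of c "\<lambda>_. 0"] by simp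
    show "continuous_on (cbox 0 1) p" if "monomial_sum p" for p :: "real^'n \<Rightarrow> real"
      using that by induction (auto intro!: continuous_intros)
    show "\<exists>p. monomial_sum p \<and> p x \<noteq> p y" if xy: "x \<in> cbox 0 1 \<and> y \<in> cbox 0 1 \<and> x \<noteq> y" for x y :: "real^'n"
    proof -
      obtain i where i: "x $ i \<noteq> y $ i" using xy unfolding vec_eq_iff by blast
      have "(\<Prod>j\<in>UNIV. (z $ j) ^ (if j = i then 1 else 0)) = z $ i" for z :: "real^'n"
        by (subst prod.remove[of _ i]) (auto intro: prod.neutral)
      then show ?thesis
        using i monomial_sum.monomial[of 1 "\<lambda>j. if j = i then 1 else 0"] by (intro exI conjI) auto
    qed
  qed (use assms in \<open>auto intro: monomial_sum.add monomial_sum_mult\<close>)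
  then obtain p where "monomial_sum p" "\<forall>z\<in>cbox 0 1. \<bar>f z - p z\<bar> < e" by metis
  then show thesis by (intro that[of p]) auto
qed

lemma borel_eq_sigma_closed: "sets (borel :: 'a::topological_space measure) = sigma_sets UNIV {S. closed S}"
proof (rule antisym)
  have "S \<in> sigma_sets UNIV {S. closed S}" if "open S" for S :: "'a set"
  proof -
    have "UNIV - (- S) \<in> sigma_sets UNIV {S. closed S}"
      by (rule sigma_sets.Compl) (use that in auto)
    then show ?thesis by simp
  qed
  then show "sets (borel :: 'a measure) \<subseteq> sigma_sets UNIV {S. closed S}"
    unfolding sets_borel by (intro sigma_sets_mono) auto
  show "sigma_sets UNIV {S. closed S} \<subseteq> sets (borel :: 'a measure)"
    by (intro sets.sigma_sets_subset[of _ borel, simplified]) auto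
qed

text \<open>
  The indicator of a closed set \<open>C\<close> is the limit of the continuous functions \<open>max 0 (1 - k * infdist x C)\<close>, and
  closed sets generate the Borel sets.
\<close>

lemma finite_measure_eqI_continuous:
  fixes M M' :: "('a::metric_space) measure"
  assumes "finite_measure M" "finite_measure M'" and sets: "sets M = sets borel" "sets M' = sets borel"
    and eq: "\<And>f :: 'a \<Rightarrow> real. continuous_on UNIV f \<Longrightarrow> (\<And>x. 0 \<le> f x \<and> f x \<le> 1) \<Longrightarrow> integral\<^sup>L M f = integral\<^sup>L M' f"
  shows "M = M'"
proof (rule measure_eqI_generator_eq[where \<Omega> = UNIV and E = "{S. closed S}" and A = "\<lambda>_. UNIV"])
  show "Int_stable {S :: 'a set. closed S}" by (auto simp: Int_stable_def)
  show "sets M = sigma_sets UNIV {S. closed S}" "sets M' = sigma_sets UNIV {S. closed S}"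
    using sets borel_eq_sigma_closed by auto
  have lim: "(\<lambda>k. integral\<^sup>L N (\<lambda>x. max 0 (1 - real k * infdist x C))) \<longlonglongrightarrow> measure N C"
    if N: "finite_measure N" "sets N = sets borel" and C: "closed C" "C \<noteq> {}" for N :: "'a measure" and C
  proof -
    interpret finite_measure N by (rule N)
    note [measurable_cong] = N(2)
    have [measurable]: "C \<in> sets borel" using C by simp
    have cont: "continuous_on UNIV (\<lambda>x. max 0 (1 - real k * infdist x C))" for k
      by (intro continuous_intros)
    have [measurable]: "(\<lambda>x. max 0 (1 - real k * infdist x C)) \<in> borel_measurable borel" for k
      by (rule borel_measurable_continuous_onI[OF cont])
    have "(\<lambda>k. integral\<^sup>L N (\<lambda>x. max 0 (1 - real k * infdist x C))) \<longlonglongrightarrow> integral\<^sup>L N (indicator C)"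
    proof (rule integral_dominated_convergence[where w = "\<lambda>_. 1"])
      show "AE x in N. (\<lambda>k. max 0 (1 - real k * infdist x C)) \<longlonglongrightarrow> indicator C x"
      proof (intro AE_I2)
        fix x
        show "(\<lambda>k. max 0 (1 - real k * infdist x C)) \<longlonglongrightarrow> indicator C x"
        proof (cases "x \<in> C")
          case False
          then have pos: "0 < infdist x C"
            using C in_closed_iff_infdist_zero[of C x] infdist_nonneg[of x C] by (auto simp: less_le)
          have "eventually (\<lambda>k. 1 / infdist x C \<le> real k) sequentially"
            using filterlim_real_sequentially by (simp add: filterlim_at_top)
          then have "eventually (\<lambda>k. max 0 (1 - real k * infdist x C) = 0) sequentially"
            by eventually_elim (use pos in \<open>auto simp: field_simps\<close>)
          then show ?thesis using False by (simp add: tendsto_eventually)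
        qed simp
      qed
      show "AE x in N. norm (max 0 (1 - real k * infdist x C)) \<le> 1" for k
        by (intro AE_I2) (auto simp: infdist_nonneg)
      show "(\<lambda>x. indicator C x :: real) \<in> borel_measurable N" by measurable
      show "integrable N (\<lambda>_. 1 :: real)" by simp
      show "(\<lambda>x. max 0 (1 - real k * infdist x C)) \<in> borel_measurable N" for k by measurable
    qed
    then show ?thesis using N by (simp add: sets_eq_imp_space_eq)
  qed
  show "emeasure M C = emeasure M' C" if "C \<in> {S. closed S}" for C
  proof (cases "C = {}")
    case False
    have "measure M C = measure M' C"
    proof (rule LIMSEQ_unique)
      show "(\<lambda>k. integral\<^sup>L M (\<lambda>x. max 0 (1 - real k * infdist x C))) \<longlonglongrightarrow> measure M C"
        using lim assms that False by auto
      have "integral\<^sup>L M (\<lambda>x. max 0 (1 - real k * infdist x C)) = integral\<^sup>L M' (\<lambda>x. max 0 (1 - real k * infdist x C))" for k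
        by (rule eq) (auto intro!: continuous_intros simp: infdist_nonneg)
      then show "(\<lambda>k. integral\<^sup>L M (\<lambda>x. max 0 (1 - real k * infdist x C))) \<longlonglongrightarrow> measure M' C"
        using lim[of M' C] assms that False by auto
    qed
    then show ?thesis using assms(1,2) by (simp add: finite_measure.emeasure_eq_measure)
  qed simp
  show "emeasure M UNIV \<noteq> \<infinity>" using assms(1) by (simp add: finite_measure.emeasure_eq_measure)
qed auto

lemma integrable_bounded_AE:
  fixes f :: "'a \<Rightarrow> real"
  assumes "finite_measure M" "f \<in> borel_measurable M" "AE x in M. \<bar>f x\<bar> \<le> B"
  shows "integrable M f"
  using finite_measure.integrable_const_bound[OF assms(1), of f B] assms by simp

text \<open>
  Monomials span a dense subspace of the continuous functions on the cube by Stone--Weierstrass.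
\<close>

lemma moment_uniqueness:
  fixes M M' :: "(real^'n::finite) measure"
  assumes fin: "finite_measure M" "finite_measure M'" and sets: "sets M = sets borel" "sets M' = sets borel"
    and cube: "AE z in M. z \<in> cbox 0 1" "AE z in M'. z \<in> cbox 0 1"
    and eq: "\<And>m. (\<integral>z. (\<Prod>i\<in>UNIV. (z $ i) ^ m i) \<partial>M) = (\<integral>z. (\<Prod>i\<in>UNIV. (z $ i) ^ m i) \<partial>M')"
  shows "M = M'"
proof (rule finite_measure_eqI_continuous[OF fin sets])
  fix f :: "real^'n \<Rightarrow> real" assume f: "continuous_on UNIV f"
  have int: "integrable N p" if p: "continuous_on UNIV p" and N: "finite_measure N" "sets N = sets borel" "AE z in N. z \<in> cbox 0 1"
    for p :: "real^'n \<Rightarrow> real" and N :: "(real^'n) measure"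
  proof -
    note [measurable_cong] = N(2)
    have [measurable]: "p \<in> borel_measurable borel" by (rule borel_measurable_continuous_onI[OF p])
    have "bounded (p ` cbox 0 1)"
      by (intro compact_imp_bounded compact_continuous_image continuous_on_subset[OF p]) auto
    then obtain C where C: "\<And>z. z \<in> cbox 0 1 \<Longrightarrow> \<bar>p z\<bar> \<le> C" unfolding bounded_iff by auto
    show ?thesis by (rule integrable_bounded_AE[OF N(1)]) (use N(3) C in auto)
  qed
  have cont: "continuous_on UNIV p" if "monomial_sum p" for p :: "real^'n \<Rightarrow> real"
    using that by induction (auto intro!: continuous_intros)
  have poly: "integral\<^sup>L M p = integral\<^sup>L M' p" if "monomial_sum p" for p
    using that
  proof induction
    case (add p q)
    then show ?case
      using int[OF cont[OF add.hyps(1)]] int[OF cont[OF add.hyps(2)]] fin sets cube by simp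
  qed (simp add: eq)
  have approx: "\<bar>integral\<^sup>L N f - integral\<^sup>L N p\<bar> \<le> e * measure N (space N)"
    if p: "monomial_sum p" "\<And>z. z \<in> cbox 0 1 \<Longrightarrow> \<bar>f z - p z\<bar> < e"
      and N: "finite_measure N" "sets N = sets borel" "AE z in N. z \<in> cbox 0 1" for p e and N :: "(real^'n) measure"
  proof -
    interpret N: finite_measure N by (rule N)
    have i: "integrable N f" "integrable N p" using int f cont[OF p(1)] N by auto
    have "\<bar>integral\<^sup>L N f - integral\<^sup>L N p\<bar> = \<bar>\<integral>z. f z - p z \<partial>N\<bar>" using i by simp
    also have "\<dots> \<le> (\<integral>z. \<bar>f z - p z\<bar> \<partial>N)" by (rule integral_abs_bound)
    also have "\<dots> \<le> (\<integral>z. e \<partial>N)"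
      by (rule integral_mono_AE) (use i N(3) p(2) in \<open>auto intro: less_imp_le\<close>)
    finally show ?thesis by (simp add: mult.commute)
  qed
  have bound: "\<bar>integral\<^sup>L M f - integral\<^sup>L M' f\<bar> \<le> e * (measure M (space M) + measure M' (space M'))" if e: "0 < e" for e
  proof -
    obtain p where p: "monomial_sum p" "\<And>z. z \<in> cbox 0 1 \<Longrightarrow> \<bar>f z - p z\<bar> < e"
      using monomial_sum_approx[OF continuous_on_subset[OF f subset_UNIV] e] by metis
    show ?thesis
      using approx[OF p fin(1) sets(1) cube(1)] approx[OF p fin(2) sets(2) cube(2)] poly[OF p(1)]
      by (simp add: distrib_left)
  qed
  \<comment> \<open>adding \<open>1\<close> makes \<open>B\<close> positive also for zero measures\<close>
  define B where "B = measure M (space M) + measure M' (space M') + 1"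
  have B: "0 < B" unfolding B_def by (simp add: add_nonneg_pos)
  have "\<bar>integral\<^sup>L M f - integral\<^sup>L M' f\<bar> \<le> d" if "0 < d" for d
  proof -
    have "d / B * (measure M (space M) + measure M' (space M')) \<le> d / B * B"
      using that B by (intro mult_left_mono) (auto simp: B_def)
    then show ?thesis using bound[of "d / B"] that B by auto
  qed
  then show "integral\<^sup>L M f = integral\<^sup>L M' f"
    using dense_ge[of 0 "\<bar>integral\<^sup>L M f - integral\<^sup>L M' f\<bar>"] by simp
qed

definition exp_neg :: "real^'n \<Rightarrow> real^'n::finite" where
  "exp_neg r = (\<chi> i. exp (- (r $ i)))"

lemma borel_measurable_vec_lambda:
  fixes f :: "'n::finite \<Rightarrow> 'a \<Rightarrow> real"
  assumes "\<And>i. f i \<in> borel_measurable M"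
  shows "(\<lambda>x. \<chi> i. f i x) \<in> borel_measurable M"
proof (subst borel_measurable_euclidean_space, intro ballI)
  fix b :: "real^'n" assume "b \<in> Basis"
  then obtain i where "b = axis i 1" by (auto simp: Basis_vec_def)
  then show "(\<lambda>x. (\<chi> i. f i x) \<bullet> b) \<in> borel_measurable M"
    using assms by (simp add: inner_axis)
qed

lemma exp_inner_eq_prod: "exp (- (r \<bullet> t)) = (\<Prod>i\<in>UNIV. exp (- (r $ i * t $ i)))" for r t :: "real^'n::finite"
  by (simp add: inner_vec_def exp_sum flip: sum_negf)

text \<open>
  The injective map \<open>r \<mapsto> exp (- r)\<close> turns the values of the Laplace transform at integer points into moments on
  the cube.
\<close>

theorem laplace_uniqueness:
  fixes M M' :: "(real^'n::finite) measure"
  assumes fin: "finite_measure M" "finite_measure M'" and sets: "sets M = sets borel" "sets M' = sets borel"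
    and orth: "AE r in M. r \<in> orthant" "AE r in M'. r \<in> orthant"
    and eq: "\<And>t. t \<in> orthant \<Longrightarrow> (\<integral>r. exp (- (r \<bullet> t)) \<partial>M) = (\<integral>r. exp (- (r \<bullet> t)) \<partial>M')"
  shows "M = M'"
proof -
  note [measurable_cong] = sets
  have cont: "continuous_on UNIV (exp_neg :: real^'n \<Rightarrow> real^'n)"
    unfolding exp_neg_def by (intro continuous_intros)
  have [measurable]: "(exp_neg :: real^'n \<Rightarrow> real^'n) \<in> borel \<rightarrow>\<^sub>M borel"
    by (rule borel_measurable_continuous_onI[OF cont])
  define log_neg :: "real^'n \<Rightarrow> real^'n" where "log_neg z = (\<chi> i. - ln (z $ i))" for z
  have [measurable]: "(log_neg :: real^'n \<Rightarrow> real^'n) \<in> borel \<rightarrow>\<^sub>M borel"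
    unfolding log_neg_def by (rule borel_measurable_vec_lambda) auto
  have log_neg: "log_neg (exp_neg r) = r" for r by (simp add: log_neg_def exp_neg_def vec_eq_iff)
  have "distr M borel exp_neg = distr M' borel exp_neg"
  proof (rule moment_uniqueness)
    show "finite_measure (distr M borel exp_neg)" "finite_measure (distr M' borel exp_neg)"
      using fin by (auto intro!: finite_measure.finite_measure_distr)
    have cube: "exp_neg r \<in> cbox 0 1" if "r \<in> orthant" for r :: "real^'n"
      using that by (auto simp: mem_box_cart exp_neg_def orthant_def)
    show "AE z in distr M borel exp_neg. z \<in> cbox 0 1"
      using orth(1) cube by (subst AE_distr_iff) auto
    show "AE z in distr M' borel exp_neg. z \<in> cbox 0 1"
      using orth(2) cube by (subst AE_distr_iff) auto
    fix m :: "'n \<Rightarrow> nat"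
    have pw: "(\<Prod>i\<in>UNIV. (exp_neg r $ i) ^ m i) = exp (- (r \<bullet> (\<chi> i. real (m i))))" for r :: "real^'n"
      by (simp add: exp_inner_eq_prod exp_neg_def flip: exp_of_nat_mult) (simp add: mult.commute)
    have mo: "(\<chi> i. real (m i)) \<in> orthant" by (simp add: orthant_def)
    show "(\<integral>z. (\<Prod>i\<in>UNIV. (z $ i) ^ m i) \<partial>distr M borel exp_neg) = (\<integral>z. (\<Prod>i\<in>UNIV. (z $ i) ^ m i) \<partial>distr M' borel exp_neg)"
      using eq[OF mo] by (simp add: integral_distr pw)
  qed (auto simp: sets)
  then have "distr (distr M borel exp_neg) borel log_neg = distr (distr M' borel exp_neg) borel log_neg" by simp
  moreover have "distr (distr N borel exp_neg) borel log_neg = N" if [measurable_cong]: "sets N = sets borel" for N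
    by (subst distr_distr) (auto simp: o_def log_neg that intro!: distr_id2)
  ultimately show ?thesis using sets by simp
qed


section \<open>Alternating functions are Laplace transforms\<close>

text \<open>
  The Hausdorff moment problem for the translations by \<open>h\<close> in the coordinate directions, with \<open>\<Lambda> y = dint y f\<close>.
\<close>

lemma root_measure_moments:
  fixes f :: "real^'n::finite \<Rightarrow> real"
  assumes cm: "\<And>t L. t \<in> orthant \<Longrightarrow> \<forall>(i, s)\<in>set L. 0 \<le> s \<Longrightarrow> 0 \<le> dint (dirac t * steps L) f"
    and h: "0 \<le> h"
  obtains M :: "(real^'n) measure" where "finite_measure M" "sets M = sets borel" "AE z in M. \<forall>i. 0 \<le> z $ i \<and> z $ i \<le> 1"
    "\<And>k. (\<integral>z. (\<Prod>i\<in>UNIV. (z $ i) ^ k i) \<partial>M) = f (\<chi> i. real (k i) * h)"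
proof -
  have monomial: "(\<Prod>i\<in>UNIV. dirac (axis i h) ^ k i) = dirac ((\<chi> i. real (k i) * h) :: real^'n)" for k
  proof -
    have "(\<chi> i. real (k i) * h) = (\<Sum>i\<in>UNIV. axis i (real (k i) * h) :: real^'n)"
      by (simp add: vec_eq_iff axis_def if_distrib[of "\<lambda>x. x = _"] cong: if_cong)
    then show ?thesis by (simp add: dirac_sum dirac_axis_power)
  qed
  have pos: "0 \<le> dint (\<Prod>i\<in>UNIV. dirac (axis i h) ^ k i * (1 - dirac (axis i h)) ^ p i) f" for k p :: "'n \<Rightarrow> nat"
  proof -
    obtain L where L: "steps L = (\<Prod>i\<in>(UNIV::'n set). step i h ^ p i)" "\<forall>(i, s)\<in>set L. s = h"
      by (rule steps_of_powers)
    have "0 \<le> dint (dirac (\<chi> i. real (k i) * h) * steps L) f"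
      by (rule cm) (use h L(2) in \<open>auto simp: orthant_def\<close>)
    then show ?thesis unfolding L(1) by (simp add: prod.distrib monomial step_def)
  qed
  obtain M :: "(real^'n) measure" where "finite_measure M" "sets M = sets borel" "AE z in M. \<forall>i. 0 \<le> z $ i \<and> z $ i \<le> 1"
    "\<And>m. (\<integral>z. (\<Prod>i\<in>UNIV. (z $ i) ^ m i) \<partial>M) = dint (\<Prod>i\<in>UNIV. dirac (axis i h) ^ m i) f"
    by (rule hausdorff_moment[of "\<lambda>\<mu>. dint \<mu> f" "\<lambda>i. dirac (axis i h)"]) (use dint_add pos in \<open>auto simp only:\<close>)
  then show thesis by (intro that) (auto simp: monomial)
qed

lemma laplace_tendsto:
  fixes M :: "(real^'n::finite) measure"
  assumes M: "finite_measure M" "sets M = sets borel" "AE r in M. r \<in> orthant"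
    and t: "\<And>m. t m \<in> orthant" "t \<longlonglongrightarrow> t0"
  shows "(\<lambda>m. \<integral>r. exp (- (r \<bullet> t m)) \<partial>M) \<longlonglongrightarrow> (\<integral>r. exp (- (r \<bullet> t0)) \<partial>M)"
proof (rule integral_dominated_convergence[where w = "\<lambda>_. 1"])
  interpret finite_measure M by (rule M)
  note [measurable_cong] = M(2)
  show "(\<lambda>r. exp (- (r \<bullet> t0))) \<in> borel_measurable M" "\<And>m. (\<lambda>r. exp (- (r \<bullet> t m))) \<in> borel_measurable M"
    by measurable
  show "integrable M (\<lambda>_. 1 :: real)" by simp
  show "AE r in M. (\<lambda>m. exp (- (r \<bullet> t m))) \<longlonglongrightarrow> exp (- (r \<bullet> t0))"
    by (intro AE_I2 tendsto_intros t)
  show "AE r in M. norm (exp (- (r \<bullet> t m))) \<le> 1" for m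
    using M(3) by eventually_elim (use t(1)[of m] in \<open>auto simp: inner_vec_def orthant_def intro!: sum_nonneg\<close>)
qed

text \<open>
  The Bernstein--Hausdorff--Widder theorem in several variables, for differences in place of derivatives.  The
  measure \<open>M 0\<close> represents \<open>f\<close> at integer points.  The measures for step \<open>1 / 2\<^sup>m\<close> are its images under taking
  roots, by uniqueness of moments, so \<open>M 0\<close> represents \<open>f\<close> at dyadic points.  Continuity of \<open>f\<close> at the origin
  excludes mass on the faces \<open>z\<^sub>i = 0\<close>, where \<open>z = exp (- r)\<close> has no solution, and then extends the
  representation to all points.
\<close>

theorem laplace_representation:
  fixes f :: "real^'n::finite \<Rightarrow> real"
  assumes cont: "continuous_on orthant f"
    and cm: "\<And>t L. t \<in> orthant \<Longrightarrow> \<forall>(i, s)\<in>set L. 0 \<le> s \<Longrightarrow> 0 \<le> dint (dirac t * steps L) f"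
  obtains \<rho> :: "(real^'n) measure" where "finite_measure \<rho>" "sets \<rho> = sets borel" "AE r in \<rho>. r \<in> orthant"
    "\<And>t. t \<in> orthant \<Longrightarrow> f t = (\<integral>r. exp (- (r \<bullet> t)) \<partial>\<rho>)"
proof -
  define P :: "nat \<Rightarrow> (real^'n) measure \<Rightarrow> bool" where "P m M \<longleftrightarrow> finite_measure M \<and> sets M = sets borel \<and>
    (AE z in M. \<forall>i. 0 \<le> z $ i \<and> z $ i \<le> 1) \<and>
    (\<forall>k. (\<integral>z. (\<Prod>i\<in>UNIV. (z $ i) ^ k i) \<partial>M) = f (\<chi> i. real (k i) * (1 / 2 ^ m)))" for m M
  have "\<exists>M. P m M" for m
  proof (rule root_measure_moments[of f "1 / 2 ^ m", OF cm])
    fix M :: "(real^'n) measure"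
    assume "finite_measure M" "sets M = sets borel" "AE z in M. \<forall>i. 0 \<le> z $ i \<and> z $ i \<le> 1"
      "\<And>k. (\<integral>z. (\<Prod>i\<in>UNIV. (z $ i) ^ k i) \<partial>M) = f (\<chi> i. real (k i) * (1 / 2 ^ m))"
    then show ?thesis unfolding P_def by blast
  qed auto
  then obtain M where "\<And>m. P m (M m)" by metis
  then have fin: "\<And>m. finite_measure (M m)" and sets: "\<And>m. sets (M m) = sets borel"
    and cube: "\<And>m. AE z in M m. \<forall>i. 0 \<le> z $ i \<and> z $ i \<le> 1"
    and mom: "\<And>m k. (\<integral>z. (\<Prod>i\<in>UNIV. (z $ i) ^ k i) \<partial>M m) = f (\<chi> i. real (k i) * (1 / 2 ^ m))"
    unfolding P_def by blast+
  note [measurable_cong] = sets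
  interpret M0: finite_measure "M 0" by (rule fin)
  have vec_power: "(\<lambda>z::real^'n. \<chi> i. (z $ i) ^ N) \<in> borel \<rightarrow>\<^sub>M borel" for N
    by (intro borel_measurable_vec_lambda) auto
  note [measurable] = vec_power
  \<comment> \<open>both sides have moments \<open>f k\<close>\<close>
  have push: "distr (M m) borel (\<lambda>z. \<chi> i. (z $ i) ^ (2 ^ m)) = M 0" for m
  proof (rule moment_uniqueness)
    show "finite_measure (distr (M m) borel (\<lambda>z. \<chi> i. (z $ i) ^ (2 ^ m)))"
      by (intro finite_measure.finite_measure_distr fin) measurable
    show "AE z in M 0. z \<in> cbox 0 1" using cube[of 0] by (simp add: mem_box_cart)
    show "AE z in distr (M m) borel (\<lambda>z. \<chi> i. (z $ i) ^ (2 ^ m)). z \<in> cbox 0 1"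
      using cube[of m] by (subst AE_distr_iff) (auto simp: mem_box_cart power_le_one elim: eventually_mono)
    fix k :: "'n \<Rightarrow> nat"
    have "(\<integral>z. (\<Prod>i\<in>UNIV. (z $ i) ^ k i) \<partial>distr (M m) borel (\<lambda>z. \<chi> i. (z $ i) ^ (2 ^ m)))
       = (\<integral>z. (\<Prod>i\<in>UNIV. (z $ i) ^ (2 ^ m * k i)) \<partial>M m)"
      by (subst integral_distr) (auto simp: power_mult)
    also have "\<dots> = f (\<chi> i. real (k i) * (1 / 2 ^ 0))"
      by (simp add: mom)
    also have "\<dots> = (\<integral>z. (\<Prod>i\<in>UNIV. (z $ i) ^ k i) \<partial>M 0)"
      by (simp only: mom)
    finally show "(\<integral>z. (\<Prod>i\<in>UNIV. (z $ i) ^ k i) \<partial>distr (M m) borel (\<lambda>z. \<chi> i. (z $ i) ^ (2 ^ m)))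
      = (\<integral>z. (\<Prod>i\<in>UNIV. (z $ i) ^ k i) \<partial>M 0)" .
  qed (auto simp: sets fin)
  have root_mom: "(\<integral>u. (\<Prod>i\<in>UNIV. root (2 ^ m) (u $ i) ^ k i) \<partial>M 0) = f (\<chi> i. real (k i) * (1 / 2 ^ m))" for m k
  proof -
    have "(\<integral>u. (\<Prod>i\<in>UNIV. root (2 ^ m) (u $ i) ^ k i) \<partial>M 0) = (\<integral>z. (\<Prod>i\<in>UNIV. root (2 ^ m) ((z $ i) ^ (2 ^ m)) ^ k i) \<partial>M m)"
      by (subst push[of m, symmetric], subst integral_distr) auto
    also have "\<dots> = (\<integral>z. (\<Prod>i\<in>UNIV. (z $ i) ^ k i) \<partial>M m)"
      by (rule integral_cong_AE) (use cube[of m] in \<open>auto simp: real_root_power_cancel elim!: eventually_mono intro!: prod.cong\<close>)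
    finally show ?thesis by (simp only: mom)
  qed
  \<comment> \<open>as \<open>m \<rightarrow> \<infinity>\<close>, the integral of \<open>u\<^sub>i\<close> to the power \<open>1 / 2\<^sup>m\<close> tends to the mass of \<open>u\<^sub>i > 0\<close>, but it equals
    \<open>f\<close> at \<open>1 / 2\<^sup>m\<close> on axis \<open>i\<close> and tends to \<open>f 0\<close>, the total mass\<close>
  have pos: "AE u in M 0. 0 < u $ i" for i
  proof -
    have ax: "(\<Prod>j\<in>UNIV. root (2 ^ m) (u $ j) ^ (if j = i then 1 else 0)) = root (2 ^ m) (u $ i)" for u :: "real^'n" and m :: nat
      by (subst prod.remove[of _ i]) (auto intro: prod.neutral)
    have lim1: "(\<lambda>m. \<integral>u. root (2 ^ m) (u $ i) \<partial>M 0) \<longlonglongrightarrow> (\<integral>u. indicator {u. 0 < u $ i} u \<partial>M 0)"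
    proof (rule integral_dominated_convergence[where w = "\<lambda>_. 1"])
      show "AE u in M 0. (\<lambda>m. root (2 ^ m) (u $ i)) \<longlonglongrightarrow> indicator {u. 0 < u $ i} u"
        using cube[of 0]
      proof eventually_elim
        case (elim u)
        show ?case
        proof (cases "u $ i = 0")
          case False
          then have u: "0 < u $ i" using elim by (metis less_le)
          have "filterlim (\<lambda>m. 2 ^ m :: nat) sequentially sequentially"
            by (rule filterlim_subseq) (auto simp: strict_mono_def)
          then have "(\<lambda>m. root (2 ^ m) (u $ i)) \<longlonglongrightarrow> 1"
            using filterlim_compose[OF LIMSEQ_root_const[OF u]] by blast
          then show ?thesis using u by simp
        qed simp
      qed
      show "AE u in M 0. norm (root (2 ^ m) (u $ i)) \<le> 1" for m
        using cube[of 0] by eventually_elim auto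
    qed auto
    have lim2: "(\<lambda>m. \<integral>u. root (2 ^ m) (u $ i) \<partial>M 0) \<longlonglongrightarrow> f 0"
    proof -
      have "(\<lambda>m. f (\<chi> j. real (if j = i then 1 else 0) * (1 / 2 ^ m))) \<longlonglongrightarrow> f 0"
      proof (rule continuous_on_tendsto_compose[OF cont])
        have "(\<lambda>m. (1 / 2 :: real) ^ m) \<longlonglongrightarrow> 0" by (rule LIMSEQ_realpow_zero) auto
        then show "(\<lambda>m. \<chi> j. real (if j = i then 1 else 0) * (1 / 2 ^ m)) \<longlonglongrightarrow> (0 :: real^'n)"
          by (intro vec_tendstoI) (auto simp: power_one_over intro!: tendsto_eq_intros)
      qed (auto simp: orthant_def)
      moreover have "f (\<chi> j. real (if j = i then 1 else 0) * (1 / 2 ^ m)) = (\<integral>u. root (2 ^ m) (u $ i) \<partial>M 0)" for m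
        using root_mom[of m "\<lambda>j. if j = i then 1 else 0"] by (simp only: ax)
      ultimately show ?thesis by simp
    qed
    have f0: "f 0 = measure (M 0) (space (M 0))"
      using mom[of 0 "\<lambda>_. 0"] by (simp add: zero_vec_def)
    have "(\<integral>u. indicator {u. 0 < u $ i} u \<partial>M 0) = measure (M 0) {u \<in> space (M 0). 0 < u $ i}"
      by (simp add: Int_def conj_commute)
    then have "measure (M 0) {u \<in> space (M 0). 0 < u $ i} = measure (M 0) (space (M 0))"
      using LIMSEQ_unique[OF lim1 lim2] f0 by simp
    then have "measure (M 0) (space (M 0) - {u \<in> space (M 0). 0 < u $ i}) = 0"
      using M0.finite_measure_compl[of "{u \<in> space (M 0). 0 < u $ i}"] by simp
    then have "space (M 0) - {u \<in> space (M 0). 0 < u $ i} \<in> null_sets (M 0)"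
      by (intro null_setsI) (auto simp: M0.emeasure_eq_measure)
    then show ?thesis by (rule AE_I') auto
  qed
  define log_neg :: "real^'n \<Rightarrow> real^'n" where "log_neg z = (\<chi> i. - ln (z $ i))" for z
  have [measurable]: "(log_neg :: real^'n \<Rightarrow> real^'n) \<in> borel \<rightarrow>\<^sub>M borel"
    unfolding log_neg_def by (rule borel_measurable_vec_lambda) auto
  define \<rho> where "\<rho> = distr (M 0) borel log_neg"
  have \<rho>: "finite_measure \<rho>" "sets \<rho> = sets borel"
    unfolding \<rho>_def by (auto intro!: finite_measure.finite_measure_distr fin)
  have posall: "AE u in M 0. \<forall>i. 0 < u $ i" using pos by (simp add: AE_all_countable)
  have "AE u in M 0. log_neg u \<in> orthant"
    using cube[of 0] posall by eventually_elim (auto simp: orthant_def log_neg_def)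
  then have \<rho>_orth: "AE r in \<rho>. r \<in> orthant"
    unfolding \<rho>_def by (subst AE_distr_iff) (auto simp: orthant_def)
  have dyadic: "f (\<chi> i. real (k i) / 2 ^ m) = (\<integral>r. exp (- (r \<bullet> (\<chi> i. real (k i) / 2 ^ m))) \<partial>\<rho>)" for k m
  proof -
    have "(\<integral>r. exp (- (r \<bullet> (\<chi> i. real (k i) / 2 ^ m))) \<partial>\<rho>) = (\<integral>u. exp (- (log_neg u \<bullet> (\<chi> i. real (k i) / 2 ^ m))) \<partial>M 0)"
      unfolding \<rho>_def by (subst integral_distr) auto
    also have "\<dots> = (\<integral>u. (\<Prod>i\<in>UNIV. root (2 ^ m) (u $ i) ^ k i) \<partial>M 0)"
    proof (rule integral_cong_AE)
      show "AE u in M 0. exp (- (log_neg u \<bullet> (\<chi> i. real (k i) / 2 ^ m))) = (\<Prod>i\<in>UNIV. root (2 ^ m) (u $ i) ^ k i)"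
        using posall
      proof eventually_elim
        case (elim u)
        have "root (2 ^ m) (u $ i) ^ k i = exp (ln (u $ i) * (real (k i) / 2 ^ m))" for i
        proof -
          have "root (2 ^ m) (u $ i) = exp (ln (u $ i) / 2 ^ m)"
            using spec[OF elim, of i] by (subst root_powr_inverse) (simp_all add: powr_def field_simps)
          then show ?thesis by (simp add: mult.commute flip: exp_of_nat_mult)
        qed
        then show ?case by (simp add: exp_inner_eq_prod log_neg_def)
      qed
    qed auto
    finally show ?thesis by (simp add: root_mom)
  qed
  show thesis
  proof
    fix t :: "real^'n" assume t: "t \<in> orthant"
    \<comment> \<open>dyadic approximation of \<open>t\<close> from below\<close>
    define s where "s m = (\<chi> i. real (nat \<lfloor>2 ^ m * t $ i\<rfloor>) / 2 ^ m)" for m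
    have s: "s m \<in> orthant" for m by (simp add: s_def orthant_def)
    have "s \<longlonglongrightarrow> t"
      unfolding s_def
    proof (rule vec_tendstoI, simp)
      fix i
      have ti: "0 \<le> t $ i" using t by (simp add: orthant_def)
      have lim: "(\<lambda>m. t $ i - (1/2) ^ m) \<longlonglongrightarrow> t $ i - 0"
        by (intro tendsto_intros LIMSEQ_realpow_zero) auto
      have lower: "t $ i - (1/2) ^ m \<le> real (nat \<lfloor>2 ^ m * t $ i\<rfloor>) / 2 ^ m" for m :: nat
      proof -
        have "2 ^ m * t $ i - 1 \<le> real_of_int \<lfloor>2 ^ m * t $ i\<rfloor>" by linarith
        then have "(2 ^ m * t $ i - 1) / 2 ^ m \<le> real_of_int \<lfloor>2 ^ m * t $ i\<rfloor> / 2 ^ m" by (intro divide_right_mono) auto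
        then show ?thesis using ti by (simp add: diff_divide_distrib power_one_over)
      qed
      have upper: "real (nat \<lfloor>2 ^ m * t $ i\<rfloor>) / 2 ^ m \<le> t $ i" for m :: nat
      proof -
        have "real (nat \<lfloor>2 ^ m * t $ i\<rfloor>) / 2 ^ m \<le> (2 ^ m * t $ i) / 2 ^ m"
          using ti by (intro divide_right_mono of_nat_floor) auto
        also have "(2 ^ m * t $ i) / 2 ^ m = t $ i" by (rule nonzero_mult_div_cancel_left) simp
        finally show ?thesis .
      qed
      show "(\<lambda>m. real (nat \<lfloor>2 ^ m * t $ i\<rfloor>) / 2 ^ m) \<longlonglongrightarrow> t $ i"
        by (rule tendsto_sandwich[OF always_eventually always_eventually lim[unfolded diff_zero] tendsto_const])
          (intro allI lower upper)+
    qed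
    then have lim_f: "(\<lambda>m. f (s m)) \<longlonglongrightarrow> f t"
      by (rule continuous_on_tendsto_compose[OF cont]) (use t s in auto)
    have "(\<lambda>m. \<integral>r. exp (- (r \<bullet> s m)) \<partial>\<rho>) \<longlonglongrightarrow> (\<integral>r. exp (- (r \<bullet> t)) \<partial>\<rho>)"
      by (rule laplace_tendsto[OF \<rho> \<rho>_orth s \<open>s \<longlonglongrightarrow> t\<close>])
    moreover have "(\<integral>r. exp (- (r \<bullet> s m)) \<partial>\<rho>) = f (s m)" for m
      unfolding s_def by (rule dyadic[symmetric])
    ultimately have "(\<lambda>m. f (s m)) \<longlonglongrightarrow> (\<integral>r. exp (- (r \<bullet> t)) \<partial>\<rho>)" by (simp only:)
    with lim_f show "f t = (\<integral>r. exp (- (r \<bullet> t)) \<partial>\<rho>)" by (rule LIMSEQ_unique)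
  qed (use \<rho> \<rho>_orth in auto)
qed


section \<open>Smooth families and differentiation under the integral\<close>

lemma open_pos_orthant: "open (pos_orthant :: (real^'n::finite) set)"
proof -
  have "pos_orthant = (\<Inter>i. {t :: real^'n. 0 < t $ i})" by (auto simp: pos_orthant_def)
  moreover have "open (\<Inter>i. {t :: real^'n. 0 < t $ i})"
    by (intro open_INT ballI open_Collect_less continuous_intros) auto
  ultimately show ?thesis by simp
qed

lemma pos_orthant_subset: "t \<in> pos_orthant \<Longrightarrow> t \<in> orthant"
  by (auto simp: pos_orthant_def orthant_def less_imp_le)

lemma partial_eq:
  assumes "open S" "x \<in> S" "\<And>y. y \<in> S \<Longrightarrow> f y = g y" "(g has_derivative D) (at x)"
  shows "partial i f x = D (axis i 1)" "f differentiable at x"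
proof -
  have "(f has_derivative D) (at x)"
    by (rule has_derivative_transform_within_open[OF assms(4,1,2)]) (simp add: assms(3))
  then show "partial i f x = D (axis i 1)" "f differentiable at x"
    by (auto simp: partial_def differentiable_def dest: frechet_derivative_at[symmetric])
qed

lemma partial_cong:
  assumes "open S" "x \<in> S" "\<And>y. y \<in> S \<Longrightarrow> f y = g y"
  shows "partial i f x = partial i g x"
proof -
  have "(f has_derivative D) (at x) \<longleftrightarrow> (g has_derivative D) (at x)" for D
    using has_derivative_transform_within_open[of f D x UNIV S g] has_derivative_transform_within_open[of g D x UNIV S f] assms
    by auto
  then show ?thesis by (simp add: partial_def frechet_derivative_def)
qed

text \<open>
  On an open set, differentiability only depends on the values there; this allows \<open>partial\<close> to be computed from a
  formula that holds on the open orthant only.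
\<close>

lemma C_diff_on_cong:
  assumes S: "open S"
  shows "(\<And>y. y \<in> S \<Longrightarrow> f y = g y) \<Longrightarrow> C_diff_on m S f \<longleftrightarrow> C_diff_on m S g"
proof (induction m arbitrary: f g)
  case 0
  then show ?case by (simp cong: continuous_on_cong)
next
  case (Suc m)
  have "C_diff_on m S (partial i f) \<longleftrightarrow> C_diff_on m S (partial i g)" for i
    by (rule Suc.IH, rule partial_cong[OF S]) (auto simp: Suc.prems)
  moreover have "f differentiable at x \<longleftrightarrow> g differentiable at x" if "x \<in> S" for x
    unfolding differentiable_def
    using has_derivative_transform_within_open[of f _ x UNIV S g] has_derivative_transform_within_open[of g _ x UNIV S f] S that Suc.prems
    by metis
  ultimately show ?case by simp
qed

text \<open>
  \<open>F \<alpha>\<close> plays the role of the derivative of \<open>F 0\<close> for the multi-index \<open>\<alpha>\<close>.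
\<close>

definition derivative_family :: "(('n \<Rightarrow> nat) \<Rightarrow> real^'n::finite \<Rightarrow> real) \<Rightarrow> bool" where
  "derivative_family F \<longleftrightarrow> (\<forall>\<alpha>. \<forall>t\<in>pos_orthant.
     (F \<alpha> has_derivative (\<lambda>h. \<Sum>i\<in>UNIV. h $ i * F (\<alpha>(i := Suc (\<alpha> i))) t)) (at t))"

lemma derivative_family_partial:
  assumes "derivative_family F" "\<And>t. t \<in> pos_orthant \<Longrightarrow> f t = F \<alpha> t" "t \<in> pos_orthant"
  shows "partial i f t = F (\<alpha>(i := Suc (\<alpha> i))) t" "f differentiable at t"
proof -
  have D: "(F \<alpha> has_derivative (\<lambda>h. \<Sum>i\<in>UNIV. h $ i * F (\<alpha>(i := Suc (\<alpha> i))) t)) (at t)"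
    using assms(1,3) by (simp add: derivative_family_def)
  note * = partial_eq[OF open_pos_orthant assms(3) assms(2) D]
  have "(\<Sum>j\<in>UNIV. axis i (1::real) $ j * F (\<alpha>(j := Suc (\<alpha> j))) t) = (\<Sum>j\<in>UNIV. if j = i then F (\<alpha>(j := Suc (\<alpha> j))) t else 0)"
    by (intro sum.cong) (auto simp: axis_def)
  then show "partial i f t = F (\<alpha>(i := Suc (\<alpha> i))) t" using *(1)[of i] by simp
  show "f differentiable at t" by (rule *(2))
qed

lemma derivative_family_smooth:
  assumes F: "derivative_family F" and "\<And>t. t \<in> pos_orthant \<Longrightarrow> f t = F \<alpha> t"
  shows "smooth_on pos_orthant f"
proof -
  have "C_diff_on m pos_orthant f" for m
    using assms(2)
  proof (induction m arbitrary: f \<alpha>)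
    case 0
    have "continuous_on pos_orthant f"
      by (rule differentiable_imp_continuous_on, rule differentiable_at_imp_differentiable_on)
        (rule derivative_family_partial(2)[OF F 0])
    then show ?case by simp
  next
    case (Suc m)
    show ?case
      using Suc.IH[OF derivative_family_partial(1)[OF F Suc.prems]] derivative_family_partial(2)[OF F Suc.prems] by auto
  qed
  then show ?thesis by (simp add: smooth_on_def)
qed

lemma derivative_family_multi_partial:
  fixes F :: "('n \<Rightarrow> nat) \<Rightarrow> real^'n::{finite,linorder} \<Rightarrow> real"
  assumes F: "derivative_family F" and f: "\<And>t. t \<in> pos_orthant \<Longrightarrow> f t = F \<alpha> t" and t: "t \<in> pos_orthant"
  shows "multi_partial \<beta> f t = F (\<lambda>i. \<alpha> i + \<beta> i) t"
proof -
  have pow: "(partial i ^^ m) h t = F (\<gamma>(i := \<gamma> i + m)) t"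
    if "\<And>t. t \<in> pos_orthant \<Longrightarrow> h t = F \<gamma> t" "t \<in> pos_orthant" for m i h \<gamma> t
    using that(2)
  proof (induction m arbitrary: t)
    case 0
    then show ?case by (simp add: that(1))
  next
    case (Suc m)
    have "(\<gamma>(i := \<gamma> i + m))(i := Suc ((\<gamma>(i := \<gamma> i + m)) i)) = \<gamma>(i := \<gamma> i + Suc m)" by auto
    then show ?case using derivative_family_partial(1)[OF F Suc.IH Suc.prems, of i] by (simp only: funpow.simps o_apply)
  qed
  have "foldr (\<lambda>i. partial i ^^ \<beta> i) ks f t = F (\<lambda>i. \<alpha> i + (if i \<in> set ks then \<beta> i else 0)) t"
    if "distinct ks" "t \<in> pos_orthant" for ks t
    using that
  proof (induction ks arbitrary: t)
    case (Cons k ks)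
    have "foldr (\<lambda>i. partial i ^^ \<beta> i) (k # ks) f t
      = F ((\<lambda>i. \<alpha> i + (if i \<in> set ks then \<beta> i else 0))(k := (\<alpha> k + (if k \<in> set ks then \<beta> k else 0)) + \<beta> k)) t"
      using pow[OF Cons.IH Cons.prems(2), where i = k and m = "\<beta> k"] Cons.prems by simp
    moreover have "(\<lambda>i. \<alpha> i + (if i \<in> set ks then \<beta> i else 0))(k := (\<alpha> k + (if k \<in> set ks then \<beta> k else 0)) + \<beta> k)
      = (\<lambda>i. \<alpha> i + (if i \<in> set (k # ks) then \<beta> i else 0))"
      using Cons.prems by auto
    ultimately show ?case by simp
  qed (simp add: f)
  from this[of "sorted_list_of_set UNIV" t] show ?thesis
    using t by (simp add: multi_partial_def)
qed

lemma derivative_family_sum: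
  fixes F :: "'a \<Rightarrow> ('n \<Rightarrow> nat) \<Rightarrow> real^'n::finite \<Rightarrow> real"
  assumes "\<And>a. a \<in> A \<Longrightarrow> derivative_family (F a)"
  shows "derivative_family (\<lambda>\<alpha> t. \<Sum>a\<in>A. F a \<alpha> t)"
  unfolding derivative_family_def
proof (intro allI ballI)
  fix \<alpha> and t :: "real^'n" assume t: "t \<in> pos_orthant"
  have "((\<lambda>t. \<Sum>a\<in>A. F a \<alpha> t) has_derivative (\<lambda>h. \<Sum>a\<in>A. \<Sum>i\<in>UNIV. h $ i * F a (\<alpha>(i := Suc (\<alpha> i))) t)) (at t)"
    by (intro has_derivative_sum) (use assms t in \<open>auto simp: derivative_family_def\<close>)
  also have "(\<lambda>h :: real^'n. \<Sum>a\<in>A. \<Sum>i\<in>UNIV. h $ i * F a (\<alpha>(i := Suc (\<alpha> i))) t)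
      = (\<lambda>h. \<Sum>i\<in>UNIV. h $ i * (\<Sum>a\<in>A. F a (\<alpha>(i := Suc (\<alpha> i))) t))"
    by (subst sum.swap) (simp add: sum_distrib_left)
  finally show "((\<lambda>t. \<Sum>a\<in>A. F a \<alpha> t) has_derivative (\<lambda>h. \<Sum>i\<in>UNIV. h $ i * (\<Sum>a\<in>A. F a (\<alpha>(i := Suc (\<alpha> i))) t))) (at t)" .
qed

text \<open>
  \<open>\<theta> m\<close> is the \<open>m\<close>-th derivative in the time variable of \<open>\<theta> 0\<close>.  All derivatives are bounded for times in compact
  subsets of \<open>(0, \<infinity>)\<close>, uniformly over the set \<open>G\<close> that carries the measure.
\<close>

definition jet_kernel :: "'b measure \<Rightarrow> 'b set \<Rightarrow> (nat \<Rightarrow> real \<Rightarrow> 'b \<Rightarrow> real) \<Rightarrow> bool" where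
  "jet_kernel M G \<theta> \<longleftrightarrow>
     (\<forall>m t. (\<lambda>\<omega>. \<theta> m t \<omega>) \<in> borel_measurable M) \<and>
     (\<forall>m t. \<forall>\<omega>\<in>G. 0 < t \<longrightarrow> ((\<lambda>s. \<theta> m s \<omega>) has_real_derivative \<theta> (Suc m) t \<omega>) (at t)) \<and>
     (\<forall>m a b. 0 < a \<longrightarrow> (\<exists>C. \<forall>t\<in>{a..b}. \<forall>\<omega>\<in>G. \<bar>\<theta> m t \<omega>\<bar> \<le> C))"

lemma product_jet_line:
  fixes \<theta> :: "'n::finite \<Rightarrow> nat \<Rightarrow> real \<Rightarrow> 'b \<Rightarrow> real" and t h :: "real^'n"
  assumes \<theta>: "\<And>l. jet_kernel M G (\<theta> l)" and \<omega>: "\<omega> \<in> G" and pos: "t + x *\<^sub>R h \<in> pos_orthant"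
  shows "((\<lambda>x. \<Prod>l\<in>UNIV. \<theta> l (\<alpha> l) ((t + x *\<^sub>R h) $ l) \<omega>) has_real_derivative
     (\<Sum>i\<in>UNIV. h $ i * (\<Prod>l\<in>UNIV. \<theta> l ((\<alpha>(i := Suc (\<alpha> i))) l) ((t + x *\<^sub>R h) $ l) \<omega>))) (at x)"
proof -
  have d: "((\<lambda>x. \<theta> l (\<alpha> l) ((t + x *\<^sub>R h) $ l) \<omega>) has_real_derivative \<theta> l (Suc (\<alpha> l)) ((t + x *\<^sub>R h) $ l) \<omega> * h $ l) (at x)" for l
  proof -
    have "0 < t $ l + x * h $ l" using pos by (simp add: pos_orthant_def)
    then have "((\<lambda>s. \<theta> l (\<alpha> l) s \<omega>) has_real_derivative \<theta> l (Suc (\<alpha> l)) (t $ l + x * h $ l) \<omega>) (at (t $ l + x * h $ l))"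
      using \<theta>[of l] \<omega> by (simp add: jet_kernel_def)
    moreover have "((\<lambda>x. t $ l + x * h $ l) has_real_derivative h $ l) (at x)"
      by (auto intro!: derivative_eq_intros)
    ultimately have "((\<lambda>x. \<theta> l (\<alpha> l) (t $ l + x * h $ l) \<omega>) has_real_derivative \<theta> l (Suc (\<alpha> l)) (t $ l + x * h $ l) \<omega> * h $ l) (at x)"
      by (rule DERIV_chain2[where f = "\<lambda>s. \<theta> l (\<alpha> l) s \<omega>" and g = "\<lambda>x. t $ l + x * h $ l"])
    then show ?thesis by simp
  qed
  have "((\<lambda>x. \<Prod>l\<in>UNIV. \<theta> l (\<alpha> l) ((t + x *\<^sub>R h) $ l) \<omega>) has_real_derivative
     (\<Sum>i\<in>UNIV. (\<theta> i (Suc (\<alpha> i)) ((t + x *\<^sub>R h) $ i) \<omega> * h $ i) * (\<Prod>l\<in>UNIV - {i}. \<theta> l (\<alpha> l) ((t + x *\<^sub>R h) $ l) \<omega>))) (at x)"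
    by (rule has_field_derivative_prod[OF d])
  moreover have "(\<theta> i (Suc (\<alpha> i)) ((t + x *\<^sub>R h) $ i) \<omega> * h $ i) * (\<Prod>l\<in>UNIV - {i}. \<theta> l (\<alpha> l) ((t + x *\<^sub>R h) $ l) \<omega>)
    = h $ i * (\<Prod>l\<in>UNIV. \<theta> l ((\<alpha>(i := Suc (\<alpha> i))) l) ((t + x *\<^sub>R h) $ l) \<omega>)" for i
    by (subst (2) prod.remove[of _ i]) (auto intro!: prod.cong)
  ultimately show ?thesis by (simp only:)
qed

text \<open>
  Two applications of the mean value theorem bound the error of the first-order expansion of the integrand by
  \<open>K\<close> times the square of the increment, with \<open>K\<close> independent of \<open>\<omega>\<close>.  Integrating this bound gives Frechet
  differentiability at once.
\<close>

lemma derivative_family_integral: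
  fixes \<theta> :: "'n::finite \<Rightarrow> nat \<Rightarrow> real \<Rightarrow> 'b \<Rightarrow> real"
  assumes M: "finite_measure M" and G: "AE \<omega> in M. \<omega> \<in> G" and \<theta>: "\<And>l. jet_kernel M G (\<theta> l)"
  shows "derivative_family (\<lambda>\<alpha> t. \<integral>\<omega>. (\<Prod>l\<in>UNIV. \<theta> l (\<alpha> l) (t $ l) \<omega>) \<partial>M)"
  unfolding derivative_family_def
proof (intro allI ballI)
  fix \<alpha> :: "'n \<Rightarrow> nat" and t :: "real^'n" assume t: "t \<in> pos_orthant"
  interpret finite_measure M by (rule M)
  define P where "P \<beta> s \<omega> = (\<Prod>l\<in>UNIV. \<theta> l (\<beta> l) (s $ l) \<omega>)" for \<beta> and s :: "real^'n" and \<omega>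
  have meas: "P \<beta> s \<in> borel_measurable M" for \<beta> s
    unfolding P_def using \<theta> by (intro borel_measurable_prod) (auto simp: jet_kernel_def)
  \<comment> \<open>within distance \<open>\<delta>\<close> of \<open>t\<close> all coordinates stay in the compact intervals \<open>[t\<^sub>l / 2, 2 t\<^sub>l]\<close>\<close>
  define \<delta> where "\<delta> = Min (range (\<lambda>i. t $ i)) / 2"
  have \<delta>i: "2 * \<delta> \<le> t $ i" for i unfolding \<delta>_def by simp
  have \<delta>: "0 < \<delta>" using t by (simp add: \<delta>_def pos_orthant_def)
  have near: "t $ i / 2 \<le> (t + h) $ i \<and> (t + h) $ i \<le> 2 * t $ i" if "norm h \<le> \<delta>" for h i
    using that \<delta>i[of i] component_le_norm_cart[of h i] \<delta> by (auto simp: abs_le_iff)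
  have "\<exists>C. \<forall>x\<in>{t $ l / 2..2 * t $ l}. \<forall>\<omega>\<in>G. \<bar>\<theta> l m x \<omega>\<bar> \<le> C" for l m
    using \<theta>[of l] t by (simp add: jet_kernel_def pos_orthant_def)
  then obtain C where C: "\<And>l m x \<omega>. x \<in> {t $ l / 2..2 * t $ l} \<Longrightarrow> \<omega> \<in> G \<Longrightarrow> \<bar>\<theta> l m x \<omega>\<bar> \<le> C l m" by metis
  define B where "B \<beta> = (\<Prod>l\<in>UNIV. C l (\<beta> l))" for \<beta>
  have bound: "\<bar>P \<beta> (t + h) \<omega>\<bar> \<le> B \<beta>" if "norm h \<le> \<delta>" "\<omega> \<in> G" for \<beta> h \<omega>
    unfolding P_def B_def abs_prod by (intro prod_mono conjI abs_ge_zero C) (use near that in auto)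
  have int: "integrable M (P \<beta> (t + h))" if "norm h \<le> \<delta>" for \<beta> h
    by (rule integrable_bounded_AE[OF M meas]) (use G bound[OF that] in auto)
  let ?up = "\<lambda>\<beta> i. \<beta>(i := Suc (\<beta> i))"
  have line: "((\<lambda>x. P \<beta> (t + x *\<^sub>R h) \<omega>) has_real_derivative (\<Sum>i\<in>UNIV. h $ i * P (?up \<beta> i) (t + x *\<^sub>R h) \<omega>)) (at x)"
    if "norm h \<le> \<delta>" "\<omega> \<in> G" "0 \<le> x" "x \<le> 1" for \<beta> h \<omega> x
  proof -
    have "x * norm h \<le> 1 * norm h" using that by (intro mult_right_mono) auto
    then have "norm (x *\<^sub>R h) \<le> \<delta>" using that by simp
    have "0 < (t + x *\<^sub>R h) $ i" for i
    proof -
      have "0 < t $ i" using t by (simp add: pos_orthant_def)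
      then show ?thesis using near[OF \<open>norm (x *\<^sub>R h) \<le> \<delta>\<close>, of i] by linarith
    qed
    then have "t + x *\<^sub>R h \<in> pos_orthant" by (simp add: pos_orthant_def)
    then show ?thesis unfolding P_def by (rule product_jet_line[OF \<theta> that(2)])
  qed
  define K where "K = (\<Sum>i\<in>UNIV. \<Sum>j\<in>UNIV. B (?up (?up \<alpha> i) j))"
  have mvt: "\<exists>x. 0 < x \<and> x < 1 \<and> P \<beta> (t + y *\<^sub>R h) \<omega> - P \<beta> t \<omega> = y * (\<Sum>i\<in>UNIV. h $ i * P (?up \<beta> i) (t + (x * y) *\<^sub>R h) \<omega>)"
    if hy: "norm h \<le> \<delta>" "\<omega> \<in> G" "0 < y" "y \<le> 1" for \<beta> h \<omega> y
  proof -
    obtain z where z: "0 < z" "z < y" "P \<beta> (t + y *\<^sub>R h) \<omega> - P \<beta> (t + 0 *\<^sub>R h) \<omega> = (y - 0) * (\<Sum>i\<in>UNIV. h $ i * P (?up \<beta> i) (t + z *\<^sub>R h) \<omega>)"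
      using MVT2[OF \<open>0 < y\<close>, of "\<lambda>x. P \<beta> (t + x *\<^sub>R h) \<omega>" "\<lambda>x. \<Sum>i\<in>UNIV. h $ i * P (?up \<beta> i) (t + x *\<^sub>R h) \<omega>"]
        line[OF hy(1,2)] hy(4) by auto
    show ?thesis using z hy by (intro exI[of _ "z / y"]) auto
  qed
  have lip: "\<bar>P (?up \<alpha> i) (t + y *\<^sub>R h) \<omega> - P (?up \<alpha> i) t \<omega>\<bar> \<le> norm h * (\<Sum>j\<in>UNIV. B (?up (?up \<alpha> i) j))"
    if h: "norm h \<le> \<delta>" "\<omega> \<in> G" "0 < y" "y \<le> 1" for h \<omega> y i
  proof -
    obtain x where x: "0 < x" "x < 1" "P (?up \<alpha> i) (t + y *\<^sub>R h) \<omega> - P (?up \<alpha> i) t \<omega> = y * (\<Sum>j\<in>UNIV. h $ j * P (?up (?up \<alpha> i) j) (t + (x * y) *\<^sub>R h) \<omega>)"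
      using mvt[OF h, of "?up \<alpha> i"] by blast
    have xy: "norm ((x * y) *\<^sub>R h) \<le> \<delta>"
    proof -
      have "x * y \<le> 1" using x h by (simp add: mult_le_one)
      then have "(x * y) * norm h \<le> 1 * norm h" by (intro mult_right_mono) auto
      then show ?thesis using x h by (simp add: abs_mult)
    qed
    have "\<bar>y * (\<Sum>j\<in>UNIV. h $ j * P (?up (?up \<alpha> i) j) (t + (x * y) *\<^sub>R h) \<omega>)\<bar>
       \<le> 1 * (\<Sum>j\<in>UNIV. norm h * B (?up (?up \<alpha> i) j))"
      unfolding abs_mult
    proof (intro mult_mono order_trans[OF sum_abs] sum_mono)
      show "\<bar>h $ j * P (?up (?up \<alpha> i) j) (t + (x * y) *\<^sub>R h) \<omega>\<bar> \<le> norm h * B (?up (?up \<alpha> i) j)" for j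
        unfolding abs_mult by (intro mult_mono component_le_norm_cart bound[OF xy h(2)]) auto
    qed (use h in auto)
    then show ?thesis unfolding x(3) by (simp add: sum_distrib_left)
  qed
  have taylor: "\<bar>P \<alpha> (t + h) \<omega> - P \<alpha> t \<omega> - (\<Sum>i\<in>UNIV. h $ i * P (?up \<alpha> i) t \<omega>)\<bar> \<le> (norm h)\<^sup>2 * K"
    if h: "norm h \<le> \<delta>" "\<omega> \<in> G" for h \<omega>
  proof -
    obtain x where x: "0 < x" "x < 1" "P \<alpha> (t + h) \<omega> - P \<alpha> t \<omega> = (\<Sum>i\<in>UNIV. h $ i * P (?up \<alpha> i) (t + x *\<^sub>R h) \<omega>)"
      using mvt[OF h, of 1 \<alpha>] by auto
    have "P \<alpha> (t + h) \<omega> - P \<alpha> t \<omega> - (\<Sum>i\<in>UNIV. h $ i * P (?up \<alpha> i) t \<omega>)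
      = (\<Sum>i\<in>UNIV. h $ i * (P (?up \<alpha> i) (t + x *\<^sub>R h) \<omega> - P (?up \<alpha> i) t \<omega>))"
      unfolding x(3) by (simp add: right_diff_distrib sum_subtractf)
    also have "\<bar>\<dots>\<bar> \<le> (\<Sum>i\<in>UNIV. norm h * (norm h * (\<Sum>j\<in>UNIV. B (?up (?up \<alpha> i) j))))"
    proof (intro order_trans[OF sum_abs] sum_mono)
      show "\<bar>h $ i * (P (?up \<alpha> i) (t + x *\<^sub>R h) \<omega> - P (?up \<alpha> i) t \<omega>)\<bar> \<le> norm h * (norm h * (\<Sum>j\<in>UNIV. B (?up (?up \<alpha> i) j)))" for i
        unfolding abs_mult by (intro mult_mono component_le_norm_cart lip h) (use x in auto)
    qed
    also have "\<dots> = (norm h)\<^sup>2 * K" by (simp add: K_def power2_eq_square sum_distrib_left mult.assoc)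
    finally show ?thesis .
  qed
  let ?F = "\<lambda>\<alpha> s. \<integral>\<omega>. P \<alpha> s \<omega> \<partial>M"
  have error: "\<bar>?F \<alpha> (t + h) - ?F \<alpha> t - (\<Sum>i\<in>UNIV. h $ i * ?F (?up \<alpha> i) t)\<bar> \<le> (norm h)\<^sup>2 * K * measure M (space M)"
    if h: "norm h \<le> \<delta>" for h
  proof -
    have i0: "integrable M (P \<beta> t)" for \<beta> using int[of 0] \<delta> by simp
    have "?F \<alpha> (t + h) - ?F \<alpha> t - (\<Sum>i\<in>UNIV. h $ i * ?F (?up \<alpha> i) t)
      = (\<integral>\<omega>. P \<alpha> (t + h) \<omega> - P \<alpha> t \<omega> - (\<Sum>i\<in>UNIV. h $ i * P (?up \<alpha> i) t \<omega>) \<partial>M)"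
      using int[OF h] i0 by simp
    also have "\<bar>\<dots>\<bar> \<le> (\<integral>\<omega>. \<bar>P \<alpha> (t + h) \<omega> - P \<alpha> t \<omega> - (\<Sum>i\<in>UNIV. h $ i * P (?up \<alpha> i) t \<omega>)\<bar> \<partial>M)"
      by (rule integral_abs_bound)
    also have "\<dots> \<le> (\<integral>\<omega>. (norm h)\<^sup>2 * K \<partial>M)"
      using int[OF h] i0 by (intro integral_mono_AE) (use G taylor[OF h] in auto)
    finally show ?thesis by (simp add: mult_ac)
  qed
  have "(?F \<alpha> has_derivative (\<lambda>h. \<Sum>i\<in>UNIV. h $ i * ?F (?up \<alpha> i) t)) (at t)"
    unfolding has_derivative_at_alt
  proof (intro conjI allI impI)
    show "bounded_linear (\<lambda>h :: real^'n. \<Sum>i\<in>UNIV. h $ i * ?F (?up \<alpha> i) t)"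
      by (intro bounded_linear_sum bounded_linear_mult_left bounded_linear_compose[OF bounded_linear_mult_left] bounded_linear_vec_nth)
    fix e :: real assume e: "0 < e"
    define Q where "Q = \<bar>K * measure M (space M)\<bar> + 1"
    have Q: "0 < Q" by (simp add: Q_def)
    show "\<exists>d>0. \<forall>y. norm (y - t) < d \<longrightarrow>
      norm (?F \<alpha> y - ?F \<alpha> t - (\<Sum>i\<in>UNIV. (y - t) $ i * ?F (?up \<alpha> i) t)) \<le> e * norm (y - t)"
    proof (intro exI[of _ "min \<delta> (e / Q)"] conjI allI impI)
      show "0 < min \<delta> (e / Q)" using \<delta> e Q by simp
      fix y assume y: "norm (y - t) < min \<delta> (e / Q)"
      have "\<bar>?F \<alpha> (t + (y - t)) - ?F \<alpha> t - (\<Sum>i\<in>UNIV. (y - t) $ i * ?F (?up \<alpha> i) t)\<bar> \<le> (norm (y - t))\<^sup>2 * K * measure M (space M)"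
        by (rule error) (use y in simp)
      also have "\<dots> \<le> (norm (y - t))\<^sup>2 * Q"
        unfolding mult.assoc by (intro mult_left_mono) (auto simp: Q_def)
      also have "\<dots> = (norm (y - t) * Q) * norm (y - t)" by (simp add: power2_eq_square)
      also have "\<dots> \<le> e * norm (y - t)"
        using y Q by (intro mult_right_mono) (auto simp: field_simps)
      finally show "norm (?F \<alpha> y - ?F \<alpha> t - (\<Sum>i\<in>UNIV. (y - t) $ i * ?F (?up \<alpha> i) t)) \<le> e * norm (y - t)"
        by simp
    qed
  qed
  then show "((\<lambda>t. \<integral>\<omega>. (\<Prod>l\<in>UNIV. \<theta> l (\<alpha> l) (t $ l) \<omega>) \<partial>M) has_derivative
    (\<lambda>h. \<Sum>i\<in>UNIV. h $ i * (\<integral>\<omega>. (\<Prod>l\<in>UNIV. \<theta> l ((?up \<alpha> i) l) (t $ l) \<omega>) \<partial>M))) (at t)"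
    unfolding P_def .
qed


section \<open>Signs of derivatives and signs of differences\<close>

definition iterated_partial :: "'n list \<Rightarrow> (real^'n::finite \<Rightarrow> real) \<Rightarrow> real^'n \<Rightarrow> real" where
  "iterated_partial ks f = foldr partial ks f"

lemma iterated_partial_simps [simp]:
  "iterated_partial [] f = f"
  "iterated_partial (k # ks) f = partial k (iterated_partial ks f)"
  "iterated_partial (ks @ ls) f = iterated_partial ks (iterated_partial ls f)"
  by (simp_all add: iterated_partial_def)

text \<open>
  The coordinates in the order in which \<open>multi_partial\<close> differentiates.  Derivatives are compared with steps in
  this order; rearrangements are made on the side of the steps, which commute.
\<close>

definition index_list :: "('n::{finite,linorder} \<Rightarrow> nat) \<Rightarrow> 'n list" where
  "index_list \<alpha> = concat (map (\<lambda>i. replicate (\<alpha> i) i) (sorted_list_of_set UNIV))"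

lemma multi_partial_eq_iterated: "multi_partial \<alpha> f = iterated_partial (index_list \<alpha>) f"
proof -
  have rep: "iterated_partial (replicate m i) h = (partial i ^^ m) h" for m i and h :: "real^'n::{finite,linorder} \<Rightarrow> real"
    by (induction m) auto
  have "iterated_partial (concat (map (\<lambda>i. replicate (\<alpha> i) i) ks)) f = foldr (\<lambda>i. partial i ^^ \<alpha> i) ks f" for ks
    by (induction ks) (auto simp: rep)
  then show ?thesis by (simp add: index_list_def multi_partial_def)
qed

lemma count_index_list: "count (mset (index_list \<alpha>)) i = \<alpha> i"
proof -
  have "count (mset (concat (map (\<lambda>i. replicate (\<alpha> i) i) ks))) i = (if i \<in> set ks then \<alpha> i else 0)" if "distinct ks" for ks
    using that by (induction ks) auto
  then show ?thesis by (simp add: index_list_def)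
qed

lemma length_index_list: "length (index_list \<alpha>) = (\<Sum>i\<in>UNIV. \<alpha> i)"
proof -
  have "length (concat (map (\<lambda>i. replicate (\<alpha> i) i) ks)) = (\<Sum>i\<in>set ks. \<alpha> i)" if "distinct ks" for ks
    using that by (induction ks) auto
  then show ?thesis by (simp add: index_list_def)
qed

lemma sorted_index_list: "sorted (index_list \<alpha>)"
proof -
  have "sorted (concat (map (\<lambda>i. replicate (\<alpha> i) i) ks))" if "sorted ks" for ks
    using that by (induction ks) (auto simp: sorted_append)
  then show ?thesis by (simp add: index_list_def)
qed

lemma sorted_eq_index_list: "sorted ks \<Longrightarrow> ks = index_list (count (mset ks))"
  using properties_for_sort[of ks "index_list (count (mset ks))"]
  by (simp add: sorted_index_list sorted_sort_id multiset_eq_iff count_index_list)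

lemma smooth_on_partial: "smooth_on S f \<Longrightarrow> smooth_on S (partial i f)"
  unfolding smooth_on_def using C_diff_on.simps(2) by blast

lemma smooth_on_iterated_partial: "smooth_on S f \<Longrightarrow> smooth_on S (iterated_partial ks f)"
  by (induction ks) (auto simp: smooth_on_partial)

lemma smooth_on_differentiable: "smooth_on S f \<Longrightarrow> x \<in> S \<Longrightarrow> f differentiable at x"
  unfolding smooth_on_def using C_diff_on.simps(2)[of 0] by blast

lemma pos_orthant_add: "t \<in> pos_orthant \<Longrightarrow> v \<in> orthant \<Longrightarrow> t + v \<in> pos_orthant"
  by (auto simp: pos_orthant_def orthant_def add_pos_nonneg)

lemma axis_in_orthant: "0 \<le> s \<Longrightarrow> axis i s \<in> orthant"
  by (auto simp: orthant_def axis_def)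

lemma partial_shift_diff:
  assumes "\<And>x. x \<in> pos_orthant \<Longrightarrow> f differentiable at x" "v \<in> orthant" "t \<in> pos_orthant"
  shows "partial i (\<lambda>x. f x - f (x + v)) t = partial i f t - partial i f (t + v)"
    "(\<lambda>x. f x - f (x + v)) differentiable at t"
proof -
  have D: "(f has_derivative frechet_derivative f (at x)) (at x)" if "x \<in> pos_orthant" for x
    using assms(1)[OF that] by (simp add: frechet_derivative_works)
  have "((\<lambda>x. f (x + v)) has_derivative frechet_derivative f (at (t + v))) (at t)"
    using has_derivative_compose[of "\<lambda>x. x + v" "\<lambda>h. h" t UNIV f "frechet_derivative f (at (t + v))"]
      D[OF pos_orthant_add[OF assms(3,2)]] by (simp add: has_derivative_add_const)
  from has_derivative_diff[OF D[OF assms(3)] this]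
  have E: "((\<lambda>x. f x - f (x + v)) has_derivative (\<lambda>h. frechet_derivative f (at t) h - frechet_derivative f (at (t + v)) h)) (at t)" .
  show "partial i (\<lambda>x. f x - f (x + v)) t = partial i f t - partial i f (t + v)"
    using fun_cong[OF frechet_derivative_at[OF E], of "axis i 1"] by (simp add: partial_def)
  show "(\<lambda>x. f x - f (x + v)) differentiable at t" using E by (auto simp: differentiable_def)
qed

lemma smooth_on_shift_diff:
  assumes "smooth_on pos_orthant f" "v \<in> orthant"
  shows "smooth_on pos_orthant (\<lambda>x. f x - f (x + v))"
proof -
  have "C_diff_on m pos_orthant (\<lambda>x. f x - f (x + v))" for m
    using assms(1)
  proof (induction m arbitrary: f)
    case 0
    have "continuous_on pos_orthant f" using 0 by (auto simp: smooth_on_def dest: spec[of _ 0])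
    moreover have "continuous_on pos_orthant (\<lambda>x. f (x + v))"
      by (rule continuous_on_compose2[OF \<open>continuous_on pos_orthant f\<close>])
        (auto intro!: continuous_intros simp: pos_orthant_add assms(2))
    ultimately have "continuous_on pos_orthant (\<lambda>x. f x - f (x + v))"
      by (rule continuous_on_diff)
    then show ?case by simp
  next
    case (Suc m)
    note d = partial_shift_diff[OF smooth_on_differentiable[OF Suc.prems] assms(2)]
    have "C_diff_on m pos_orthant (partial i (\<lambda>x. f x - f (x + v)))" for i
      using Suc.IH[OF smooth_on_partial[OF Suc.prems], of i]
      by (subst C_diff_on_cong[OF open_pos_orthant d(1)]) auto
    then show ?case using d(2) by simp
  qed
  then show ?thesis by (simp add: smooth_on_def)
qed

lemma iterated_partial_shift_diff:
  assumes "smooth_on pos_orthant f" "v \<in> orthant"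
  shows "t \<in> pos_orthant \<Longrightarrow> iterated_partial ks (\<lambda>x. f x - f (x + v)) t = iterated_partial ks f t - iterated_partial ks f (t + v)"
proof (induction ks arbitrary: t)
  case (Cons k ks)
  have "iterated_partial (k # ks) (\<lambda>x. f x - f (x + v)) t = partial k (\<lambda>x. iterated_partial ks f x - iterated_partial ks f (x + v)) t"
    using partial_cong[OF open_pos_orthant Cons.prems Cons.IH] by simp
  also have "\<dots> = partial k (iterated_partial ks f) t - partial k (iterated_partial ks f) (t + v)"
    by (rule partial_shift_diff) (use smooth_on_differentiable[OF smooth_on_iterated_partial[OF assms(1)]] assms(2) Cons.prems in auto)
  finally show ?case by simp
qed simp

text \<open>
  The constant \<open>c\<close> is \<open>1\<close> or \<open>-1\<close> in the application; it carries the sign that alternates with the order.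
\<close>

lemma decreasing_iff_partial_nonpos:
  fixes f :: "real^'n::finite \<Rightarrow> real"
  assumes d: "\<And>x. x \<in> pos_orthant \<Longrightarrow> f differentiable at x"
  shows "(\<forall>t\<in>pos_orthant. \<forall>s\<ge>0. 0 \<le> c * (f t - f (t + axis k s))) \<longleftrightarrow> (\<forall>t\<in>pos_orthant. 0 \<le> - (c * partial k f t))"
proof -
  have line: "((\<lambda>s. f (t + axis k s)) has_real_derivative partial k f (t + axis k s)) (at s)"
    if "t + axis k s \<in> pos_orthant" for t :: "real^'n" and s
  proof -
    have "((\<lambda>s. t + axis k s) has_derivative (\<lambda>h. axis k h)) (at s)"
    proof -
      have "bounded_linear (\<lambda>h. axis k h :: real^'n)"
        by (subst linear_conv_bounded_linear[symmetric]) (auto intro!: linearI simp: vec_eq_iff axis_def)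
      then show ?thesis by (auto intro!: derivative_eq_intros bounded_linear_imp_has_derivative)
    qed
    moreover have "(f has_derivative frechet_derivative f (at (t + axis k s))) (at (t + axis k s))"
      using d[OF that] by (simp add: frechet_derivative_works)
    ultimately have "((\<lambda>s. f (t + axis k s)) has_derivative (\<lambda>h. frechet_derivative f (at (t + axis k s)) (axis k h))) (at s)"
      by (rule has_derivative_compose)
    moreover have "frechet_derivative f (at (t + axis k s)) (axis k h) = h * partial k f (t + axis k s)" for h
    proof -
      have "axis k h = h *\<^sub>R axis k (1::real)" by (simp add: vec_eq_iff axis_def)
      then show ?thesis
        using linear_cmul[OF linear_frechet_derivative[OF d[OF that]]] by (simp add: partial_def)
    qed
    ultimately show ?thesis by (simp add: has_field_derivative_def mult_commute_abs)
  qed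
  show ?thesis
  proof (intro iffI ballI allI impI)
    fix t :: "real^'n" assume L: "\<forall>t\<in>pos_orthant. \<forall>s\<ge>0. 0 \<le> c * (f t - f (t + axis k s))" and t: "t \<in> pos_orthant"
    have ax0: "axis k (0::real) = 0" by (simp add: vec_eq_iff axis_def)
    have "((\<lambda>s. f (t + axis k s)) has_real_derivative partial k f t) (at 0)"
      using line[of t 0] t by (simp add: ax0)
    then have "((\<lambda>s. (f (t + axis k (0 + s)) - f (t + axis k 0)) / s) \<longlongrightarrow> partial k f t) (at 0)"
      by (simp only: DERIV_def)
    then have "((\<lambda>s. (f (t + axis k s) - f t) / s) \<longlongrightarrow> partial k f t) (at_right 0)"
      by (simp add: filterlim_at_split ax0)
    then have lim: "((\<lambda>s. - (c * ((f (t + axis k s) - f t) / s))) \<longlongrightarrow> - (c * partial k f t)) (at_right 0)"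
      by (intro tendsto_intros)
    have "\<forall>\<^sub>F s in at_right 0. 0 \<le> - (c * ((f (t + axis k s) - f t) / s))"
      unfolding eventually_at_filter
    proof (rule always_eventually, intro allI impI)
      fix s :: real assume "s \<in> {0<..}"
      then have "0 \<le> c * (f t - f (t + axis k s)) / s" using L t by (intro divide_nonneg_pos) auto
      then show "0 \<le> - (c * ((f (t + axis k s) - f t) / s))" by (simp add: algebra_simps diff_divide_distrib)
    qed
    then show "0 \<le> - (c * partial k f t)"
      by (rule tendsto_lowerbound[OF lim]) simp
  next
    fix t :: "real^'n" and s :: real assume R: "\<forall>t\<in>pos_orthant. 0 \<le> - (c * partial k f t)" and t: "t \<in> pos_orthant" and s: "0 \<le> s"
    show "0 \<le> c * (f t - f (t + axis k s))"
    proof (cases "s = 0")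
      case False
      have p: "t + axis k x \<in> pos_orthant" if "0 \<le> x" for x
        using pos_orthant_add[OF t axis_in_orthant[OF that]] .
      obtain z where z: "0 < z" "z < s" "f (t + axis k s) - f (t + axis k 0) = (s - 0) * partial k f (t + axis k z)"
        using MVT2[of 0 s "\<lambda>s. f (t + axis k s)" "\<lambda>s. partial k f (t + axis k s)"] line p False s by auto
      have "f t - f (t + axis k s) = - (s * partial k f (t + axis k z))" using z(3) by (simp add: axis_def flip: zero_vec_def)
      then have "c * (f t - f (t + axis k s)) = s * - (c * partial k f (t + axis k z))" by (simp add: mult_ac)
      also have "0 \<le> \<dots>" using R p[of z] z s by (intro mult_nonneg_nonneg) auto
      finally show ?thesis .
    qed (simp add: axis_def flip: zero_vec_def)
  qed
qed

text \<open>
  Induction on the number of directions.  The induction hypothesis is applied to the differences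
  \<open>f x - f (x + s)\<close>, which are again smooth, and a function with nonnegative differences of this kind is one with
  nonpositive derivative.
\<close>

lemma alternating_differences_iff_derivatives:
  fixes f :: "real^'n::finite \<Rightarrow> real"
  shows "smooth_on pos_orthant f \<Longrightarrow>
    (\<forall>t\<in>pos_orthant. \<forall>L. map fst L = ks \<and> (\<forall>(i, s)\<in>set L. 0 \<le> s) \<longrightarrow> 0 \<le> dint (dirac t * steps L) f)
    \<longleftrightarrow> (\<forall>t\<in>pos_orthant. 0 \<le> (-1) ^ length ks * iterated_partial ks f t)"
proof (induction ks arbitrary: f)
  case Nil
  then show ?case by (auto simp: dint_dirac_mult)
next
  case (Cons k ks)
  let ?d = "\<lambda>s x. f x - f (x + axis k s)"
  have split: "(\<forall>L. map fst L = k # ks \<and> (\<forall>(i, s)\<in>set L. 0 \<le> s) \<longrightarrow> 0 \<le> dint (dirac t * steps L) f)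
      \<longleftrightarrow> (\<forall>s\<ge>0. \<forall>L. map fst L = ks \<and> (\<forall>(i, s)\<in>set L. 0 \<le> s) \<longrightarrow> 0 \<le> dint (dirac t * steps L) (?d s))" for t
  proof -
    have shift: "dint (dirac t * steps ((k, s) # L)) f = dint (dirac t * steps L) (?d s)" for s L
      by (simp add: mult.left_commute[of "dirac t"] dint_step_mult add.commute)
    show ?thesis
    proof (intro iffI allI impI)
      fix s :: real and L :: "('n \<times> real) list"
      assume "\<forall>L. map fst L = k # ks \<and> (\<forall>(i, s)\<in>set L. 0 \<le> s) \<longrightarrow> 0 \<le> dint (dirac t * steps L) f"
        and "0 \<le> s" "map fst L = ks \<and> (\<forall>(i, s)\<in>set L. 0 \<le> s)"
      then have "0 \<le> dint (dirac t * steps ((k, s) # L)) f" by (elim allE[of _ "(k, s) # L"]) auto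
      then show "0 \<le> dint (dirac t * steps L) (?d s)" by (simp only: shift)
    next
      fix L :: "('n \<times> real) list"
      assume A: "\<forall>s\<ge>0. \<forall>L. map fst L = ks \<and> (\<forall>(i, s)\<in>set L. 0 \<le> s) \<longrightarrow> 0 \<le> dint (dirac t * steps L) (?d s)"
        and L: "map fst L = k # ks \<and> (\<forall>(i, s)\<in>set L. 0 \<le> s)"
      then obtain s L' where L': "L = (k, s) # L'" by (cases L) auto
      have "0 \<le> dint (dirac t * steps L') (?d s)" using A L unfolding L' by auto
      then show "0 \<le> dint (dirac t * steps L) f" unfolding L' by (simp only: shift)
    qed
  qed
  have "(\<forall>t\<in>pos_orthant. \<forall>L. map fst L = k # ks \<and> (\<forall>(i, s)\<in>set L. 0 \<le> s) \<longrightarrow> 0 \<le> dint (dirac t * steps L) f)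
    \<longleftrightarrow> (\<forall>s\<ge>0. \<forall>t\<in>pos_orthant. \<forall>L. map fst L = ks \<and> (\<forall>(i, s)\<in>set L. 0 \<le> s) \<longrightarrow> 0 \<le> dint (dirac t * steps L) (?d s))"
    unfolding split by blast
  also have "\<dots> \<longleftrightarrow> (\<forall>s\<ge>0. \<forall>t\<in>pos_orthant. 0 \<le> (-1) ^ length ks * iterated_partial ks (?d s) t)"
    using Cons.IH[OF smooth_on_shift_diff[OF Cons.prems axis_in_orthant]] by (intro all_cong) auto
  also have "\<dots> \<longleftrightarrow> (\<forall>t\<in>pos_orthant. \<forall>s\<ge>0. 0 \<le> (-1) ^ length ks * (iterated_partial ks f t - iterated_partial ks f (t + axis k s)))"
    using iterated_partial_shift_diff[OF Cons.prems axis_in_orthant] by auto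
  also have "\<dots> \<longleftrightarrow> (\<forall>t\<in>pos_orthant. 0 \<le> - ((-1) ^ length ks * partial k (iterated_partial ks f) t))"
    by (rule decreasing_iff_partial_nonpos)
      (use smooth_on_differentiable[OF smooth_on_iterated_partial[OF Cons.prems]] in auto)
  finally show ?case by simp
qed

lemma bernstein_iff_derivatives:
  "bernstein 2 g \<longleftrightarrow> smooth_on pos_orthant g \<and> (\<forall>F \<alpha>. card F = 2 \<longrightarrow> (\<forall>t\<in>pos_orthant.
     0 \<le> (-1) ^ length (index_list \<alpha> @ index_list (\<lambda>i. if i \<in> F then 1 else 0)) *
       iterated_partial (index_list \<alpha> @ index_list (\<lambda>i. if i \<in> F then 1 else 0)) g t))"
  unfolding bernstein_def completely_monotone_def
  by (auto simp: multi_partial_eq_iterated smooth_on_iterated_partial length_index_list power_add sum.If_cases)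

definition mixed_alternating_pos :: "(real^'n::finite \<Rightarrow> real) \<Rightarrow> bool" where
  "mixed_alternating_pos g \<longleftrightarrow> (\<forall>t\<in>pos_orthant. \<forall>L. (\<forall>(i, s)\<in>set L. 0 \<le> s) \<longrightarrow>
     (two_coordinates L) \<longrightarrow> 0 \<le> dint (dirac t * steps L) g)"

lemma steps_perm: "mset L = mset L' \<Longrightarrow> steps L = steps L'"
  by (metis mset_map prod_mset_prod_list)

text \<open>
  Since \<open>steps L\<close> does not depend on the order of \<open>L\<close>, two steps in different directions can be moved to the end and
  the rest sorted.  The list of directions then has exactly the order of the derivatives in \<open>bernstein\<close>.
\<close>

lemma bernstein_iff_mixed_alternating_pos:
  fixes g :: "real^'n::{finite,linorder} \<Rightarrow> real"
  shows "bernstein 2 g \<longleftrightarrow> smooth_on pos_orthant g \<and> mixed_alternating_pos g"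
proof -
  let ?F = "\<lambda>F. index_list (\<lambda>i. if i \<in> F then 1 else 0) :: 'n list"
  have "(\<forall>F \<alpha>. card F = 2 \<longrightarrow> (\<forall>t\<in>pos_orthant. 0 \<le> (-1) ^ length (index_list \<alpha> @ ?F F) * iterated_partial (index_list \<alpha> @ ?F F) g t))
    \<longleftrightarrow> mixed_alternating_pos g" if g: "smooth_on pos_orthant g"
  proof -
    have "(\<forall>F \<alpha>. card F = 2 \<longrightarrow> (\<forall>t\<in>pos_orthant. \<forall>L. map fst L = index_list \<alpha> @ ?F F \<and> (\<forall>(i, s)\<in>set L. 0 \<le> s) \<longrightarrow> 0 \<le> dint (dirac t * steps L) g))
      \<longleftrightarrow> mixed_alternating_pos g" (is "?L \<longleftrightarrow> _")
    proof
      assume L: ?L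
      show "mixed_alternating_pos g"
        unfolding mixed_alternating_pos_def
      proof (intro ballI allI impI)
        fix t :: "(real, 'n) vec" and L :: "('n \<times> real) list"
        assume t: "t \<in> pos_orthant" and nonneg: "\<forall>(i, s)\<in>set L. 0 \<le> s"
          and "two_coordinates L"
        then obtain i j a b where ij: "i \<noteq> j" "(i, a) \<in> set L" "(j, b) \<in> set L" by force
        define R where "R = remove1 (j, b) (remove1 (i, a) L)"
        have "(j, b) \<in> set (remove1 (i, a) L)" using ij by (simp add: in_set_remove1)
        then have msetL: "mset L = mset ([(i, a), (j, b)] @ R)"
        proof -
          have rem: "mset X = add_mset x (mset (remove1 x X))" if "x \<in> set X" for x and X :: "('n \<times> real) list"
            using that by simp
          show ?thesis
            using rem[OF ij(2)] rem[OF \<open>(j, b) \<in> set (remove1 (i, a) L)\<close>] by (simp add: R_def del: mset_remove1)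
        qed
        define L' where "L' = sort_key fst R @ sort_key fst [(i, a), (j, b)]"
        have msetL': "mset L = mset L'" unfolding msetL L'_def by simp
        have "map fst (sort_key fst R) = index_list (count (mset (map fst (sort_key fst R))))"
          by (rule sorted_eq_index_list) simp
        moreover have "map fst (sort_key fst [(i, a), (j, b)]) = ?F {i, j}"
        proof -
          have "count (mset (map fst (sort_key fst [(i, a), (j, b)]))) = (\<lambda>k. if k \<in> {i, j} then 1 else 0)"
            using ij(1) by (auto simp: fun_eq_iff)
          then show ?thesis
            using sorted_eq_index_list[of "map fst (sort_key fst [(i, a), (j, b)])"] by (metis sorted_sort_key)
        qed
        ultimately have "map fst L' = index_list (count (mset (map fst (sort_key fst R)))) @ ?F {i, j}"
          unfolding L'_def map_append by (rule arg_cong2)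
        moreover have "\<forall>(i, s)\<in>set L'. 0 \<le> s" using nonneg msetL' by (metis set_mset_mset)
        moreover have "card {i, j} = 2" using ij(1) by simp
        ultimately have "0 \<le> dint (dirac t * steps L') g" using L t by blast
        then show "0 \<le> dint (dirac t * steps L) g" using steps_perm[OF msetL'] by simp
      qed
    next
      assume m: "mixed_alternating_pos g"
      show ?L
      proof (intro allI impI ballI)
        fix F \<alpha> and t :: "(real, 'n) vec" and L :: "('n \<times> real) list"
        assume F: "card F = 2" and t: "t \<in> pos_orthant" and L: "map fst L = index_list \<alpha> @ ?F F \<and> (\<forall>(i, s)\<in>set L. 0 \<le> s)"
        obtain i j where ij: "F = {i, j}" "i \<noteq> j" using F by (auto simp: card_2_iff)
        have "k \<in> fst ` set L" if "k \<in> F" for k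
        proof -
          have "k \<in># mset (?F F)" using that count_index_list[of "\<lambda>i. if i \<in> F then 1 else 0" k]
            by (metis count_eq_zero_iff zero_neq_one)
          then have "k \<in> set (map fst L)" using L by simp
          then show ?thesis by simp
        qed
        then have "i \<in> fst ` set L" "j \<in> fst ` set L" using ij by auto
        then have "two_coordinates L" using ij(2) by blast
        then show "0 \<le> dint (dirac t * steps L) g"
          using L by (intro m[unfolded mixed_alternating_pos_def, rule_format, OF t]) auto
      qed
    qed
    then show ?thesis using alternating_differences_iff_derivatives[OF g] by blast
  qed
  then show ?thesis unfolding bernstein_iff_derivatives by blast
qed

lemma keys_step:
  fixes i :: "'n::finite"
  assumes "0 \<le> s"
  shows "Poly_Mapping.keys (step i s) \<subseteq> orthant"
proof
  fix x :: "real^'n" assume "x \<in> Poly_Mapping.keys (step i s)"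
  then have "x = 0 \<or> x = axis i s"
    using keys_diff[of "1 :: (real^'n) dmeasure" "dirac (axis i s)"] by (auto simp: step_def dirac_def)
  moreover have "0 \<in> (orthant :: (real^'n) set)" by (simp add: orthant_def)
  ultimately show "x \<in> orthant" using axis_in_orthant[OF assms] by auto
qed

lemma keys_mult_orthant:
  assumes "Poly_Mapping.keys \<mu> \<subseteq> orthant" "Poly_Mapping.keys \<nu> \<subseteq> orthant"
  shows "Poly_Mapping.keys (\<mu> * \<nu>) \<subseteq> (orthant :: (real^'n::finite) set)"
proof -
  have "a + b \<in> orthant" if "a \<in> orthant" "b \<in> orthant" for a b :: "real^'n"
    using that by (simp add: orthant_def)
  then show ?thesis using keys_mult[of \<mu> \<nu>] assms by blast
qed

lemma keys_steps:
  fixes L :: "('n::finite \<times> real) list"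
  assumes "\<forall>(i, s)\<in>set L. 0 \<le> s"
  shows "Poly_Mapping.keys (steps L) \<subseteq> orthant"
  using assms
proof (induction L)
  case (Cons p L)
  then have "Poly_Mapping.keys (step (fst p) (snd p) * steps L) \<subseteq> orthant"
    by (intro keys_mult_orthant keys_step) auto
  then show ?case by (cases p) simp
qed (auto simp: orthant_def)

lemma mixed_alternating_pos_iff:
  fixes g :: "real^'n::finite \<Rightarrow> real"
  assumes cont: "continuous_on orthant g"
  shows "mixed_alternating_pos g \<longleftrightarrow> mixed_alternating g"
proof
  assume "mixed_alternating g"
  then show "mixed_alternating_pos g"
    unfolding mixed_alternating_def mixed_alternating_pos_def using pos_orthant_subset by blast
next
  assume m: "mixed_alternating_pos g"
  show "mixed_alternating g"
    unfolding mixed_alternating_def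
  proof (intro ballI allI impI)
    fix t :: "real^'n" and L :: "('n \<times> real) list"
    assume t: "t \<in> orthant" and L: "\<forall>(i, s)\<in>set L. 0 \<le> s" "two_coordinates L"
    define e where "e k = t + (\<chi> i. 1 / real (Suc k))" for k
    have e: "e k \<in> pos_orthant" for k
      using t by (auto simp: e_def pos_orthant_def orthant_def intro!: add_nonneg_pos)
    have elim: "e \<longlonglongrightarrow> t"
      unfolding e_def
    proof (rule vec_tendstoI)
      fix i
      show "(\<lambda>k. (t + (\<chi> i. 1 / real (Suc k))) $ i) \<longlonglongrightarrow> t $ i"
        using tendsto_add[OF tendsto_const LIMSEQ_Suc[OF lim_1_over_n], of "t $ i"] by simp
    qed
    have keys: "Poly_Mapping.keys (steps L) \<subseteq> orthant" by (rule keys_steps[OF L(1)])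
    have "(\<lambda>k. dint (dirac (e k) * steps L) g) \<longlonglongrightarrow> dint (dirac t * steps L) g"
      unfolding dint_dirac_mult unfolding dint_def
    proof (intro tendsto_intros)
      fix x assume "x \<in> Poly_Mapping.keys (steps L)"
      then have x: "x \<in> orthant" using keys by blast
      show "(\<lambda>k. g (e k + x)) \<longlonglongrightarrow> g (t + x)"
      proof (rule continuous_on_tendsto_compose[OF cont])
        show "(\<lambda>k. e k + x) \<longlonglongrightarrow> t + x" by (intro tendsto_intros elim)
        show "t + x \<in> orthant" using t x by (simp add: orthant_def)
        show "\<forall>\<^sub>F k in sequentially. e k + x \<in> orthant"
          using pos_orthant_subset[OF pos_orthant_add[OF e x]] by simp
      qed
    qed
    moreover have "0 \<le> dint (dirac (e k) * steps L) g" for k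
      using m e L unfolding mixed_alternating_pos_def by blast
    ultimately show "0 \<le> dint (dirac t * steps L) g"
      by (intro LIMSEQ_le_const) auto
  qed
qed


section \<open>Positive definite kernels and discrete measures\<close>

lemma Rd_eq: "Rd d = {x. \<forall>i\<ge>d. x i = 0}"
  by (rule topspace_Euclidean_space)

lemma sqdists_nth: "sqdists d u v $ i = (\<Sum>l<d. (u i l - v i l)\<^sup>2)"
  by (simp add: sqdists_def L2_set_def sum_nonneg)

lemma sqdists_in_orthant: "sqdists d u v \<in> orthant"
  by (auto simp: orthant_def sqdists_nth intro: sum_nonneg)

lemma dist_energy_eq_sum:
  "dist_energy d g \<mu> = (\<Sum>v\<in>Poly_Mapping.keys \<mu>. \<Sum>u\<in>Poly_Mapping.keys \<mu>.
      Poly_Mapping.lookup \<mu> v * Poly_Mapping.lookup \<mu> u * g (sqdists d u v))"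
  by (simp add: dist_energy_def dint_def sum_distrib_left mult_ac)

definition psd_kernel :: "('a \<Rightarrow> 'a \<Rightarrow> real) \<Rightarrow> bool" where
  "psd_kernel K \<longleftrightarrow> (\<forall>S c. finite S \<longrightarrow> 0 \<le> (\<Sum>v\<in>S. \<Sum>u\<in>S. c v * c u * K u v))"

lemma psd_kernel_rank_one_mult:
  fixes K :: "'a \<Rightarrow> 'a \<Rightarrow> real"
  assumes "psd_kernel K"
  shows "psd_kernel (\<lambda>u v. f u * f v * K u v)"
  unfolding psd_kernel_def
proof (intro allI impI)
  fix S :: "'a set" and c :: "'a \<Rightarrow> real" assume "finite S"
  then have "0 \<le> (\<Sum>v\<in>S. \<Sum>u\<in>S. (c v * f v) * (c u * f u) * K u v)"
    using assms[unfolded psd_kernel_def, rule_format, of S "\<lambda>v. c v * f v"] by simp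
  then show "0 \<le> (\<Sum>v\<in>S. \<Sum>u\<in>S. c v * c u * (f u * f v * K u v))"
    by (simp add: mult_ac)
qed

lemma psd_kernel_one: "psd_kernel (\<lambda>_ _. 1)"
  unfolding psd_kernel_def
proof (intro allI impI)
  fix S :: "'a set" and c :: "'a \<Rightarrow> real"
  have "(\<Sum>v\<in>S. \<Sum>u\<in>S. c v * c u * 1) = (\<Sum>v\<in>S. c v)\<^sup>2"
    by (simp add: power2_eq_square sum_product)
  then show "0 \<le> (\<Sum>v\<in>S. \<Sum>u\<in>S. c v * c u * 1)" by simp
qed

lemma psd_kernel_sum:
  fixes K :: "'b \<Rightarrow> 'a \<Rightarrow> 'a \<Rightarrow> real"
  assumes "\<And>a. a \<in> I \<Longrightarrow> psd_kernel (K a)"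
  shows "psd_kernel (\<lambda>u v. \<Sum>a\<in>I. K a u v)"
  unfolding psd_kernel_def
proof (intro allI impI)
  fix S :: "'a set" and c :: "'a \<Rightarrow> real" assume S: "finite S"
  have "(\<Sum>v\<in>S. \<Sum>u\<in>S. c v * c u * (\<Sum>a\<in>I. K a u v)) = (\<Sum>v\<in>S. \<Sum>a\<in>I. \<Sum>u\<in>S. c v * c u * K a u v)"
    by (intro sum.cong refl) (subst sum.swap, simp add: sum_distrib_left)
  also have "\<dots> = (\<Sum>a\<in>I. \<Sum>v\<in>S. \<Sum>u\<in>S. c v * c u * K a u v)" by (rule sum.swap)
  also have "0 \<le> \<dots>" by (rule sum_nonneg) (use assms S in \<open>auto simp: psd_kernel_def\<close>)
  finally show "0 \<le> (\<Sum>v\<in>S. \<Sum>u\<in>S. c v * c u * (\<Sum>a\<in>I. K a u v))" .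
qed

lemma psd_kernel_scale: "0 \<le> b \<Longrightarrow> psd_kernel K \<Longrightarrow> psd_kernel (\<lambda>u v. b * K u v)"
  using psd_kernel_rank_one_mult[of K "\<lambda>_. sqrt b"] by simp

lemma psd_kernel_limit:
  fixes L :: "'a \<Rightarrow> 'a \<Rightarrow> real"
  assumes "\<And>m. psd_kernel (K m)" "\<And>u v. (\<lambda>m :: nat. K m u v) \<longlonglongrightarrow> L u v"
  shows "psd_kernel L"
  unfolding psd_kernel_def
proof (intro allI impI)
  fix S :: "'a set" and c :: "'a \<Rightarrow> real" assume S: "finite S"
  have "(\<lambda>m. \<Sum>v\<in>S. \<Sum>u\<in>S. c v * c u * K m u v) \<longlonglongrightarrow> (\<Sum>v\<in>S. \<Sum>u\<in>S. c v * c u * L u v)"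
    by (intro tendsto_intros assms)
  moreover have "\<And>m. 0 \<le> (\<Sum>v\<in>S. \<Sum>u\<in>S. c v * c u * K m u v)"
    using assms(1) S by (auto simp: psd_kernel_def)
  ultimately show "0 \<le> (\<Sum>v\<in>S. \<Sum>u\<in>S. c v * c u * L u v)" by (intro LIMSEQ_le_const) auto
qed

text \<open>
  The powers of a sum of rank-one kernels are positive definite by induction, and the exponential series has
  nonnegative coefficients.
\<close>

lemma psd_kernel_exp:
  fixes \<phi> :: "'b \<Rightarrow> 'a \<Rightarrow> real"
  shows "psd_kernel (\<lambda>u v. exp (\<Sum>a\<in>I. \<phi> a u * \<phi> a v))"
proof -
  let ?B = "\<lambda>u v. \<Sum>a\<in>I. \<phi> a u * \<phi> a v"
  have pow: "psd_kernel (\<lambda>u v. ?B u v ^ m)" for m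
  proof (induction m)
    case (Suc m)
    have "psd_kernel (\<lambda>u v. \<Sum>a\<in>I. \<phi> a u * \<phi> a v * ?B u v ^ m)"
      by (intro psd_kernel_sum psd_kernel_rank_one_mult Suc)
    then show ?case by (simp add: sum_distrib_right)
  qed (simp add: psd_kernel_one)
  show ?thesis
  proof (rule psd_kernel_limit)
    show "psd_kernel (\<lambda>u v. \<Sum>k<m. (1 / fact k) * ?B u v ^ k)" for m :: nat
      by (intro psd_kernel_sum psd_kernel_scale pow) simp
    show "(\<lambda>m. \<Sum>k<m. (1 / fact k) * ?B u v ^ k) \<longlonglongrightarrow> exp (?B u v)" for u v
      using exp_converges[of "?B u v"] by (simp add: sums_def divide_inverse mult.commute)
  qed
qed

text \<open>
  Expanding the squares, \<open>exp (- \<parallel>u - v\<parallel>\<^sup>2) = exp (- \<parallel>u\<parallel>\<^sup>2) exp (- \<parallel>v\<parallel>\<^sup>2) exp (2 u \<bullet> v)\<close>, here with weights \<open>r\<^sub>i\<close>.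
\<close>

lemma psd_kernel_gaussian:
  fixes r :: "real^'n::finite"
  assumes r: "r \<in> orthant"
  shows "psd_kernel (\<lambda>u v. exp (- (r \<bullet> sqdists d u v)))"
proof -
  define f where "f u = exp (- (\<Sum>i\<in>UNIV. \<Sum>l<d. r $ i * (u i l)\<^sup>2))" for u :: "'n \<Rightarrow> nat \<Rightarrow> real"
  define \<phi> :: "'n \<times> nat \<Rightarrow> ('n \<Rightarrow> nat \<Rightarrow> real) \<Rightarrow> real" where "\<phi> = (\<lambda>(i, l) u. sqrt (2 * r $ i) * (u i l :: real))"
  have "exp (- (r \<bullet> sqdists d u v)) = f u * f v * exp (\<Sum>a\<in>UNIV \<times> {..<d}. \<phi> a u * \<phi> a v)" for u v
  proof -
    have r0: "sqrt (2 * r $ i) * sqrt (2 * r $ i) = 2 * r $ i" for i using r by (simp add: orthant_def)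
    have phi: "\<phi> (i, l) u * \<phi> (i, l) v = 2 * r $ i * (u i l * v i l)" for i l
    proof -
      have "\<phi> (i, l) u * \<phi> (i, l) v = (sqrt (2 * r $ i) * sqrt (2 * r $ i)) * (u i l * v i l)"
        by (simp only: \<phi>_def prod.case) (simp add: mult_ac)
      then show ?thesis by (simp only: r0)
    qed
    have "(\<Sum>a\<in>UNIV \<times> {..<d}. \<phi> a u * \<phi> a v) = (\<Sum>i\<in>UNIV. \<Sum>l<d. 2 * r $ i * (u i l * v i l))"
      by (auto simp: sum.cartesian_product phi intro!: sum.cong)
    moreover have "- (r \<bullet> sqdists d u v) = - (\<Sum>i\<in>UNIV. \<Sum>l<d. r $ i * (u i l)\<^sup>2) + - (\<Sum>i\<in>UNIV. \<Sum>l<d. r $ i * (v i l)\<^sup>2)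
       + (\<Sum>i\<in>UNIV. \<Sum>l<d. 2 * r $ i * (u i l * v i l))"
      by (simp add: inner_vec_def sqdists_nth sum_distrib_left power2_diff algebra_simps sum.distrib sum_subtractf)
    ultimately show ?thesis by (simp add: f_def mult_exp_exp)
  qed
  then show ?thesis using psd_kernel_rank_one_mult[OF psd_kernel_exp] by simp
qed

subsection \<open>Discrete measures annihilating functions of one coordinate\<close>

lemma dmeas_eq_dint: "dmeas \<mu> A = dint \<mu> (indicator A)"
  by (simp add: dmeas_def dint_def sum.inter_restrict indicator_def if_distrib cong: if_cong)

lemma dmeasure_eqI:
  assumes "\<And>f. dint \<mu> f = dint \<nu> f"
  shows "\<mu> = \<nu>"
proof (rule poly_mapping_eqI)
  fix x
  have "dint \<mu> (indicator {x}) = Poly_Mapping.lookup \<mu> x" for \<mu> :: "'a dmeasure"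
    by (subst dint_superset[of "insert x (Poly_Mapping.keys \<mu>)"])
      (auto simp: indicator_def if_distrib in_keys_iff cong: if_cong)
  then show "Poly_Mapping.lookup \<mu> x = Poly_Mapping.lookup \<nu> x" using assms by metis
qed

text \<open>
  The sets \<open>\<Prod>A\<^sub>j\<close> in the definition of \<open>M_space 2\<close> may restrict one coordinate; restricting it to a point shows that
  the measure has total mass zero on each fibre of that coordinate.
\<close>

lemma M_space_two_annihilates:
  fixes \<mu> :: "('n::finite \<Rightarrow> nat \<Rightarrow> real) dmeasure"
  assumes \<mu>: "\<mu> \<in> M_space 2 (\<lambda>_. Rd d)"
  shows "dint \<mu> (\<lambda>u. f (u i)) = 0"
proof -
  let ?K = "Poly_Mapping.keys \<mu>"
  have K: "?K \<subseteq> Rd_pow d" using \<mu> by (auto simp: M_space_def dmeasures_in_def)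
  have fibre: "(\<Sum>u | u \<in> ?K \<and> u i = x. Poly_Mapping.lookup \<mu> u) = 0" if "x \<in> (\<lambda>u. u i) ` ?K" for x
  proof -
    have x: "x \<in> Rd d" using that K by auto
    define A where "A = (\<lambda>j. if j = i then {x} else Rd d)"
    have "card (UNIV - {i}) \<le> card {j. A j = Rd d}" by (rule card_mono) (auto simp: A_def)
    then have "card {j. A j = Rd d} + 2 \<ge> CARD('n) + 1" by (simp add: card_Diff_singleton)
    moreover have "\<forall>j. A j \<subseteq> Rd d" using x by (auto simp: A_def)
    ultimately have "dmeas \<mu> (\<Pi>\<^sub>E j\<in>UNIV. A j) = 0" using \<mu> by (simp add: M_space_def)
    moreover have "?K \<inter> (\<Pi>\<^sub>E j\<in>UNIV. A j) = {u. u \<in> ?K \<and> u i = x}"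
      using K by (auto simp: A_def PiE_iff subset_iff split: if_splits)
    ultimately show ?thesis by (simp add: dmeas_def)
  qed
  have "dint \<mu> (\<lambda>u. f (u i)) = (\<Sum>x\<in>(\<lambda>u. u i) ` ?K. \<Sum>u | u \<in> ?K \<and> u i = x. Poly_Mapping.lookup \<mu> u * f (u i))"
    unfolding dint_def by (rule sum.image_gen) simp
  also have "\<dots> = (\<Sum>x\<in>(\<lambda>u. u i) ` ?K. f x * (\<Sum>u | u \<in> ?K \<and> u i = x. Poly_Mapping.lookup \<mu> u))"
    by (simp add: sum_distrib_left mult.commute)
  also have "\<dots> = 0" using fibre by (intro sum.neutral) simp
  finally show ?thesis .
qed

text \<open>
  At most one of the sets \<open>A\<^sub>i\<close> differs from the whole space, so the indicator of \<open>\<Prod>A\<^sub>i\<close> is a function of one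
  coordinate.
\<close>

lemma M_spaceI_two:
  fixes \<mu> :: "('n::finite \<Rightarrow> nat \<Rightarrow> real) dmeasure"
  assumes K: "Poly_Mapping.keys \<mu> \<subseteq> Rd_pow d" and f: "\<And>f i. dint \<mu> (\<lambda>u. f (u i)) = 0"
  shows "\<mu> \<in> M_space 2 (\<lambda>_. Rd d)"
  unfolding M_space_def dmeasures_in_def
proof (intro CollectI conjI K allI impI)
  fix A :: "'n \<Rightarrow> (nat \<Rightarrow> real) set"
  assume A: "(\<forall>i. A i \<subseteq> Rd d) \<and> CARD('n) + 1 \<le> card {i. A i = Rd d} + 2"
  have "card {i. A i = Rd d} + card {i. A i \<noteq> Rd d} = CARD('n)"
    by (subst card_Un_disjoint[symmetric]) (auto intro!: arg_cong[where f = card])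
  then have "card {i. A i \<noteq> Rd d} \<le> 1" using A by linarith
  then have "\<exists>i. {i. A i \<noteq> Rd d} \<subseteq> {i}"
    by (metis card_le_Suc0_iff_eq[OF finite] One_nat_def insertI1 singletonI subsetI)
  then obtain i where i: "\<And>j. j \<noteq> i \<Longrightarrow> A j = Rd d" by blast
  have "dmeas \<mu> (\<Pi>\<^sub>E i\<in>UNIV. A i) = dint \<mu> (\<lambda>u. indicator (A i) (u i))"
    unfolding dmeas_eq_dint
  proof (rule dint_cong)
    fix u assume "u \<in> Poly_Mapping.keys \<mu>"
    then have "\<And>j. u j \<in> Rd d" using K by (auto simp: PiE_iff)
    then have "u \<in> (\<Pi>\<^sub>E i\<in>UNIV. A i) \<longleftrightarrow> u i \<in> A i" using i by (metis PiE_iff UNIV_I extensional_UNIV)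
    then show "indicator (\<Pi>\<^sub>E i\<in>UNIV. A i) u = (indicator (A i) (u i) :: real)" by (simp add: indicator_def)
  qed
  then show "dmeas \<mu> (\<Pi>\<^sub>E i\<in>UNIV. A i) = 0" using f by simp
qed

lemma dint_dprod:
  "dint (dprod_meas \<mu>) f = (\<Sum>u\<in>(\<Pi>\<^sub>E i\<in>UNIV. Poly_Mapping.keys (\<mu> i)). (\<Prod>i\<in>UNIV. Poly_Mapping.lookup (\<mu> i) (u i)) * f u)"
  by (simp add: dprod_meas_def dint_sum)

lemma dint_dprod_prod:
  "dint (dprod_meas \<mu>) (\<lambda>u. \<Prod>i\<in>UNIV. h i (u i)) = (\<Prod>i\<in>UNIV. dint (\<mu> i) (h i))"
proof -
  have "(\<Prod>i\<in>UNIV. dint (\<mu> i) (h i)) = (\<Sum>u\<in>(\<Pi>\<^sub>E i\<in>UNIV. Poly_Mapping.keys (\<mu> i)). \<Prod>i\<in>UNIV. Poly_Mapping.lookup (\<mu> i) (u i) * h i (u i))"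
    unfolding dint_def by (rule prod_sum_PiE) auto
  then show ?thesis by (simp add: dint_dprod prod.distrib)
qed

lemma dint_dprod_coordinate:
  "dint (dprod_meas \<mu>) (\<lambda>u. f (u i)) = dint (\<mu> i) f * (\<Prod>j\<in>UNIV - {i}. dint (\<mu> j) (\<lambda>_. 1))"
proof -
  have "(\<Prod>j\<in>UNIV. (if j = i then f else (\<lambda>_. 1)) (u j)) = f (u i)" for u
    by (subst prod.remove[of _ i]) (auto intro!: prod.neutral)
  then have "dint (dprod_meas \<mu>) (\<lambda>u. f (u i)) = (\<Prod>j\<in>UNIV. dint (\<mu> j) (if j = i then f else (\<lambda>_. 1)))"
    using dint_dprod_prod[of \<mu> "\<lambda>j. if j = i then f else (\<lambda>_. 1)"] by simp
  also have "\<dots> = dint (\<mu> i) f * (\<Prod>j\<in>UNIV - {i}. dint (\<mu> j) (\<lambda>_. 1))"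
    by (subst prod.remove[of _ i]) (auto intro!: prod.cong)
  finally show ?thesis .
qed

lemma keys_dprod: "Poly_Mapping.keys (dprod_meas \<mu>) \<subseteq> (\<Pi>\<^sub>E i\<in>UNIV. Poly_Mapping.keys (\<mu> i))"
  unfolding dprod_meas_def by (rule order_trans[OF keys_sum]) (auto split: if_splits)

lemma keys_dprod_Rd:
  assumes "\<And>i. Poly_Mapping.keys (\<mu> i) \<subseteq> Rd d"
  shows "Poly_Mapping.keys (dprod_meas \<mu>) \<subseteq> Rd_pow d"
  using keys_dprod[of \<mu>] assms by (force simp: PiE_iff)

lemma dmeas_total: "Poly_Mapping.keys \<mu> \<subseteq> X \<Longrightarrow> dmeas \<mu> X = dint \<mu> (\<lambda>_. 1)"
  unfolding dmeas_eq_dint by (rule dint_cong) auto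

lemma dint_dmarginal: "dint (dmarginal P i) f = dint P (\<lambda>u. f (u i))"
  by (simp add: dmarginal_def dint_sum) (simp add: dint_def)

subsection \<open>Product measures and independence\<close>

lemma PDI_two_iff: "PDI 2 g \<longleftrightarrow> (\<forall>d\<ge>1. \<forall>\<mu>\<in>M_space 2 (\<lambda>i. Rd d). 0 \<le> dist_energy d g \<mu>)"
  by (simp add: PDI_def)

lemma product_in_M_space:
  fixes \<mu> :: "'n::finite \<Rightarrow> (nat \<Rightarrow> real) dmeasure"
  assumes \<mu>: "\<And>i. \<mu> i \<in> dmeasures_in (Rd d)" and two: "card {i. dmeas (\<mu> i) (Rd d) = 0} \<ge> 2"
  shows "dprod_meas \<mu> \<in> M_space 2 (\<lambda>_. Rd d)"
proof (rule M_spaceI_two)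
  have K: "Poly_Mapping.keys (\<mu> i) \<subseteq> Rd d" for i using \<mu> by (simp add: dmeasures_in_def)
  show "Poly_Mapping.keys (dprod_meas \<mu>) \<subseteq> Rd_pow d" by (rule keys_dprod_Rd[OF K])
  fix f :: "(nat \<Rightarrow> real) \<Rightarrow> real" and i
  have "\<not> {i. dmeas (\<mu> i) (Rd d) = 0} \<subseteq> {i}"
    using two card_mono[of "{i}" "{i. dmeas (\<mu> i) (Rd d) = 0}"] by auto
  then obtain j where "j \<noteq> i" "dint (\<mu> j) (\<lambda>_. 1) = 0" using dmeas_total[OF K] by auto
  then have "(\<Prod>j\<in>UNIV - {i}. dint (\<mu> j) (\<lambda>_. 1)) = 0" by (intro prod_zero) auto
  then show "dint (dprod_meas \<mu>) (\<lambda>u. f (u i)) = 0" by (simp add: dint_dprod_coordinate)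
qed

lemma centred_prob_in_M_space:
  fixes P :: "('n::finite \<Rightarrow> nat \<Rightarrow> real) dmeasure"
  assumes P: "P \<in> dprobs_in (Rd_pow d)"
  shows "P - dprod_meas (dmarginal P) \<in> M_space 2 (\<lambda>_. Rd d)"
proof (rule M_spaceI_two)
  have K: "Poly_Mapping.keys P \<subseteq> Rd_pow d" and one: "dmeas P (Rd_pow d) = 1"
    using P by (auto simp: dprobs_in_def dmeasures_in_def)
  have marg: "Poly_Mapping.keys (dmarginal P i) \<subseteq> Rd d" for i
    unfolding dmarginal_def by (rule order_trans[OF keys_sum]) (use K in \<open>auto simp: PiE_iff split: if_splits\<close>)
  show "Poly_Mapping.keys (P - dprod_meas (dmarginal P)) \<subseteq> Rd_pow d"
    using keys_diff[of P "dprod_meas (dmarginal P)"] K keys_dprod_Rd[of "dmarginal P", OF marg] by blast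
  have "dint P (\<lambda>_. 1) = 1" using one dmeas_total[OF K] by simp
  then show "dint (P - dprod_meas (dmarginal P)) (\<lambda>u. f (u i)) = 0" for f i
    by (simp add: dint_diff dint_dprod_coordinate dint_dmarginal)
qed

text \<open>
  If \<open>\<mu>\<close> annihilates the functions of one coordinate and \<open>Q\<close> is a product of probabilities, then \<open>Q + \<epsilon> \<mu>\<close> has
  the same marginals as \<open>Q\<close>, so the difference to the product of its marginals is \<open>\<epsilon> \<mu>\<close>.  For \<open>Q\<close> uniform on a grid
  that contains the support of \<open>\<mu>\<close> and for small \<open>\<epsilon>\<close> it is a probability.
\<close>

lemma PDI_two_if_centred_probs:
  fixes g :: "real^'n::finite \<Rightarrow> real"
  assumes *: "\<And>d P. 1 \<le> d \<Longrightarrow> P \<in> dprobs_in (Rd_pow d) \<Longrightarrow> 0 \<le> dist_energy d g (P - dprod_meas (dmarginal P))"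
  shows "PDI 2 g"
  unfolding PDI_two_iff
proof (intro allI impI ballI)
  fix d :: nat and \<mu> :: "('n \<Rightarrow> nat \<Rightarrow> real) dmeasure"
  assume d: "1 \<le> d" and \<mu>: "\<mu> \<in> M_space 2 (\<lambda>_. Rd d)"
  show "0 \<le> dist_energy d g \<mu>"
  proof (cases "Poly_Mapping.keys \<mu> = {}")
    case True
    then show ?thesis by (simp add: dist_energy_eq_sum)
  next
    case False
    have K: "Poly_Mapping.keys \<mu> \<subseteq> Rd_pow d" using \<mu> by (auto simp: M_space_def dmeasures_in_def)
    define C where "C i = (\<lambda>u. u i) ` Poly_Mapping.keys \<mu>" for i
    have C: "finite (C i)" "C i \<noteq> {}" "C i \<subseteq> Rd d" for i
      using False K by (auto simp: C_def PiE_iff)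
    define q where "q = (\<Prod>i\<in>UNIV. 1 / real (card (C i)))"
    have q: "0 < q" unfolding q_def using C by (intro prod_pos) (simp add: card_gt_0_iff)
    define Q where "Q i = (\<Sum>x\<in>C i. Poly_Mapping.single x (1 / real (card (C i))))" for i
    have lkQ: "Poly_Mapping.lookup (Q i) x = (if x \<in> C i then 1 / real (card (C i)) else 0)" for i x
      unfolding Q_def using C(1) by (simp add: lookup_sum lookup_single when_def)
    have keysQ: "Poly_Mapping.keys (Q i) = C i" for i
      using C by (auto simp: in_keys_iff lkQ split: if_splits)
    have Q1: "dint (Q i) (\<lambda>_. 1) = 1" for i
      unfolding Q_def using C by (simp add: dint_sum)
    \<comment> \<open>small enough for \<open>\<epsilon> * \<bar>\<mu> u\<bar> \<le> q\<close>, the mass of every point of the grid\<close>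
    define \<epsilon> where "\<epsilon> = q / (1 + (\<Sum>u\<in>Poly_Mapping.keys \<mu>. \<bar>Poly_Mapping.lookup \<mu> u\<bar>))"
    have S: "0 < 1 + (\<Sum>u\<in>Poly_Mapping.keys \<mu>. \<bar>Poly_Mapping.lookup \<mu> u\<bar>)"
      by (intro add_pos_nonneg sum_nonneg) auto
    have \<epsilon>: "0 < \<epsilon>" using q S by (simp add: \<epsilon>_def)
    define \<nu> where "\<nu> = (\<Sum>u\<in>Poly_Mapping.keys \<mu>. Poly_Mapping.single u (\<epsilon> * Poly_Mapping.lookup \<mu> u))"
    have lk\<nu>: "Poly_Mapping.lookup \<nu> u = \<epsilon> * Poly_Mapping.lookup \<mu> u" for u
      unfolding \<nu>_def by (auto simp: lookup_sum lookup_single when_def in_keys_iff)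
    have int\<nu>: "dint \<nu> f = \<epsilon> * dint \<mu> f" for f
      unfolding \<nu>_def by (simp add: dint_sum) (simp add: dint_def sum_distrib_left mult.assoc)
    define P where "P = dprod_meas Q + \<nu>"
    have lkprod: "Poly_Mapping.lookup (dprod_meas Q) u = (if u \<in> (\<Pi>\<^sub>E i\<in>UNIV. C i) then q else 0)" for u
    proof -
      have "Poly_Mapping.lookup (dprod_meas Q) u = (if u \<in> (\<Pi>\<^sub>E i\<in>UNIV. C i) then (\<Prod>i\<in>UNIV. Poly_Mapping.lookup (Q i) (u i)) else 0)"
        unfolding dprod_meas_def keysQ using C by (simp add: lookup_sum lookup_single when_def finite_PiE)
      then show ?thesis by (auto simp: lkQ q_def PiE_iff intro!: prod.cong)
    qed
    have keys\<nu>: "Poly_Mapping.keys \<nu> \<subseteq> Poly_Mapping.keys \<mu>" by (auto simp: in_keys_iff lk\<nu>)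
    have KP: "Poly_Mapping.keys P \<subseteq> Rd_pow d"
      using keys_add[of "dprod_meas Q" \<nu>] keys_dprod_Rd[of Q d] keysQ C(3) keys\<nu> K unfolding P_def by blast
    have nonneg: "0 \<le> Poly_Mapping.lookup P u" for u
    proof (cases "u \<in> Poly_Mapping.keys \<mu>")
      case True
      then have "u \<in> (\<Pi>\<^sub>E i\<in>UNIV. C i)" by (auto simp: C_def)
      moreover have "\<epsilon> * \<bar>Poly_Mapping.lookup \<mu> u\<bar> \<le> q"
      proof -
        have "\<bar>Poly_Mapping.lookup \<mu> u\<bar> \<le> (\<Sum>u\<in>Poly_Mapping.keys \<mu>. \<bar>Poly_Mapping.lookup \<mu> u\<bar>)"
          using True by (intro member_le_sum) auto
        then have "\<epsilon> * \<bar>Poly_Mapping.lookup \<mu> u\<bar> \<le> \<epsilon> * (1 + (\<Sum>u\<in>Poly_Mapping.keys \<mu>. \<bar>Poly_Mapping.lookup \<mu> u\<bar>))"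
          using \<epsilon> by (intro mult_left_mono) auto
        then show ?thesis using S by (simp add: \<epsilon>_def)
      qed
      moreover have "- (\<epsilon> * \<bar>Poly_Mapping.lookup \<mu> u\<bar>) \<le> \<epsilon> * Poly_Mapping.lookup \<mu> u"
        using \<epsilon> by (simp add: abs_if)
      ultimately show ?thesis by (simp add: P_def lookup_add lkprod lk\<nu>)
    next
      case False
      then show ?thesis using q by (simp add: P_def lookup_add lkprod lk\<nu> in_keys_iff)
    qed
    have ann: "dint \<mu> (\<lambda>u. f (u i)) = 0" for f i by (rule M_space_two_annihilates[OF \<mu>])
    have marg: "dmarginal P = Q"
    proof (rule ext, rule dmeasure_eqI)
      fix i f
      show "dint (dmarginal P i) f = dint (Q i) f"
        by (simp add: dint_dmarginal P_def dint_add dint_dprod_coordinate Q1 int\<nu> ann)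
    qed
    have "dmeas P (Rd_pow d) = 1"
      using dmeas_total[OF KP] ann[of "\<lambda>_. 1"] dint_dprod_coordinate[of Q "\<lambda>_. 1"]
      by (simp add: P_def dint_add int\<nu> Q1)
    then have "P \<in> dprobs_in (Rd_pow d)" using KP nonneg by (simp add: dprobs_in_def dmeasures_in_def)
    from *[OF d this] have "0 \<le> dist_energy d g \<nu>" unfolding marg by (simp add: P_def)
    also have "dist_energy d g \<nu> = \<epsilon>\<^sup>2 * dist_energy d g \<mu>"
      by (simp add: dist_energy_def int\<nu> dint_fun_mult power2_eq_square)
    finally show ?thesis using \<epsilon> by (simp add: zero_le_mult_iff)
  qed
qed


subsection \<open>Product measures see all mixed differences\<close>

definition sqdist :: "nat \<Rightarrow> (nat \<Rightarrow> real) \<Rightarrow> (nat \<Rightarrow> real) \<Rightarrow> real" where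
  "sqdist d x y = (\<Sum>l<d. (x l - y l)\<^sup>2)"

lemma dint_of_nat_mult: "dint (of_nat c * \<mu>) f = real c * dint \<mu> f" for \<mu> :: "('a::monoid_add) dmeasure"
  by (induction c) (auto simp: dint_add algebra_simps)

text \<open>
  The law of the squared distance under \<open>\<mu> \<times> \<mu>\<close>, written along the axis \<open>i\<close>.  For \<open>N\<close> orthogonal points of length
  \<open>sqrt (t / 2)\<close> the distance is \<open>0\<close> on the diagonal and \<open>t\<close> off it.  Replacing \<open>\<mu>\<close> by \<open>\<mu> \<times> (\<delta>\<^sub>0 - \<delta>\<^sub>x)\<close>, with
  \<open>x = sqrt s\<close> in a new coordinate, adds \<open>s\<close> to the squared distance for mixed pairs, which carry the sign \<open>-1\<close>,
  and \<open>0\<close> for the others; this is the factor \<open>2 (1 - E\<^sub>s)\<close>.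
\<close>

lemma step_list_measure:
  fixes i :: "'n::finite" and t :: real
  assumes t: "0 \<le> t" and "\<forall>s\<in>set ss. 0 \<le> s"
  shows "\<exists>d \<mu>. Poly_Mapping.keys \<mu> \<subseteq> Rd d \<and> (ss \<noteq> [] \<longrightarrow> dint \<mu> (\<lambda>_. 1) = 0) \<and>
    (\<forall>\<phi>. dint \<mu> (\<lambda>v. dint \<mu> (\<lambda>u. \<phi> (axis i (sqdist d u v)))) =
      dint ((of_nat N + of_nat (N * (N - 1)) * dirac (axis i t)) * (\<Prod>s\<leftarrow>ss. of_nat 2 * step i s)) (\<phi> :: real^'n \<Rightarrow> real))"
  using assms(2)
proof (induction ss)
  case Nil
  \<comment> \<open>orthogonal points at mutual squared distance \<open>t / 2 + t / 2\<close>\<close>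
  define e where "e a = (\<lambda>l. if l = a then sqrt (t / 2) else 0)" for a :: nat
  define \<mu> where "\<mu> = (\<Sum>a<N. Poly_Mapping.single (e a) (1::real))"
  have int: "dint \<mu> f = (\<Sum>a<N. f (e a))" for f by (simp add: \<mu>_def dint_sum)
  have dist: "sqdist N (e a) (e b) = (if a = b then 0 else t)" if ab: "a < N" "b < N" for a b
  proof (cases "a = b")
    case False
    have "sqdist N (e a) (e b) = (\<Sum>l<N. (if l = a then t / 2 else 0) + (if l = b then t / 2 else 0))"
      unfolding sqdist_def e_def using False t by (intro sum.cong) (auto simp: real_sqrt_pow2)
    also have "\<dots> = t" using ab by (simp add: sum.distrib)
    finally show ?thesis using False by simp
  qed (simp add: sqdist_def)
  have "dint \<mu> (\<lambda>v. dint \<mu> (\<lambda>u. \<phi> (axis i (sqdist N u v)))) = dint (of_nat N + of_nat (N * (N - 1)) * dirac (axis i t)) \<phi>"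
    for \<phi> :: "real^'n \<Rightarrow> real"
  proof -
    have "dint \<mu> (\<lambda>v. dint \<mu> (\<lambda>u. \<phi> (axis i (sqdist N u v)))) = (\<Sum>b<N. \<Sum>a<N. if a = b then \<phi> (axis i 0) else \<phi> (axis i t))"
      unfolding int by (intro sum.cong refl) (auto simp: dist)
    also have "\<dots> = (\<Sum>b<N. \<phi> (axis i 0) + real (N - 1) * \<phi> (axis i t))"
    proof (rule sum.cong)
      fix b assume b: "b \<in> {..<N}"
      have "(\<Sum>a<N. if a = b then \<phi> (axis i 0) else \<phi> (axis i t)) = \<phi> (axis i 0) + (\<Sum>a\<in>{..<N} - {b}. \<phi> (axis i t))"
        using b by (subst sum.remove[of _ b]) (auto intro!: sum.cong)
      then show "(\<Sum>a<N. if a = b then \<phi> (axis i 0) else \<phi> (axis i t)) = \<phi> (axis i 0) + real (N - 1) * \<phi> (axis i t)"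
        using b by simp
    qed simp
    also have "\<dots> = real N * \<phi> 0 + real (N * (N - 1)) * \<phi> (axis i t)"
    proof -
      have ax0: "axis i (0::real) = 0" by (simp add: vec_eq_iff axis_def)
      show ?thesis unfolding ax0 by (simp add: algebra_simps)
    qed
    also have "\<dots> = dint (of_nat N + of_nat (N * (N - 1)) * dirac (axis i t)) \<phi>"
    proof -
      have "dint (of_nat N) \<phi> = real N * \<phi> 0" using dint_of_nat_mult[of N 1 \<phi>] by simp
      then show ?thesis by (simp only: dint_add dint_of_nat_mult dint_dirac)
    qed
    finally show ?thesis .
  qed
  moreover have "Poly_Mapping.keys \<mu> \<subseteq> Rd N"
    unfolding \<mu>_def by (rule order_trans[OF keys_sum]) (auto simp: e_def Rd_eq split: if_splits)
  ultimately show ?case by (intro exI[of _ N] exI[of _ \<mu>]) simp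
next
  case (Cons s ss)
  then obtain d \<mu> where K: "Poly_Mapping.keys \<mu> \<subseteq> Rd d"
    and E: "\<And>\<phi> :: real^'n \<Rightarrow> real. dint \<mu> (\<lambda>v. dint \<mu> (\<lambda>u. \<phi> (axis i (sqdist d u v)))) =
      dint ((of_nat N + of_nat (N * (N - 1)) * dirac (axis i t)) * (\<Prod>s\<leftarrow>ss. of_nat 2 * step i s)) \<phi>"
    by auto
  have s: "0 \<le> s" using Cons.prems by simp
  \<comment> \<open>coordinate \<open>d\<close> vanishes on the support of \<open>\<mu>\<close>, so \<open>up\<close> is the translation by \<open>sqrt s\<close> in a new direction\<close>
  define up where "up x = x(d := sqrt s)" for x :: "nat \<Rightarrow> real"
  define \<nu> where "\<nu> = (\<Sum>x\<in>Poly_Mapping.keys \<mu>. Poly_Mapping.single x (Poly_Mapping.lookup \<mu> x) - Poly_Mapping.single (up x) (Poly_Mapping.lookup \<mu> x))"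
  have int: "dint \<nu> f = dint \<mu> (\<lambda>x. f x - f (up x))" for f
    by (simp add: \<nu>_def dint_sum dint_diff) (simp add: dint_def algebra_simps)
  have keys: "Poly_Mapping.keys \<nu> \<subseteq> Rd (Suc d)"
  proof -
    have "Poly_Mapping.keys (Poly_Mapping.single x c - Poly_Mapping.single (up x) c) \<subseteq> Rd (Suc d)" if "x \<in> Poly_Mapping.keys \<mu>" for x and c :: real
    proof -
      have "x \<in> Rd d" using that K by blast
      then have "x \<in> Rd (Suc d)" "up x \<in> Rd (Suc d)" by (auto simp: Rd_eq up_def)
      then show ?thesis
        using keys_diff[of "Poly_Mapping.single x c" "Poly_Mapping.single (up x) c"] by (auto split: if_splits)
    qed
    then show ?thesis unfolding \<nu>_def by (intro order_trans[OF keys_sum] UN_least)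
  qed
  have dist: "sqdist (Suc d) u v = sqdist d u v" "sqdist (Suc d) (up u) v = sqdist d u v + s"
      "sqdist (Suc d) u (up v) = sqdist d u v + s" "sqdist (Suc d) (up u) (up v) = sqdist d u v"
    if "u \<in> Poly_Mapping.keys \<mu>" "v \<in> Poly_Mapping.keys \<mu>" for u v
  proof -
    have "u d = 0" "v d = 0" using that K by (auto simp: Rd_eq subset_iff)
    then show "sqdist (Suc d) u v = sqdist d u v" "sqdist (Suc d) (up u) v = sqdist d u v + s"
      "sqdist (Suc d) u (up v) = sqdist d u v + s" "sqdist (Suc d) (up u) (up v) = sqdist d u v"
      using s by (auto simp: sqdist_def up_def)
  qed
  have "dint \<nu> (\<lambda>v. dint \<nu> (\<lambda>u. \<phi> (axis i (sqdist (Suc d) u v)))) =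
      dint ((of_nat N + of_nat (N * (N - 1)) * dirac (axis i t)) * (\<Prod>s\<leftarrow>s # ss. of_nat 2 * step i s)) \<phi>"
    for \<phi> :: "real^'n \<Rightarrow> real"
  proof -
    define \<psi> where "\<psi> x = real 2 * (\<phi> x - \<phi> (axis i s + x))" for x
    have ax: "axis i (x + s) = axis i s + axis i x" for x by (simp add: vec_eq_iff axis_def)
    have "dint \<nu> (\<lambda>v. dint \<nu> (\<lambda>u. \<phi> (axis i (sqdist (Suc d) u v)))) = dint \<mu> (\<lambda>v. dint \<mu> (\<lambda>u. \<psi> (axis i (sqdist d u v))))"
      unfolding int dint_fun_diff[symmetric]
    proof (intro dint_cong)
      fix v u assume "v \<in> Poly_Mapping.keys \<mu>" "u \<in> Poly_Mapping.keys \<mu>"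
      then show "\<phi> (axis i (sqdist (Suc d) u v)) - \<phi> (axis i (sqdist (Suc d) (up u) v)) -
          (\<phi> (axis i (sqdist (Suc d) u (up v))) - \<phi> (axis i (sqdist (Suc d) (up u) (up v)))) = \<psi> (axis i (sqdist d u v))"
        by (simp add: dist ax \<psi>_def)
    qed
    also have "\<dots> = dint (((of_nat N + of_nat (N * (N - 1)) * dirac (axis i t)) * (\<Prod>s\<leftarrow>ss. of_nat 2 * step i s))) \<psi>"
      by (rule E)
    also have "\<dots> = dint (of_nat 2 * (step i s * ((of_nat N + of_nat (N * (N - 1)) * dirac (axis i t)) * (\<Prod>s\<leftarrow>ss. of_nat 2 * step i s)))) \<phi>"
      unfolding dint_of_nat_mult dint_step_mult \<psi>_def dint_fun_mult ..
    finally show ?thesis by (simp add: mult_ac)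
  qed
  moreover have "dint \<nu> (\<lambda>_. 1) = 0" by (simp add: int) (simp add: dint_def)
  ultimately show ?case using keys by blast
qed

lemma sqdist_mono_dim:
  assumes "u \<in> Rd d" "v \<in> Rd d" "d \<le> d'"
  shows "sqdist d' u v = sqdist d u v"
  unfolding sqdist_def
  by (rule sum.mono_neutral_right) (use assms in \<open>auto simp: Rd_eq\<close>)

text \<open>
  The laws of the squared distances in the coordinates are independent, so the joint law is the convolution of
  the laws along the axes.
\<close>

lemma dist_energy_dprod:
  fixes \<mu> :: "'n::finite \<Rightarrow> (nat \<Rightarrow> real) dmeasure"
  assumes M: "\<And>i \<phi>. dint (\<mu> i) (\<lambda>v. dint (\<mu> i) (\<lambda>u. \<phi> (axis i (sqdist d u v)))) = dint (M i) (\<phi> :: real^'n \<Rightarrow> real)"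
  shows "dist_energy d g (dprod_meas \<mu>) = dint (\<Prod>i\<in>UNIV. M i) g"
proof -
  let ?K = "\<lambda>i. Poly_Mapping.keys (\<mu> i)" and ?l = "\<lambda>i. Poly_Mapping.lookup (\<mu> i)"
  have M_eq: "M i = (\<Sum>p\<in>?K i \<times> ?K i. Poly_Mapping.single (axis i (sqdist d (snd p) (fst p))) (?l i (fst p) * ?l i (snd p)))" for i
  proof (rule dmeasure_eqI)
    fix \<phi> :: "real^'n \<Rightarrow> real"
    show "dint (M i) \<phi> = dint (\<Sum>p\<in>?K i \<times> ?K i. Poly_Mapping.single (axis i (sqdist d (snd p) (fst p))) (?l i (fst p) * ?l i (snd p))) \<phi>"
      unfolding M[symmetric]
      by (simp add: dint_sum sum.cartesian_product' ) (simp add: dint_def sum_distrib_left mult.assoc)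
  qed
  have prod_single: "(\<Prod>i\<in>I. Poly_Mapping.single (x i) (c i)) = Poly_Mapping.single (\<Sum>i\<in>I. x i) (\<Prod>i\<in>I. c i)"
    for I and x :: "'n \<Rightarrow> real^'n" and c :: "'n \<Rightarrow> real"
    by (induction I rule: infinite_finite_induct) (auto simp: mult_single)
  have "(\<Prod>i\<in>UNIV. M i) = (\<Sum>\<beta>\<in>(\<Pi>\<^sub>E i\<in>UNIV. ?K i \<times> ?K i). Poly_Mapping.single (\<Sum>i\<in>UNIV. axis i (sqdist d (snd (\<beta> i)) (fst (\<beta> i))))
      (\<Prod>i\<in>UNIV. ?l i (fst (\<beta> i)) * ?l i (snd (\<beta> i))))"
    unfolding M_eq by (subst prod_sum_PiE) (auto simp: prod_single)
  moreover have "(\<Sum>i\<in>UNIV. axis i (sqdist d (snd (\<beta> i)) (fst (\<beta> i)))) = sqdists d (\<lambda>i. snd (\<beta> i)) (\<lambda>i. fst (\<beta> i))" for \<beta> :: "'n \<Rightarrow> (nat \<Rightarrow> real) \<times> (nat \<Rightarrow> real)"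
    by (simp add: vec_eq_iff sqdists_nth axis_def sqdist_def if_distrib[of "\<lambda>x. x = _"] cong: if_cong)
  ultimately have "dint (\<Prod>i\<in>UNIV. M i) g = (\<Sum>\<beta>\<in>(\<Pi>\<^sub>E i\<in>UNIV. ?K i \<times> ?K i). (\<Prod>i\<in>UNIV. ?l i (fst (\<beta> i)) * ?l i (snd (\<beta> i))) * g (sqdists d (\<lambda>i. snd (\<beta> i)) (\<lambda>i. fst (\<beta> i))))"
    by (simp add: dint_sum)
  also have "\<dots> = (\<Sum>(v, u)\<in>(\<Pi>\<^sub>E i\<in>UNIV. ?K i) \<times> (\<Pi>\<^sub>E i\<in>UNIV. ?K i). (\<Prod>i\<in>UNIV. ?l i (v i) * ?l i (u i)) * g (sqdists d u v))"
    by (rule sum.reindex_bij_witness[of _ "\<lambda>(v, u) i. (v i, u i)" "\<lambda>\<beta>. (\<lambda>i. fst (\<beta> i), \<lambda>i. snd (\<beta> i))"])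
      (auto simp: PiE_iff mem_Times_iff)
  also have "\<dots> = dist_energy d g (dprod_meas \<mu>)"
    unfolding dist_energy_def dint_dprod
    by (simp add: sum.cartesian_product[symmetric] sum_distrib_left prod.distrib mult.assoc)
  finally show ?thesis by simp
qed

lemma steps_by_coordinate:
  "(\<Prod>i\<in>(UNIV::'n::finite set). \<Prod>s\<leftarrow>map snd (filter (\<lambda>p. fst p = i) L). step i s) = steps L"
proof (induction L)
  case (Cons p L)
  obtain k a where p: "p = (k, a)" by (cases p)
  have "(\<Prod>i\<in>(UNIV::'n set). \<Prod>s\<leftarrow>map snd (filter (\<lambda>p. fst p = i) (p # L)). step i s)
    = (\<Prod>i\<in>UNIV. (if i = k then step k a else 1) * (\<Prod>s\<leftarrow>map snd (filter (\<lambda>p. fst p = i) L). step i s))"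
    by (intro prod.cong) (auto simp: p)
  then show ?case using Cons by (simp add: prod.distrib p)
qed simp

text \<open>
  For the product of the measures of \<open>step_list_measure\<close> the energy is, up to a positive factor,
  \<open>\<Prod>\<^sub>i (1 + m E\<^sub>i) \<Prod>\<^sub>l (1 - E\<^sub>l)\<close> applied to \<open>g\<close> at the origin, where \<open>E\<^sub>i\<close> is the translation by \<open>t\<^sub>i\<close> in direction \<open>i\<close>,
  \<open>l\<close> runs through the list of steps and \<open>m + 1\<close> is the number of points.  Dividing by \<open>m\<^sup>n\<close> and letting \<open>m\<close> tend to
  infinity leaves the term \<open>\<Prod>\<^sub>i E\<^sub>i\<close>, the translation by \<open>t\<close>.
\<close>

lemma mixed_alternating_if_products:
  fixes g :: "real^'n::finite \<Rightarrow> real"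
  assumes *: "\<And>d (\<mu> :: 'n \<Rightarrow> (nat \<Rightarrow> real) dmeasure). 1 \<le> d \<Longrightarrow> (\<forall>i. \<mu> i \<in> dmeasures_in (Rd d)) \<Longrightarrow>
      card {i. dmeas (\<mu> i) (Rd d) = 0} \<ge> 2 \<Longrightarrow> 0 \<le> dist_energy d g (dprod_meas \<mu>)"
  shows "mixed_alternating g"
  unfolding mixed_alternating_def
proof (intro ballI allI impI)
  fix t :: "real^'n" and L :: "('n \<times> real) list"
  assume t: "t \<in> orthant" and L: "\<forall>(i, s)\<in>set L. 0 \<le> s" and two: "two_coordinates L"
  let ?ss = "\<lambda>i. map snd (filter (\<lambda>p. fst p = i) L)"
  have energy: "0 \<le> dint ((\<Prod>i\<in>UNIV. 1 + of_nat m * dirac (axis i (t $ i))) * steps L) g" for m :: nat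
  proof -
    define N where "N = Suc m"
    let ?W = "\<lambda>i. (of_nat N + of_nat (N * (N - 1)) * dirac (axis i (t $ i))) * (\<Prod>s\<leftarrow>?ss i. of_nat 2 * step i s)"
    have ex: "\<exists>d \<mu>. Poly_Mapping.keys \<mu> \<subseteq> Rd d \<and> (?ss i \<noteq> [] \<longrightarrow> dint \<mu> (\<lambda>_. 1) = 0) \<and>
      (\<forall>\<phi>. dint \<mu> (\<lambda>v. dint \<mu> (\<lambda>u. \<phi> (axis i (sqdist d u v)))) = dint (?W i) \<phi>)" for i
      by (rule step_list_measure) (use t L in \<open>auto simp: orthant_def\<close>)
    define good where "good i d \<mu> \<longleftrightarrow> Poly_Mapping.keys \<mu> \<subseteq> Rd d \<and> (?ss i \<noteq> [] \<longrightarrow> dint \<mu> (\<lambda>_. 1) = 0) \<and>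
      (\<forall>\<phi>. dint \<mu> (\<lambda>v. dint \<mu> (\<lambda>u. \<phi> (axis i (sqdist d u v)))) = dint (?W i) \<phi>)" for i d \<mu>
    have "\<forall>i. \<exists>d \<mu>. good i d \<mu>" using ex unfolding good_def by blast
    then obtain d \<mu> where good: "\<And>i. good i (d i) (\<mu> i)" by metis
    have gK: "Poly_Mapping.keys (\<mu> i) \<subseteq> Rd (d i)" for i
      using good[of i] unfolding good_def by (rule conjunct1)
    have gZ: "?ss i \<noteq> [] \<longrightarrow> dint (\<mu> i) (\<lambda>_. 1) = 0" for i
      using good[of i] unfolding good_def by (rule conjunct1[OF conjunct2])
    have gE: "\<forall>\<phi>. dint (\<mu> i) (\<lambda>v. dint (\<mu> i) (\<lambda>u. \<phi> (axis i (sqdist (d i) u v)))) = dint (?W i) \<phi>" for i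
      using good[of i] unfolding good_def by (rule conjunct2[OF conjunct2])
    \<comment> \<open>a common dimension for all factors\<close>
    define D where "D = Suc (Max (range d))"
    have dD: "d i \<le> D" for i by (auto simp: D_def intro!: le_SucI Max_ge)
    have K: "Poly_Mapping.keys (\<mu> i) \<subseteq> Rd D" for i
      using gK[of i] dD[of i] by (auto simp: Rd_eq subset_iff)
    have W: "dint (\<mu> i) (\<lambda>v. dint (\<mu> i) (\<lambda>u. \<phi> (axis i (sqdist D u v)))) = dint (?W i) \<phi>" for i \<phi>
    proof -
      have "dint (\<mu> i) (\<lambda>v. dint (\<mu> i) (\<lambda>u. \<phi> (axis i (sqdist D u v)))) = dint (\<mu> i) (\<lambda>v. dint (\<mu> i) (\<lambda>u. \<phi> (axis i (sqdist (d i) u v))))"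
      proof (intro dint_cong)
        fix v u assume "v \<in> Poly_Mapping.keys (\<mu> i)" "u \<in> Poly_Mapping.keys (\<mu> i)"
        then have "u \<in> Rd (d i)" "v \<in> Rd (d i)" using gK by blast+
        then have "sqdist D u v = sqdist (d i) u v" using dD[of i] by (rule sqdist_mono_dim)
        then show "\<phi> (axis i (sqdist D u v)) = \<phi> (axis i (sqdist (d i) u v))" by (rule arg_cong)
      qed
      also have "\<dots> = dint (?W i) \<phi>" using spec[OF gE[of i], of \<phi>] .
      finally show ?thesis .
    qed
    have "0 \<le> dist_energy D g (dprod_meas \<mu>)"
    proof (rule *)
      show "1 \<le> D" by (simp add: D_def)
      show "\<forall>i. \<mu> i \<in> dmeasures_in (Rd D)" using K by (simp add: dmeasures_in_def)
      obtain i j where ij: "i \<noteq> j" "i \<in> fst ` set L" "j \<in> fst ` set L" using two by blast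
      have zero: "dmeas (\<mu> k) (Rd D) = 0" if "k \<in> fst ` set L" for k
      proof -
        have "?ss k \<noteq> []" using that by (auto simp: filter_empty_conv)
        then show ?thesis using gZ[of k] dmeas_total[OF K] by simp
      qed
      have "card {i, j} \<le> card {i. dmeas (\<mu> i) (Rd D) = 0}"
        by (rule card_mono) (use zero ij in auto)
      then show "2 \<le> card {i. dmeas (\<mu> i) (Rd D) = 0}" using ij by simp
    qed
    also have "dist_energy D g (dprod_meas \<mu>) = dint (\<Prod>i\<in>UNIV. ?W i) g" by (rule dist_energy_dprod[OF W])
    also have "(\<Prod>i\<in>UNIV. ?W i) = of_nat (N ^ CARD('n) * 2 ^ length L) * ((\<Prod>i\<in>UNIV. 1 + of_nat m * dirac (axis i (t $ i))) * steps L)"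
    proof -
      have scal: "(\<Prod>s\<leftarrow>ss. of_nat 2 * step i s) = of_nat (2 ^ length ss) * (\<Prod>s\<leftarrow>ss. step i s)" for ss and i :: 'n
        by (induction ss) (auto simp: mult_ac)
      have "(\<Sum>i\<in>UNIV. length (?ss i)) = length L"
      proof (induction L)
        case (Cons p L)
        have "(\<Sum>i\<in>UNIV. length (map snd (filter (\<lambda>p. fst p = i) (p # L)))) = (\<Sum>i\<in>UNIV. (if i = fst p then 1 else 0) + length (map snd (filter (\<lambda>p. fst p = i) L)))"
          by (intro sum.cong) auto
        then show ?case using Cons by (simp add: sum.distrib)
      qed simp
      then have two: "(\<Prod>i\<in>UNIV. of_nat (2 ^ length (?ss i))) = (of_nat (2 ^ length L) :: (real^'n) dmeasure)"
        by (simp flip: power_sum)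
      have W_eq: "?W i = of_nat N * ((1 + of_nat m * dirac (axis i (t $ i))) * (of_nat (2 ^ length (?ss i)) * (\<Prod>s\<leftarrow>?ss i. step i s)))" for i
        unfolding scal N_def by (simp add: algebra_simps)
      have "(\<Prod>i\<in>UNIV. ?W i) = of_nat N ^ CARD('n) * ((\<Prod>i\<in>UNIV. 1 + of_nat m * dirac (axis i (t $ i))) * (of_nat (2 ^ length L) * steps L))"
        unfolding W_eq prod.distrib two steps_by_coordinate by simp
      then show ?thesis by (simp add: mult_ac)
    qed
    finally have "0 \<le> real (N ^ CARD('n) * 2 ^ length L) * dint ((\<Prod>i\<in>UNIV. 1 + of_nat m * dirac (axis i (t $ i))) * steps L) g"
      unfolding dint_of_nat_mult .
    moreover have "0 < real (N ^ CARD('n) * 2 ^ length L)" by (simp add: N_def)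
    ultimately show ?thesis by (smt (verit) mult_pos_neg)
  qed
  \<comment> \<open>expansion in powers of \<open>m\<close>; the leading coefficient \<open>a UNIV\<close> is the wanted difference at \<open>t\<close>\<close>
  define a where "a Z = dint ((\<Prod>i\<in>Z. dirac (axis i (t $ i))) * steps L) g" for Z
  have expand: "dint ((\<Prod>i\<in>UNIV. 1 + of_nat m * dirac (axis i (t $ i))) * steps L) g = (\<Sum>Z\<in>Pow UNIV. real m ^ card Z * a Z)" for m :: nat
  proof -
    have "(\<Prod>i\<in>UNIV. 1 + of_nat m * dirac (axis i (t $ i))) = (\<Sum>Z\<in>Pow UNIV. \<Prod>i\<in>Z. of_nat m * dirac (axis i (t $ i)))"
      by (subst add.commute, subst prod_add) auto
    also have "\<dots> = (\<Sum>Z\<in>Pow UNIV. of_nat (m ^ card Z) * (\<Prod>i\<in>Z. dirac (axis i (t $ i))))"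
      by (simp add: prod.distrib)
    finally show ?thesis
      by (simp add: sum_distrib_right dint_sum mult.assoc dint_of_nat_mult a_def del: of_nat_power flip: of_nat_power)
  qed
  have scaled: "0 \<le> (\<Sum>Z\<in>Pow UNIV. (real (Suc m) ^ card Z / real (Suc m) ^ CARD('n)) * a Z)" for m
  proof -
    have "0 \<le> (\<Sum>Z\<in>Pow UNIV. real (Suc m) ^ card Z * a Z) / real (Suc m) ^ CARD('n)"
      using energy[of "Suc m"] expand[of "Suc m"] by (intro divide_nonneg_nonneg) auto
    then show ?thesis by (simp add: sum_divide_distrib)
  qed
  have "(\<lambda>m. \<Sum>Z\<in>Pow UNIV. (real (Suc m) ^ card Z / real (Suc m) ^ CARD('n)) * a Z) \<longlonglongrightarrow> (\<Sum>Z\<in>Pow UNIV. (if Z = UNIV then 1 else 0) * a Z)"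
  proof (intro tendsto_intros)
    fix Z :: "'n set"
    show "(\<lambda>m. real (Suc m) ^ card Z / real (Suc m) ^ CARD('n)) \<longlonglongrightarrow> (if Z = UNIV then 1 else 0)"
    proof (cases "Z = UNIV")
      case False
      then have lt: "card Z < CARD('n)" by (simp add: psubset_card_mono psubsetI)
      have "(\<lambda>m. (1 / real (Suc m)) ^ (CARD('n) - card Z)) \<longlonglongrightarrow> 0 ^ (CARD('n) - card Z)"
        by (intro tendsto_power LIMSEQ_Suc[OF lim_1_over_n])
      moreover have "real (Suc m) ^ card Z / real (Suc m) ^ CARD('n) = (1 / real (Suc m)) ^ (CARD('n) - card Z)" for m
        using lt by (simp add: power_diff power_one_over field_simps del: of_nat_Suc)
      ultimately show ?thesis using False lt by (simp add: zero_power)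
    qed simp
  qed
  also have "(\<Sum>Z\<in>Pow UNIV. (if Z = UNIV then 1 else 0) * a Z) = a UNIV"
    by (subst sum.remove[of _ UNIV]) auto
  finally have "0 \<le> a UNIV" using scaled by (intro LIMSEQ_le_const) auto
  also have "a UNIV = dint (dirac t * steps L) g"
  proof -
    have "(\<Sum>i\<in>UNIV. axis i (t $ i)) = t"
      by (simp add: vec_eq_iff axis_def if_distrib[of "\<lambda>x. x = _"] cong: if_cong)
    then show ?thesis by (simp add: a_def flip: dirac_sum)
  qed
  finally show "0 \<le> dint (dirac t * steps L) g" .
qed


section \<open>The representing measures of mixed second differences\<close>

text \<open>
  The quotient \<open>(1 - exp (- a x)) / (1 - exp (- x))\<close>, extended continuously to \<open>x = 0\<close>.  Normalising by the
  step \<open>1\<close> keeps the mass at \<open>x = 0\<close>, which the factors \<open>1 - exp (- a x)\<close> would destroy.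
\<close>

definition incr :: "real \<Rightarrow> real \<Rightarrow> real" where
  "incr a x = (if x = 0 then a else (1 - exp (- (a * x))) / (1 - exp (- x)))"

lemma incr_mult: "incr a x * (1 - exp (- x)) = 1 - exp (- (a * x))"
  by (simp add: incr_def)

lemma incr_zero_left [simp]: "incr 0 x = 0"
  by (simp add: incr_def)

lemma incr_nonneg:
  assumes "0 \<le> a" "0 \<le> x"
  shows "0 \<le> incr a x"
  using assms by (simp add: incr_def)

text \<open>
  Bernoulli's inequality for the power \<open>exp (- n x)\<close> of \<open>exp (- x)\<close>, with \<open>n\<close> the integer above \<open>a\<close>.
\<close>

lemma incr_le:
  assumes "0 \<le> a" "0 \<le> x"
  shows "incr a x \<le> a + 1"
proof (cases "x = 0")
  case False
  then have x: "0 < x" using assms by simp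
  define n where "n = nat \<lceil>a\<rceil>"
  have n: "a \<le> real n" "real n \<le> a + 1" unfolding n_def using assms by linarith+
  have "1 - exp (- (a * x)) \<le> 1 - exp (- (real n * x))"
    using n x by simp
  also have "exp (- (real n * x)) = exp (- x) ^ n" by (simp flip: exp_of_nat_mult)
  also have "1 - exp (- x) ^ n \<le> real n * (1 - exp (- x))"
    using Bernoulli_inequality[of "exp (- x) - 1" n] by (simp add: algebra_simps)
  also have "\<dots> \<le> (a + 1) * (1 - exp (- x))"
    using n x by (intro mult_right_mono) auto
  finally show ?thesis using x by (simp add: incr_def pos_divide_le_eq)
qed (use assms in \<open>simp add: incr_def\<close>)

lemma borel_measurable_incr [measurable]: "incr a \<in> borel_measurable borel"
  unfolding incr_def by measurable

lemma tendsto_incr_left: "(f \<longlongrightarrow> a) F \<Longrightarrow> ((\<lambda>m. incr (f m) x) \<longlongrightarrow> incr a x) F"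
  unfolding incr_def by (cases "x = 0") (auto intro!: tendsto_intros)

lemma incr_limit:
  assumes "0 \<le> a" "0 \<le> x"
  shows "(\<lambda>m. incr a (x + 1 / real (Suc m))) \<longlonglongrightarrow> incr a x"
proof (cases "x = 0")
  case True
  show ?thesis
  proof (cases "a = 0")
    case False
    then have a: "0 < a" using assms by simp
    have "((\<lambda>y. (1 - exp (- (a * y))) / (1 - exp (- y))) \<longlongrightarrow> a) (at_right 0)"
      using a by real_asymp
    moreover have "filterlim (\<lambda>m. 1 / real (Suc m)) (at_right 0) sequentially"
      unfolding filterlim_at by (auto simp del: of_nat_Suc intro!: LIMSEQ_Suc[OF lim_1_over_n])
    ultimately have "(\<lambda>m. (1 - exp (- (a * (1 / real (Suc m))))) / (1 - exp (- (1 / real (Suc m))))) \<longlonglongrightarrow> a"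
      by (rule filterlim_compose)
    then show ?thesis using True by (simp add: incr_def)
  qed (use True in simp)
next
  case False
  then have x: "0 < x" using assms by simp
  have lim: "(\<lambda>m. x + 1 / real (Suc m)) \<longlonglongrightarrow> x + 0"
    by (intro tendsto_intros LIMSEQ_Suc[OF lim_1_over_n])
  have "(\<lambda>m. (1 - exp (- (a * (x + 1 / real (Suc m))))) / (1 - exp (- (x + 1 / real (Suc m))))) \<longlonglongrightarrow> (1 - exp (- (a * (x + 0)))) / (1 - exp (- (x + 0)))"
    by (intro tendsto_divide tendsto_diff tendsto_const tendsto_exp tendsto_minus tendsto_mult lim) (use x in auto)
  moreover have "x + 1 / real (Suc m) \<noteq> 0" for m using x by (simp add: add_pos_pos less_imp_neq[symmetric])
  ultimately show ?thesis using x by (simp add: incr_def)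
qed

definition orthant_measure :: "(real^'n::finite) measure \<Rightarrow> bool" where
  "orthant_measure \<rho> \<longleftrightarrow> finite_measure \<rho> \<and> sets \<rho> = sets borel \<and> (AE r in \<rho>. r \<in> orthant)"

lemma orthant_measure_integrable:
  assumes "orthant_measure \<rho>" "f \<in> borel_measurable borel" "\<And>r. r \<in> orthant \<Longrightarrow> \<bar>f r\<bar> \<le> B"
  shows "integrable \<rho> (f :: real^'n::finite \<Rightarrow> real)"
proof (rule integrable_bounded_AE[of _ _ B])
  show "finite_measure \<rho>" using assms by (simp add: orthant_measure_def)
  have [measurable_cong]: "sets \<rho> = sets borel" using assms by (simp add: orthant_measure_def)
  show "f \<in> borel_measurable \<rho>" using assms(2) by measurable
  have "AE r in \<rho>. r \<in> orthant" using assms by (simp add: orthant_measure_def)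
  then show "AE r in \<rho>. \<bar>f r\<bar> \<le> B" by eventually_elim (rule assms(3))
qed

lemma exp_inner_bounds:
  assumes "r \<in> orthant" "t \<in> orthant"
  shows "0 < exp (- (r \<bullet> t))" "exp (- (r \<bullet> t)) \<le> 1"
  using assms by (auto simp: inner_vec_def orthant_def intro!: sum_nonneg)

lemma orthant_measure_density:
  fixes u :: "real^'n::finite \<Rightarrow> real"
  assumes \<rho>: "orthant_measure \<rho>" and u[measurable]: "u \<in> borel_measurable borel"
    and bound: "\<forall>r\<in>orthant. 0 \<le> u r \<and> u r \<le> B"
  shows "orthant_measure (density \<rho> (\<lambda>r. ennreal (u r)))"
    "f \<in> borel_measurable borel \<Longrightarrow> integral\<^sup>L (density \<rho> (\<lambda>r. ennreal (u r))) f = (\<integral>r. u r * f r \<partial>\<rho>)"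
    "f \<in> borel_measurable borel \<Longrightarrow> integrable (density \<rho> (\<lambda>r. ennreal (u r))) f \<longleftrightarrow> integrable \<rho> (\<lambda>r. u r * f r)"
proof -
  have [measurable_cong]: "sets \<rho> = sets borel" and fin: "finite_measure \<rho>" and orth: "AE r in \<rho>. r \<in> orthant"
    using \<rho> by (simp_all add: orthant_measure_def)
  have nn: "AE r in \<rho>. 0 \<le> u r" using orth by eventually_elim (simp add: bound)
  have int: "integrable \<rho> u" by (rule orthant_measure_integrable[OF \<rho> u, of B]) (use bound in \<open>auto simp: abs_of_nonneg\<close>)
  have "emeasure (density \<rho> (\<lambda>r. ennreal (u r))) (space \<rho>) = ennreal (integral\<^sup>L \<rho> u)"
    using nn_integral_eq_integral[OF int nn] by (simp add: emeasure_density cong: nn_integral_cong)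
  then have "finite_measure (density \<rho> (\<lambda>r. ennreal (u r)))" by (intro finite_measureI) simp
  moreover have "AE r in density \<rho> (\<lambda>r. ennreal (u r)). r \<in> orthant"
    using orth by (subst AE_density) auto
  ultimately show "orthant_measure (density \<rho> (\<lambda>r. ennreal (u r)))"
    using \<rho> by (simp add: orthant_measure_def)
  show "integral\<^sup>L (density \<rho> (\<lambda>r. ennreal (u r))) f = (\<integral>r. u r * f r \<partial>\<rho>)" if [measurable]: "f \<in> borel_measurable borel"
    using nn by (subst integral_density) auto
  show "integrable (density \<rho> (\<lambda>r. ennreal (u r))) f \<longleftrightarrow> integrable \<rho> (\<lambda>r. u r * f r)" if [measurable]: "f \<in> borel_measurable borel"
    using nn by (subst integrable_density) auto
qed

text \<open>
  In the applications \<open>u\<close> and \<open>v\<close> are transforms of products of steps and vanish on some faces of the orthant;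
  the lemma compares the two measures off these faces.
\<close>

lemma laplace_density_unique:
  fixes u v :: "real^'n::finite \<Rightarrow> real"
  assumes M: "orthant_measure M" "orthant_measure M'"
    and u: "u \<in> borel_measurable borel" "\<forall>r\<in>orthant. 0 \<le> u r \<and> u r \<le> B"
    and v: "v \<in> borel_measurable borel" "\<forall>r\<in>orthant. 0 \<le> v r \<and> v r \<le> B'"
    and eq: "\<And>t. t \<in> orthant \<Longrightarrow> (\<integral>r. exp (- (r \<bullet> t)) * u r \<partial>M) = (\<integral>r. exp (- (r \<bullet> t)) * v r \<partial>M')"
    and f: "f \<in> borel_measurable borel"
  shows "(\<integral>r. u r * f r \<partial>M) = (\<integral>r. v r * f r \<partial>M')"
    "integrable M (\<lambda>r. u r * f r) \<longleftrightarrow> integrable M' (\<lambda>r. v r * f r)"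
proof -
  note du = orthant_measure_density[OF M(1) u] and dv = orthant_measure_density[OF M(2) v]
  have "density M (\<lambda>r. ennreal (u r)) = density M' (\<lambda>r. ennreal (v r))"
  proof (rule laplace_uniqueness)
    fix t :: "real^'n" assume t: "t \<in> orthant"
    have "(\<lambda>r. exp (- (r \<bullet> t))) \<in> borel_measurable borel" by measurable
    from du(2)[OF this] dv(2)[OF this] eq[OF t]
    show "(\<integral>r. exp (- (r \<bullet> t)) \<partial>density M (\<lambda>r. ennreal (u r))) = (\<integral>r. exp (- (r \<bullet> t)) \<partial>density M' (\<lambda>r. ennreal (v r)))"
      by (simp add: mult.commute)
  qed (use du(1) dv(1) in \<open>auto simp: orthant_measure_def\<close>)
  then show "(\<integral>r. u r * f r \<partial>M) = (\<integral>r. v r * f r \<partial>M')"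
    "integrable M (\<lambda>r. u r * f r) \<longleftrightarrow> integrable M' (\<lambda>r. v r * f r)"
    using du(2,3)[OF f] dv(2,3)[OF f] by simp_all
qed

definition exp_transform :: "(real^'n::finite) dmeasure \<Rightarrow> real^'n \<Rightarrow> real" where
  "exp_transform y r = dint y (\<lambda>s. exp (- (r \<bullet> s)))"

lemma exp_transform_mult: "exp_transform (x * y) r = exp_transform x r * exp_transform y r"
proof -
  have "exp (- (r \<bullet> (s + t))) = exp (- (r \<bullet> s)) * exp (- (r \<bullet> t))" for s t
    by (simp add: inner_add_right mult_exp_exp)
  then have "exp_transform (x * y) r = dint x (\<lambda>s. exp (- (r \<bullet> s)) * exp_transform y r)"
    by (simp only: exp_transform_def dint_mult dint_fun_mult)
  then show ?thesis by (simp add: exp_transform_def[of x] dint_def[of x] sum_distrib_right mult.assoc)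
qed

lemma exp_transform_one [simp]: "exp_transform 1 r = 1"
  by (simp add: exp_transform_def)

lemma exp_transform_dirac [simp]: "exp_transform (dirac t) r = exp (- (r \<bullet> t))"
  by (simp add: exp_transform_def)

lemma exp_transform_sum: "exp_transform (sum y I) r = (\<Sum>i\<in>I. exp_transform (y i) r)"
  by (simp add: exp_transform_def dint_sum)

lemma exp_transform_prod: "exp_transform (prod y I) r = (\<Prod>i\<in>I. exp_transform (y i) r)"
  by (induction I rule: infinite_finite_induct) (auto simp: exp_transform_mult)

lemma exp_transform_step [simp]: "exp_transform (step i s) r = 1 - exp (- (r $ i * s))"
  by (simp add: exp_transform_def step_def dint_diff inner_axis)

lemma borel_measurable_exp_transform [measurable]: "exp_transform y \<in> borel_measurable borel"
  unfolding exp_transform_def dint_def by measurable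

text \<open>
  A difference operator acts on a Laplace transform through multiplication of the measure by the transform of the
  operator.
\<close>

lemma laplace_action:
  fixes \<rho> :: "(real^'n::finite) measure"
  assumes \<rho>: "orthant_measure \<rho>" and F: "\<And>t. t \<in> orthant \<Longrightarrow> dint (dirac t * m) g = (\<integral>r. exp (- (r \<bullet> t)) \<partial>\<rho>)"
    and y: "Poly_Mapping.keys y \<subseteq> orthant" and t: "t \<in> orthant"
  shows "dint (dirac t * (y * m)) g = (\<integral>r. exp (- (r \<bullet> t)) * exp_transform y r \<partial>\<rho>)"
proof -
  have int: "integrable \<rho> (\<lambda>r. exp (- (r \<bullet> s)))" if "s \<in> orthant" for s
    by (rule orthant_measure_integrable[OF \<rho>, of _ 1]) (use exp_inner_bounds[OF _ that] in \<open>auto\<close>)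
  have ts: "t + s \<in> orthant" if "s \<in> Poly_Mapping.keys y" for s
    using y t that by (auto simp: orthant_def subset_iff)
  have "dint (dirac t * (y * m)) g = dint (y * (dirac t * m)) g" by (simp add: mult_ac)
  also have "\<dots> = dint y (\<lambda>s. dint (dirac s * (dirac t * m)) g)" by (simp only: dint_conv)
  also have "\<dots> = dint y (\<lambda>s. \<integral>r. exp (- (r \<bullet> (t + s))) \<partial>\<rho>)"
  proof (rule dint_cong)
    fix s assume "s \<in> Poly_Mapping.keys y"
    have "dirac s * (dirac t * m) = dirac (t + s) * m" by (simp add: dirac_add mult_ac)
    then show "dint (dirac s * (dirac t * m)) g = (\<integral>r. exp (- (r \<bullet> (t + s))) \<partial>\<rho>)"
      using F[OF ts[OF \<open>s \<in> Poly_Mapping.keys y\<close>]] by simp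
  qed
  also have "\<dots> = (\<integral>r. (\<Sum>s\<in>Poly_Mapping.keys y. Poly_Mapping.lookup y s * exp (- (r \<bullet> (t + s)))) \<partial>\<rho>)"
    unfolding dint_def using int ts by (subst Bochner_Integration.integral_sum) auto
  also have "\<dots> = (\<integral>r. exp (- (r \<bullet> t)) * exp_transform y r \<partial>\<rho>)"
  proof -
    have "exp (- (r \<bullet> (t + s))) = exp (- (r \<bullet> t)) * exp (- (r \<bullet> s))" for r s
      by (simp add: inner_add_right mult_exp_exp)
    then show ?thesis
      by (simp only: exp_transform_def dint_def sum_distrib_left mult.left_commute)
  qed
  finally show ?thesis .
qed

lemma difference_measure:
  fixes g :: "real^'n::finite \<Rightarrow> real"
  assumes cont: "continuous_on orthant g" and m: "Poly_Mapping.keys m \<subseteq> orthant"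
    and pos: "\<And>t L. t \<in> orthant \<Longrightarrow> \<forall>(i, s)\<in>set L. 0 \<le> s \<Longrightarrow> 0 \<le> dint (dirac t * (steps L * m)) g"
  obtains \<rho> where "orthant_measure \<rho>" "\<And>t. t \<in> orthant \<Longrightarrow> dint (dirac t * m) g = (\<integral>r. exp (- (r \<bullet> t)) \<partial>\<rho>)"
proof -
  have c: "continuous_on orthant (\<lambda>t. dint (dirac t * m) g)"
    unfolding dint_dirac_mult unfolding dint_def
  proof (intro continuous_on_sum continuous_on_mult continuous_on_const)
    fix s assume "s \<in> Poly_Mapping.keys m"
    then have s: "s \<in> orthant" using m by blast
    show "continuous_on orthant (\<lambda>t. g (t + s))"
      by (rule continuous_on_compose2[OF cont]) (use s in \<open>auto intro!: continuous_intros simp: orthant_def\<close>)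
  qed
  have p: "0 \<le> dint (dirac t * steps L) (\<lambda>t. dint (dirac t * m) g)" if "t \<in> orthant" "\<forall>(i, s)\<in>set L. 0 \<le> s" for t L
    using pos[OF that] by (simp add: dint_conv mult.assoc)
  show thesis
  proof (rule laplace_representation[OF c p])
    fix \<rho> :: "(real^'n) measure"
    assume \<rho>: "finite_measure \<rho>" "sets \<rho> = sets borel" "AE r in \<rho>. r \<in> orthant"
      and eq: "\<And>t. t \<in> orthant \<Longrightarrow> dint (dirac t * m) g = (\<integral>r. exp (- (r \<bullet> t)) \<partial>\<rho>)"
    have "orthant_measure \<rho>" using \<rho> by (simp add: orthant_measure_def)
    then show thesis by (rule that) (rule eq)
  qed
qed

lemma exp_geometric_ratio:
  assumes x: "0 \<le> x" and m: "0 < m"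
  shows "(\<Sum>k<p. exp (- (x * (real k * (1 / real m))))) = incr (real p / real m) x * (\<Sum>k<m. exp (- (x * (real k * (1 / real m)))))"
proof (cases "x = 0")
  case False
  define z where "z = exp (- (x / real m))"
  have z: "z \<noteq> 1" using False m by (simp add: z_def)
  have pow: "exp (- (x * (real k * (1 / real m)))) = z ^ k" for k
    by (simp add: z_def flip: exp_of_nat_mult)
  have zm: "z ^ m = exp (- x)" using m by (simp add: z_def flip: exp_of_nat_mult)
  have zp: "z ^ p = exp (- (real p / real m * x))" by (simp add: z_def flip: exp_of_nat_mult)
  have "(\<Sum>k<p. z ^ k) = (1 - z ^ p) / (1 - z)" for p using z by (simp add: sum_gp_strict)
  then show ?thesis using False z unfolding pow incr_def zp zm[symmetric]
    by (simp add: zm zp)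
qed (use m in \<open>simp add: incr_def\<close>)

text \<open>
  The factorisation of \<open>1 - x\<^sup>p\<close>, for \<open>x\<close> the translation by \<open>h\<close>.
\<close>

lemma step_geometric: "step i (real p * h) = (\<Sum>k<p. dirac (axis i (real k * h))) * step i h"
  unfolding step_def dirac_axis_power using one_diff_power_eq[of "dirac (axis i h)" p] by (simp add: mult.commute)

lemma dint_two_steps:
  "dint (dirac t * (step i a * step j b)) g = g t - g (t + axis i a) - g (t + axis j b) + g (t + axis i a + axis j b)"
  unfolding dint_dirac_mult dint_step_mult by (simp add: step_def dint_diff add_ac)

text \<open>
  A single measure serves all step sizes \<open>a\<close> and \<open>b\<close>.  For rational steps with common denominator \<open>m\<close>, both these
  and the unit steps are sums of translates of steps of size \<open>1 / m\<close>; the quotient of the two transforms is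
  \<open>incr\<close>, also at \<open>0\<close>.  Real steps follow by continuity.
\<close>

theorem mixed_difference_measure:
  fixes g :: "real^'n::finite \<Rightarrow> real"
  assumes cont: "continuous_on orthant g" and mixed: "mixed_alternating g" and ij: "i \<noteq> j"
  obtains \<rho> where "orthant_measure \<rho>"
    "\<And>a b t. 0 \<le> a \<Longrightarrow> 0 \<le> b \<Longrightarrow> t \<in> orthant \<Longrightarrow>
       dint (dirac t * (step i a * step j b)) g = (\<integral>r. exp (- (r \<bullet> t)) * (incr a (r $ i) * incr b (r $ j)) \<partial>\<rho>)"
proof -
  have ex: "\<exists>\<rho>. orthant_measure \<rho> \<and> (\<forall>t\<in>orthant. dint (dirac t * (step i h * step j h)) g = (\<integral>r. exp (- (r \<bullet> t)) \<partial>\<rho>))"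
    if h: "0 \<le> h" for h
  proof (rule difference_measure[OF cont])
    show "Poly_Mapping.keys (step i h * step j h) \<subseteq> orthant" by (intro keys_mult_orthant keys_step h)
    show "0 \<le> dint (dirac t * (steps L * (step i h * step j h))) g" if "t \<in> orthant" "\<forall>(i, s)\<in>set L. 0 \<le> s" for t L
    proof -
      have "0 \<le> dint (dirac t * steps (L @ [(i, h), (j, h)])) g"
        using mixed[unfolded mixed_alternating_def, rule_format, OF that(1), of "L @ [(i, h), (j, h)]"] that(2) h ij by auto
      then show ?thesis by simp
    qed
  qed blast
  define R where "R h = (SOME \<rho>. orthant_measure \<rho> \<and> (\<forall>t\<in>orthant. dint (dirac t * (step i h * step j h)) g = (\<integral>r. exp (- (r \<bullet> t)) \<partial>\<rho>)))" for h
  have R: "orthant_measure (R h)" "\<And>t. t \<in> orthant \<Longrightarrow> dint (dirac t * (step i h * step j h)) g = (\<integral>r. exp (- (r \<bullet> t)) \<partial>R h)" if "0 \<le> h" for h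
    using someI_ex[OF ex[OF that]] unfolding R_def by blast+
  define \<rho> where "\<rho> = R 1"
  have \<rho>: "orthant_measure \<rho>" unfolding \<rho>_def by (rule R) simp
  note [measurable_cong] = conjunct1[OF conjunct2[OF \<rho>[unfolded orthant_measure_def]]]
  \<comment> \<open>the transform of \<open>1 + E + \<dots> + E\<^bsup>p - 1\<^esup>\<close> for the translation \<open>E\<close> by \<open>1 / m\<close>\<close>
  define G where "G m p x = (\<Sum>k<p. exp (- (x * (real k * (1 / real m)))))" for m p :: nat and x :: real
  have [measurable]: "G m p \<in> borel_measurable borel" for m p unfolding G_def by measurable
  have G_bounds: "0 \<le> G m p x \<and> G m p x \<le> real p" if "0 \<le> x" for m p x
    unfolding G_def using that sum_bounded_above[of "{..<p}" "\<lambda>k. exp (- (x * (real k * (1 / real m))))" 1]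
    by (auto intro!: sum_nonneg)
  have rational: "dint (dirac t * (step i (real p / real m) * step j (real q / real m))) g
      = (\<integral>r. exp (- (r \<bullet> t)) * (incr (real p / real m) (r $ i) * incr (real q / real m) (r $ j)) \<partial>\<rho>)"
    if t: "t \<in> orthant" and m: "0 < m" for t and p q m :: nat
  proof -
    define h where "h = 1 / real m"
    have h: "0 \<le> h" by (simp add: h_def)
    define y where "y p q = (\<Sum>k<p. dirac (axis i (real k * h))) * (\<Sum>k<q. dirac (axis j (real k * h)))" for p q :: nat
    have y: "Poly_Mapping.keys (y p q) \<subseteq> orthant" for p q
    proof -
      have "Poly_Mapping.keys (\<Sum>k<p. dirac (axis l (real k * h) :: real^'n)) \<subseteq> orthant" for l p
        by (rule order_trans[OF keys_sum]) (use h in \<open>auto simp: dirac_def axis_in_orthant split: if_splits\<close>)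
      then show ?thesis unfolding y_def by (intro keys_mult_orthant)
    qed
    have hat: "exp_transform (y p q) r = G m p (r $ i) * G m q (r $ j)" for p q r
      by (simp add: y_def exp_transform_mult exp_transform_sum inner_axis G_def h_def)
    have prod: "step i (real p * h) * step j (real q * h) = y p q * (step i h * step j h)" for p q
      unfolding step_geometric[of i p h] step_geometric[of j q h] y_def by (simp only: mult_ac)
    have int: "dint (dirac s * (step i (real p * h) * step j (real q * h))) g = (\<integral>r. exp (- (r \<bullet> s)) * (G m p (r $ i) * G m q (r $ j)) \<partial>R h)"
      if "s \<in> orthant" for s p q
      unfolding prod hat[symmetric] by (rule laplace_action[OF R[OF h] y that])
    have one: "real m * h = 1" using m by (simp add: h_def)
    have Gb: "\<forall>r\<in>orthant. 0 \<le> G m m ((r :: real^'n) $ i) * G m m (r $ j) \<and> G m m (r $ i) * G m m (r $ j) \<le> real m * real m"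
      using G_bounds[of _ m m] by (auto simp: orthant_def intro!: mult_mono mult_nonneg_nonneg)
    \<comment> \<open>both sides represent the unit steps; on the left these are sums of \<open>m\<close> translates of steps of size \<open>h\<close>\<close>
    have eq: "(\<integral>r. (G m m (r $ i) * G m m (r $ j)) * f r \<partial>R h) = (\<integral>r. 1 * f r \<partial>\<rho>)" if f: "f \<in> borel_measurable borel" for f
    proof (rule laplace_density_unique(1)[OF R(1)[OF h] \<rho> _ Gb _ _ _ f])
      show "(\<integral>r. exp (- (r \<bullet> s)) * (G m m (r $ i) * G m m (r $ j)) \<partial>R h) = (\<integral>r. exp (- (r \<bullet> s)) * 1 \<partial>\<rho>)" if "s \<in> orthant" for s
        using int[OF that, of m m] R(2)[OF _ that, of 1] unfolding one \<rho>_def by simp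
    qed auto
    have "dint (dirac t * (step i (real p / real m) * step j (real q / real m))) g = (\<integral>r. exp (- (r \<bullet> t)) * (G m p (r $ i) * G m q (r $ j)) \<partial>R h)"
      using int[OF t, of p q] by (simp add: h_def)
    also have "\<dots> = (\<integral>r. (G m m (r $ i) * G m m (r $ j)) * (exp (- (r \<bullet> t)) * (incr (real p / real m) (r $ i) * incr (real q / real m) (r $ j))) \<partial>R h)"
    proof (rule integral_cong_AE)
      have [measurable_cong]: "sets (R h) = sets borel" using R(1)[OF h] by (simp add: orthant_measure_def)
      show "(\<lambda>r. exp (- (r \<bullet> t)) * (G m p (r $ i) * G m q (r $ j))) \<in> borel_measurable (R h)" by measurable
      show "(\<lambda>r. (G m m (r $ i) * G m m (r $ j)) * (exp (- (r \<bullet> t)) * (incr (real p / real m) (r $ i) * incr (real q / real m) (r $ j)))) \<in> borel_measurable (R h)"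
        by measurable
      have "AE r in R h. r \<in> orthant" using R(1)[OF h] by (simp add: orthant_measure_def)
      then show "AE r in R h. exp (- (r \<bullet> t)) * (G m p (r $ i) * G m q (r $ j)) =
          (G m m (r $ i) * G m m (r $ j)) * (exp (- (r \<bullet> t)) * (incr (real p / real m) (r $ i) * incr (real q / real m) (r $ j)))"
      proof eventually_elim
        case (elim r)
        then have ri: "0 \<le> r $ i" and rj: "0 \<le> r $ j" by (auto simp: orthant_def)
        have "G m p (r $ i) = incr (real p / real m) (r $ i) * G m m (r $ i)" "G m q (r $ j) = incr (real q / real m) (r $ j) * G m m (r $ j)"
          unfolding G_def by (rule exp_geometric_ratio[OF ri m], rule exp_geometric_ratio[OF rj m])
        then show ?case by (simp only: mult_ac)
      qed
    qed
    also have "\<dots> = (\<integral>r. exp (- (r \<bullet> t)) * (incr (real p / real m) (r $ i) * incr (real q / real m) (r $ j)) \<partial>\<rho>)"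
      by (subst eq) auto
    finally show ?thesis .
  qed
  show thesis
  proof (rule that[OF \<rho>])
    fix a b :: real and t :: "real^'n" assume a: "0 \<le> a" and b: "0 \<le> b" and t: "t \<in> orthant"
    \<comment> \<open>rational approximation of \<open>x\<close> from below with denominator \<open>Suc m\<close>\<close>
    define ra where "ra x m = real (nat \<lfloor>real (Suc m) * x\<rfloor>) / real (Suc m)" for x m
    have ra: "0 \<le> ra x m" for x m by (simp add: ra_def)
    have ra_le: "ra x m \<le> x" if "0 \<le> x" for x m
      unfolding ra_def using of_nat_floor[of "real (Suc m) * x"] that by (subst pos_divide_le_eq) (auto simp: mult.commute)
    have ra_lim: "ra x \<longlonglongrightarrow> x" if x: "0 \<le> x" for x
    proof (rule tendsto_sandwich[OF _ _ _ tendsto_const])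
      have "x - 1 / real (Suc m) \<le> ra x m" for m
      proof -
        have "real (Suc m) * x - 1 \<le> real (nat \<lfloor>real (Suc m) * x\<rfloor>)" by linarith
        then have "(real (Suc m) * x - 1) / real (Suc m) \<le> ra x m" unfolding ra_def by (intro divide_right_mono) auto
        then show ?thesis by (simp add: diff_divide_distrib del: of_nat_Suc)
      qed
      then show "\<forall>\<^sub>F m in sequentially. x - 1 / real (Suc m) \<le> ra x m" by (intro always_eventually allI)
      show "\<forall>\<^sub>F m in sequentially. ra x m \<le> x" using ra_le[OF x] by (intro always_eventually allI)
      have "(\<lambda>m. x - 1 / real (Suc m)) \<longlonglongrightarrow> x - 0" by (intro tendsto_intros LIMSEQ_Suc[OF lim_1_over_n])
      then show "(\<lambda>m. x - 1 / real (Suc m)) \<longlonglongrightarrow> x" by simp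
    qed
    have "(\<lambda>m. dint (dirac t * (step i (ra a m) * step j (ra b m))) g) \<longlonglongrightarrow> dint (dirac t * (step i a * step j b)) g"
      unfolding dint_two_steps
    proof (intro tendsto_intros; rule continuous_on_tendsto_compose[OF cont])
      have ax: "(\<lambda>m. axis l (ra x m) :: real^'n) \<longlonglongrightarrow> axis l x" if "0 \<le> x" for l x
        by (rule vec_tendstoI) (auto simp: axis_def intro: ra_lim[OF that])
      show "(\<lambda>m. t + axis i (ra a m)) \<longlonglongrightarrow> t + axis i a" "(\<lambda>m. t + axis j (ra b m)) \<longlonglongrightarrow> t + axis j b"
        "(\<lambda>m. t + axis i (ra a m) + axis j (ra b m)) \<longlonglongrightarrow> t + axis i a + axis j b"
        using a b by (auto intro!: tendsto_intros ax)
    qed (use t a b ra in \<open>auto simp: orthant_def axis_def\<close>)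
    moreover have "(\<lambda>m. \<integral>r. exp (- (r \<bullet> t)) * (incr (ra a m) (r $ i) * incr (ra b m) (r $ j)) \<partial>\<rho>)
       \<longlonglongrightarrow> (\<integral>r. exp (- (r \<bullet> t)) * (incr a (r $ i) * incr b (r $ j)) \<partial>\<rho>)"
    proof (rule integral_dominated_convergence[where w = "\<lambda>_. 1 * ((a + 1) * (b + 1))"])
      interpret finite_measure \<rho> using \<rho> by (simp add: orthant_measure_def)
      show "integrable \<rho> (\<lambda>_. 1 * ((a + 1) * (b + 1)))" by simp
      show "AE r in \<rho>. (\<lambda>m. exp (- (r \<bullet> t)) * (incr (ra a m) (r $ i) * incr (ra b m) (r $ j))) \<longlonglongrightarrow> exp (- (r \<bullet> t)) * (incr a (r $ i) * incr b (r $ j))"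
        by (intro AE_I2 tendsto_intros tendsto_incr_left ra_lim a b)
      fix m
      have "AE r in \<rho>. r \<in> orthant" using \<rho> by (simp add: orthant_measure_def)
      then show "AE r in \<rho>. norm (exp (- (r \<bullet> t)) * (incr (ra a m) (r $ i) * incr (ra b m) (r $ j))) \<le> 1 * ((a + 1) * (b + 1))"
      proof eventually_elim
        case (elim r)
        then have r: "0 \<le> r $ i" "0 \<le> r $ j" by (auto simp: orthant_def)
        have "incr (ra a m) (r $ i) \<le> a + 1" "incr (ra b m) (r $ j) \<le> b + 1"
          using incr_le[OF ra r(1)] incr_le[OF ra r(2)] ra_le[OF a] ra_le[OF b] by (meson add_right_mono order_trans)+
        then show ?case
          unfolding norm_mult using exp_inner_bounds[OF elim t] incr_nonneg[OF ra r(1)] incr_nonneg[OF ra r(2)] a b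
          by (intro mult_mono) auto
      qed
    qed measurable
    moreover have "dint (dirac t * (step i (ra a m) * step j (ra b m))) g
        = (\<integral>r. exp (- (r \<bullet> t)) * (incr (ra a m) (r $ i) * incr (ra b m) (r $ j)) \<partial>\<rho>)" for m
      unfolding ra_def by (rule rational[OF t]) simp
    ultimately have "(\<lambda>m. \<integral>r. exp (- (r \<bullet> t)) * (incr (ra a m) (r $ i) * incr (ra b m) (r $ j)) \<partial>\<rho>) \<longlonglongrightarrow> dint (dirac t * (step i a * step j b)) g"
      by (simp only:)
    then show "dint (dirac t * (step i a * step j b)) g = (\<integral>r. exp (- (r \<bullet> t)) * (incr a (r $ i) * incr b (r $ j)) \<partial>\<rho>)"
      using \<open>(\<lambda>m. \<integral>r. exp (- (r \<bullet> t)) * (incr (ra a m) (r $ i) * incr (ra b m) (r $ j)) \<partial>\<rho>)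
       \<longlonglongrightarrow> (\<integral>r. exp (- (r \<bullet> t)) * (incr a (r $ i) * incr b (r $ j)) \<partial>\<rho>)\<close>
      by (rule LIMSEQ_unique)
  qed
qed


section \<open>The integral representation\<close>

definition cut :: "'n set \<Rightarrow> real^'n \<Rightarrow> real^'n" where
  "cut A t = (\<chi> l. if l \<in> A then t $ l else 0)"

lemma cut_in_orthant: "t \<in> orthant \<Longrightarrow> cut A t \<in> orthant"
  by (auto simp: cut_def orthant_def)

lemma telescope_initial_segments:
  fixes H :: "'n::{finite,linorder} set \<Rightarrow> real"
  assumes "\<forall>x\<in>A. {..x} \<subseteq> A"
  shows "(\<Sum>i\<in>A. H {..i} - H {..<i}) = H A - H {}"
  using finite[of A] assms
proof (induction A rule: finite_linorder_max_induct)
  case (insert b A)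
  have A: "A = {..<b}"
    using insert.hyps(2) insert.prems by (auto dest: order.strict_implies_order)
  have bA: "insert b A = {..b}" unfolding A by auto
  have "\<forall>x\<in>A. {..x} \<subseteq> A" unfolding A by auto
  from insert.IH[OF this] have "(\<Sum>i\<in>A. H {..i} - H {..<i}) = H A - H {}" .
  moreover have "b \<notin> A" using insert.hyps by auto
  ultimately show ?case using insert.hyps(1) by (simp add: bA[symmetric]) (simp add: bA A[symmetric])
qed simp

lemma sum_ordered_pairs:
  "(\<Sum>(i, j) | i < j. X i j) = (\<Sum>j\<in>UNIV. \<Sum>i\<in>{..<j::'n::{finite,linorder}}. X i j :: real)"
proof -
  have "(\<Sum>j\<in>UNIV. \<Sum>i\<in>{..<j}. X i j) = (\<Sum>(j, i)\<in>(SIGMA j:UNIV. {..<j}). X i j)"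
    by (rule sum.Sigma) auto
  also have "\<dots> = (\<Sum>(i, j) | i < j. X i j)"
    by (rule sum.reindex_bij_witness[of _ "\<lambda>(i, j). (j, i)" "\<lambda>(j, i). (i, j)"]) auto
  finally show ?thesis by simp
qed

lemma axis_in_bdry_one: "0 \<le> a \<Longrightarrow> axis j a \<in> orthant_bdry 1"
proof -
  assume a: "0 \<le> a"
  have "{i. 0 < axis j a $ i} \<subseteq> {j}" by (auto simp: axis_def)
  then have "card {i. 0 < axis j a $ i} \<le> card {j}" by (intro card_mono) auto
  then show ?thesis using axis_in_orthant[OF a] by (simp add: orthant_bdry_def)
qed

text \<open>
  Switch on the coordinates of \<open>t\<close> one after the other.  The increment from coordinate \<open>j\<close> telescopes into its mixed
  differences with the coordinates \<open>i < j\<close>, since \<open>f\<close> vanishes on the axis \<open>j\<close>.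
\<close>

lemma pair_decomposition:
  fixes f :: "real^'n::{finite,linorder} \<Rightarrow> real"
  assumes bdry: "\<And>s. s \<in> orthant_bdry 1 \<Longrightarrow> f s = 0" and t: "t \<in> orthant"
  shows "f t = (\<Sum>(i, j) | i < j. dint (dirac (cut {..<i} t) * (step i (t $ i) * step j (t $ j))) f)"
proof -
  define H where "H j A = f (cut A t + axis j (t $ j)) - f (cut A t)" for j A
  have add_axis: "cut A t + axis i (t $ i) = cut (insert i A) t" if "i \<notin> A" for i A
    using that by (auto simp: vec_eq_iff cut_def axis_def)
  have ins: "insert i {..<i} = {..i}" for i :: 'n by auto
  have pair: "dint (dirac (cut {..<i} t) * (step i (t $ i) * step j (t $ j))) f = H j {..i} - H j {..<i}" if "i < j" for i j
    unfolding dint_two_steps H_def using add_axis[of i "{..<i}"] by (simp add: ins)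
  have zero: "H j {} = 0" for j
  proof -
    have c: "cut {} t = 0" by (simp add: cut_def vec_eq_iff)
    have "f 0 = 0" by (rule bdry) (simp add: orthant_bdry_def orthant_def)
    moreover have "f (axis j (t $ j)) = 0"
      using t by (intro bdry axis_in_bdry_one) (simp add: orthant_def)
    ultimately show ?thesis by (simp add: H_def c)
  qed
  have "(\<Sum>(i, j) | i < j. dint (dirac (cut {..<i} t) * (step i (t $ i) * step j (t $ j))) f)
     = (\<Sum>j\<in>UNIV. \<Sum>i\<in>{..<j}. H j {..i} - H j {..<i})"
    unfolding sum_ordered_pairs by (intro sum.cong refl) (simp add: pair)
  also have "\<dots> = (\<Sum>j\<in>UNIV. H j {..<j})"
  proof (intro sum.cong refl)
    fix j :: 'n
    have "\<forall>x\<in>{..<j}. {..x} \<subseteq> {..<j}" by auto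
    from telescope_initial_segments[OF this, of "H j"]
    show "(\<Sum>i\<in>{..<j}. H j {..i} - H j {..<i}) = H j {..<j}" by (simp add: zero)
  qed
  also have "\<dots> = (\<Sum>j\<in>UNIV. f (cut {..j} t) - f (cut {..<j} t))"
    unfolding H_def using add_axis by (intro sum.cong refl) (simp add: ins)
  also have "\<dots> = f (cut UNIV t) - f (cut {} t)"
    by (rule telescope_initial_segments[of UNIV "\<lambda>A. f (cut A t)"]) auto
  also have "cut UNIV t = t" by (simp add: cut_def vec_eq_iff)
  also have "f (cut {} t) = 0"
  proof -
    have "cut {} t = 0" by (simp add: cut_def vec_eq_iff)
    then show ?thesis by (intro bdry) (simp add: orthant_bdry_def orthant_def)
  qed
  finally show ?thesis by simp
qed

subsection \<open>The kernel of the representation\<close>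

text \<open>
  The kernel \<open>exp (- (r \<bullet> t))\<close> corrected by functions of one coordinate such that it vanishes on the axes.
\<close>

definition base_kernel :: "real^'n::finite \<Rightarrow> real^'n \<Rightarrow> real" where
  "base_kernel r t = exp (- (r \<bullet> t)) - (\<Sum>i\<in>UNIV. exp (- (r $ i * t $ i))) + real CARD('n) - 1"

lemma dint_steps_coordinate:
  assumes "k \<in> fst ` set L" "k \<noteq> i"
  shows "dint (dirac t * steps L) (\<lambda>x. f (x $ i)) = 0"
proof -
  obtain s L1 L2 where L: "L = L1 @ (k, s) # L2" using assms(1) by (auto simp: in_set_conv_decomp)
  have "steps L = step k s * (steps L1 * steps L2)" by (simp add: L mult_ac)
  moreover have "axis k s $ i = 0" using assms(2) by (simp add: axis_def)
  ultimately show ?thesis by (simp add: dint_dirac_mult dint_step_mult) (simp add: dint_def)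
qed

lemma two_coordinates_other:
  assumes "two_coordinates L"
  obtains k where "k \<in> fst ` set L" "k \<noteq> i"
  using assms by metis

lemma base_kernel_differences:
  assumes "two_coordinates L"
  shows "dint (dirac t * steps L) (base_kernel r) = exp (- (r \<bullet> t)) * exp_transform (steps L) r"
proof -
  have coord: "dint (dirac t * steps L) (\<lambda>x. f (x $ i)) = 0" for f i
    using two_coordinates_other[OF assms, of i] dint_steps_coordinate by metis
  have "dint (dirac t * steps L) (base_kernel r) = dint (dirac t * steps L) (\<lambda>t. exp (- (r \<bullet> t)))
      - (\<Sum>i\<in>UNIV. dint (dirac t * steps L) (\<lambda>t. exp (- (r $ i * t $ i)))) + dint (dirac t * steps L) (\<lambda>t. real CARD('a) - 1)"
    unfolding base_kernel_def add_diff_eq[symmetric] dint_fun_add dint_fun_diff dint_fun_sum ..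
  also have "\<dots> = dint (dirac t * steps L) (\<lambda>t. exp (- (r \<bullet> t)))"
    using coord[of "\<lambda>x. exp (- (r $ _ * x))"] coord[of "\<lambda>_. real CARD('a) - 1"] by simp
  also have "\<dots> = exp_transform (dirac t * steps L) r" by (simp add: exp_transform_def)
  finally show ?thesis by (simp add: exp_transform_mult)
qed

lemma base_kernel_bdry_one:
  assumes "t \<in> orthant_bdry 1"
  shows "base_kernel r t = 0"
proof -
  have t: "t \<in> orthant" "card {i. 0 < t $ i} \<le> 1" using assms by (auto simp: orthant_bdry_def)
  then have "\<exists>j. {i. 0 < t $ i} \<subseteq> {j}"
    by (metis card_le_Suc0_iff_eq[OF finite] One_nat_def insertI1 singletonI subsetI)
  then obtain j where "{i. 0 < t $ i} \<subseteq> {j}" by blast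
  then have j: "t $ i = 0" if "i \<noteq> j" for i using that t(1) by (force simp: orthant_def less_le)
  have "r \<bullet> t = r $ j * t $ j"
    unfolding inner_vec_def by (subst sum.remove[of _ j]) (auto simp: j)
  moreover have "(\<Sum>i\<in>UNIV. exp (- (r $ i * t $ i))) = exp (- (r $ j * t $ j)) + (\<Sum>i\<in>UNIV - {j}. 1)"
    by (subst sum.remove[of _ j]) (auto simp: j)
  ultimately show ?thesis
    by (simp add: base_kernel_def card_Diff_singleton of_nat_diff)
qed

lemma exp_transform_two_steps:
  "exp_transform (step i a * step j b) r = (1 - exp (- (r $ i * a))) * (1 - exp (- (r $ j * b)))"
  by (simp add: exp_transform_mult)

lemma base_kernel_pair_sum:
  fixes t r :: "real^'n::{finite,linorder}"
  assumes "t \<in> orthant"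
  shows "base_kernel r t = (\<Sum>(i, j) | i < j. exp (- (r \<bullet> cut {..<i} t)) * ((1 - exp (- (r $ i * t $ i))) * (1 - exp (- (r $ j * t $ j)))))"
proof -
  have "base_kernel r t = (\<Sum>(i, j) | i < j. dint (dirac (cut {..<i} t) * (step i (t $ i) * step j (t $ j))) (base_kernel r))"
    by (rule pair_decomposition[OF base_kernel_bdry_one assms])
  also have "\<dots> = (\<Sum>(i, j) | i < j. exp (- (r \<bullet> cut {..<i} t)) * ((1 - exp (- (r $ i * t $ i))) * (1 - exp (- (r $ j * t $ j)))))"
  proof (intro sum.cong refl, clarify)
    fix i j :: 'n assume "i < j"
    then have "\<exists>k l. k \<noteq> l \<and> k \<in> fst ` set [(i, t $ i), (j, t $ j)] \<and> l \<in> fst ` set [(i, t $ i), (j, t $ j)]"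
    by (intro exI[of _ i] exI[of _ j]) auto
  from base_kernel_differences[OF this, of "cut {..<i} t" r]
  show "dint (dirac (cut {..<i} t) * (step i (t $ i) * step j (t $ j))) (base_kernel r)
     = exp (- (r \<bullet> cut {..<i} t)) * ((1 - exp (- (r $ i * t $ i))) * (1 - exp (- (r $ j * t $ j))))"
    by (simp add: exp_transform_two_steps)
  qed
  finally show ?thesis .
qed

subsection \<open>The weight\<close>

lemma elem_sym_two_pairs:
  fixes r :: "real^'n::{finite,linorder}"
  shows "elem_sym 2 r = (\<Sum>(i, j) | i < j. r $ i * r $ j)"
proof -
  have "(\<Sum>(i, j) | i < j. r $ i * r $ j) = (\<Sum>F | card F = 2. \<Prod>i\<in>F. r $ i)"
  proof (rule sum.reindex_bij_witness[of _ "\<lambda>F. (Min F, Max F)" "\<lambda>(i, j). {i, j}"])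
    fix p :: "'n \<times> 'n" assume "p \<in> {(i, j). i < j}"
    then obtain i j where p: "p = (i, j)" "i < j" by auto
    then show "(Min (case p of (i, j) \<Rightarrow> {i, j}), Max (case p of (i, j) \<Rightarrow> {i, j})) = p" by (auto simp: min_def max_def)
    show "(case p of (i, j) \<Rightarrow> {i, j}) \<in> {F. card F = 2}" using p by simp
    show "(\<Prod>i\<in>(case p of (i, j) \<Rightarrow> {i, j}). r $ i) = (case p of (i, j) \<Rightarrow> r $ i * r $ j)" using p by simp
  next
    fix F :: "'n set" assume "F \<in> {F. card F = 2}"
    then obtain a b where F: "F = {a, b}" "a \<noteq> b" by (auto simp: card_2_iff)
    show "(case (Min F, Max F) of (i, j) \<Rightarrow> {i, j}) = F" unfolding F by (auto simp: min_def max_def)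
    show "(Min F, Max F) \<in> {(i, j). i < j}" unfolding F using F(2) by (auto simp: min_def max_def)
  qed
  then show ?thesis by (simp add: elem_sym_def)
qed

text \<open>
  The transforms of the unit steps, collected in a vector.
\<close>

definition decay :: "real^'n \<Rightarrow> real^'n::finite" where
  "decay r = (\<chi> i. 1 - exp (- (r $ i)))"

lemma decay_nth [simp]: "decay r $ i = 1 - exp (- (r $ i))"
  by (simp add: decay_def)

lemma elem_sym_nonneg: "r \<in> orthant \<Longrightarrow> 0 \<le> elem_sym k r"
  unfolding elem_sym_def orthant_def by (intro sum_nonneg prod_nonneg) auto

lemma elem_sym_pos:
  assumes "r \<in> orthant" "F \<subseteq> {i. 0 < r $ i}" "card F = k"
  shows "0 < elem_sym k r"
proof -
  have "0 < (\<Prod>i\<in>F. r $ i)" using assms(2) by (intro prod_pos) auto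
  also have "\<dots> \<le> elem_sym k r"
    unfolding elem_sym_def using assms by (intro member_le_sum prod_nonneg) (auto simp: orthant_def)
  finally show ?thesis .
qed

lemma decay_in_orthant: "r \<in> orthant \<Longrightarrow> decay r \<in> orthant"
  by (auto simp: orthant_def)

lemma decay_bound:
  assumes "0 \<le> (x::real)"
  shows "x \<le> (1 - exp (- x)) * (1 + x)"
proof -
  have "1 + x \<le> exp x" by (rule exp_ge_add_one_self)
  then have "(1 + x) * exp (- x) \<le> exp x * exp (- x)" by (intro mult_right_mono) auto
  then show ?thesis by (simp add: mult_exp_exp algebra_simps)
qed

text \<open>
  This inequality makes the bulk measure finite.  Each product \<open>\<Prod>\<^sub>i r\<^sub>i\<close> over \<open>F\<close> is at most the
  product of the terms for the same \<open>F\<close> in the two factors on the right, by \<open>x \<le> (1 - exp (- x)) (1 + x)\<close>.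
\<close>

lemma elem_sym_decay_bound:
  assumes r: "r \<in> orthant"
  shows "elem_sym k r \<le> elem_sym k (decay r) * elem_sym k (1 + r)"
proof -
  have r0: "0 \<le> r $ i" for i using r by (simp add: orthant_def)
  have "elem_sym k r \<le> (\<Sum>F | card F = k. (\<Prod>i\<in>F. decay r $ i) * (\<Prod>i\<in>F. (1 + r) $ i))"
    unfolding elem_sym_def prod.distrib[symmetric]
    by (intro sum_mono prod_mono) (use r0 decay_bound in auto)
  also have "\<dots> \<le> (\<Sum>F | card F = k. (\<Prod>i\<in>F. decay r $ i) * elem_sym k (1 + r))"
    unfolding elem_sym_def using r0
    by (intro sum_mono mult_left_mono member_le_sum prod_nonneg) (auto intro: add_nonneg_nonneg)
  also have "\<dots> = elem_sym k (decay r) * elem_sym k (1 + r)"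
    by (simp add: elem_sym_def[of k "decay r"] sum_distrib_right)
  finally show ?thesis .
qed

abbreviation "Omega \<equiv> orthant - orthant_bdry 2"

lemma Omega_iff: "r \<in> Omega \<longleftrightarrow> r \<in> orthant \<and> 3 \<le> card {i. 0 < r $ i}"
  by (auto simp: orthant_bdry_def)

lemma Omega_elem_sym_pos:
  assumes "r \<in> Omega" "k \<le> 3"
  shows "0 < elem_sym k r" "0 < elem_sym k (decay r)"
proof -
  have r: "r \<in> orthant" "3 \<le> card {i. 0 < r $ i}" using assms(1) unfolding Omega_iff by auto
  obtain F where F: "F \<subseteq> {i. 0 < r $ i}" "card F = k"
    using obtain_subset_with_card_n[of k "{i. 0 < r $ i}"] r assms(2) by auto
  show "0 < elem_sym k r" by (rule elem_sym_pos[OF r(1) F])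
  show "0 < elem_sym k (decay r)"
    by (rule elem_sym_pos[OF decay_in_orthant[OF r(1)] _ F(2)]) (use F(1) in auto)
qed

lemma borel_orthant [measurable]: "(orthant :: (real^'n::finite) set) \<in> sets borel"
proof -
  have "orthant = (\<Inter>i. {t :: real^'n. 0 \<le> t $ i})" by (auto simp: orthant_def)
  also have "\<dots> \<in> sets borel" by measurable
  finally show ?thesis .
qed

lemma borel_orthant_bdry [measurable]: "(orthant_bdry m :: (real^'n::finite) set) \<in> sets borel"
proof -
  have card: "real (card {i. 0 < r $ i}) = (\<Sum>i\<in>UNIV. indicator {r. 0 < r $ i} r)" for r :: "real^'n"
    by (simp add: indicator_def sum.If_cases)
  have "orthant_bdry m = orthant \<inter> {r :: real^'n. (\<Sum>i\<in>UNIV. indicator {r. 0 < r $ i} r) < real (m + 1)}"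
    unfolding orthant_bdry_def card[symmetric] by auto
  also have "\<dots> \<in> sets borel" by measurable
  finally show ?thesis .
qed

lemma borel_measurable_elem_sym [measurable]: "elem_sym k \<in> borel_measurable borel"
  unfolding elem_sym_def by measurable

lemma borel_measurable_decay [measurable]: "decay \<in> borel \<rightarrow>\<^sub>M borel"
  unfolding decay_def by (intro borel_measurable_vec_lambda) auto

subsection \<open>Existence of the representation\<close>

text \<open>
  \<open>\<rho> i j\<close> represents the mixed differences of \<open>g\<close> in the directions \<open>i\<close> and \<open>j\<close>, and \<open>S\<close> represents the sum of
  the mixed unit differences over all pairs.
\<close>

definition difference_system ::
    "(real^'n::{finite,linorder} \<Rightarrow> real) \<Rightarrow> ('n \<Rightarrow> 'n \<Rightarrow> (real^'n::{finite,linorder}) measure) \<Rightarrow> (real^'n::{finite,linorder}) measure \<Rightarrow> bool"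
where
  "difference_system g \<rho> S \<longleftrightarrow> orthant_measure S \<and>
     (\<forall>t\<in>orthant. dint (dirac t * (\<Sum>(i, j) | i < j. step i 1 * step j 1)) g = (\<integral>r. exp (- (r \<bullet> t)) \<partial>S)) \<and>
     (\<forall>i j. i \<noteq> j \<longrightarrow> orthant_measure (\<rho> i j) \<and> (\<forall>a\<ge>0. \<forall>b\<ge>0. \<forall>t\<in>orthant.
        dint (dirac t * (step i a * step j b)) g = (\<integral>r. exp (- (r \<bullet> t)) * (incr a (r $ i) * incr b (r $ j)) \<partial>\<rho> i j)))"

lemma difference_system_exists:
  fixes g :: "real^'n::{finite,linorder} \<Rightarrow> real"
  assumes cont: "continuous_on orthant g" and mixed: "mixed_alternating g"
  obtains \<rho> S where "difference_system g \<rho> S"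
proof -
  define P where "P i j \<rho> \<longleftrightarrow> orthant_measure \<rho> \<and> (\<forall>a\<ge>0. \<forall>b\<ge>0. \<forall>t\<in>orthant.
        dint (dirac t * (step i a * step j b)) g = (\<integral>r. exp (- (r \<bullet> t)) * (incr a (r $ i) * incr b (r $ j)) \<partial>\<rho>))" for i j \<rho>
  have "\<exists>\<rho>. P i j \<rho>" if "i \<noteq> j" for i j
    by (rule mixed_difference_measure[OF cont mixed that]) (auto simp: P_def)
  then have P: "P i j (SOME \<rho>. P i j \<rho>)" if "i \<noteq> j" for i j
    using someI_ex that by metis
  have keys: "Poly_Mapping.keys (\<Sum>(i, j) | i < j. step i 1 * step j 1) \<subseteq> (orthant :: (real, 'n) vec set)"
  proof (rule order_trans[OF keys_sum], rule UN_least)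
    fix p :: "'n \<times> 'n"
    show "Poly_Mapping.keys (case p of (i, j) \<Rightarrow> step i 1 * step j 1) \<subseteq> (orthant :: (real, 'n) vec set)"
      by (cases p) (simp add: keys_mult_orthant keys_step)
  qed
  have pos: "0 \<le> dint (dirac t * (steps L * (\<Sum>(i, j) | i < j. step i 1 * step j 1))) g"
    if t: "t \<in> orthant" and L: "\<forall>(i, s)\<in>set L. 0 \<le> s" for t L
  proof -
    have "dirac t * (steps L * (\<Sum>(i, j) | i < j. step i 1 * step j 1)) = (\<Sum>(i, j) | i < j. dirac t * steps (L @ [(i, 1), (j, 1)]))"
      by (simp add: sum_distrib_left case_prod_beta mult.assoc)
    then have "dint (dirac t * (steps L * (\<Sum>(i, j) | i < j. step i 1 * step j 1))) g = (\<Sum>(i, j) | i < j. dint (dirac t * steps (L @ [(i, 1), (j, 1)])) g)"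
      by (simp add: dint_sum case_prod_beta)
    also have "0 \<le> \<dots>"
    proof (rule sum_nonneg, clarify)
      fix i j :: 'n assume "i < j"
      then have "\<exists>k l. k \<noteq> l \<and> k \<in> fst ` set (L @ [(i, 1), (j, 1)]) \<and> l \<in> fst ` set (L @ [(i, 1), (j, 1)])"
        by (intro exI[of _ i] exI[of _ j]) auto
      then show "0 \<le> dint (dirac t * steps (L @ [(i, 1), (j, 1)])) g"
        using L by (intro mixed[unfolded mixed_alternating_def, rule_format, OF t]) auto
    qed
    finally show ?thesis .
  qed
  obtain S where "orthant_measure S" "\<And>t. t \<in> orthant \<Longrightarrow>
    dint (dirac t * (\<Sum>(i, j) | i < j. step i 1 * step j 1)) g = (\<integral>r. exp (- (r \<bullet> t)) \<partial>S)"
    using difference_measure[OF cont keys pos] by blast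
  then have "difference_system g (\<lambda>i j. SOME \<rho>. P i j \<rho>) S"
    using P unfolding difference_system_def P_def by blast
  then show thesis by (rule that)
qed

lemma incr_one: "incr 1 x = 1"
  by (simp add: incr_def)

lemma decay_bounds: "r \<in> orthant \<Longrightarrow> 0 \<le> decay r $ i \<and> decay r $ i \<le> 1"
  by (auto simp: orthant_def)

lemma elem_sym_decay_bounds:
  fixes r :: "real^'n::finite"
  assumes "r \<in> orthant"
  shows "0 \<le> elem_sym k (decay r)" "elem_sym k (decay r) \<le> real (card {F :: 'n set. card F = k})"
proof -
  show "0 \<le> elem_sym k (decay r)" by (intro elem_sym_nonneg decay_in_orthant assms)
  have "elem_sym k (decay r) \<le> (\<Sum>F | F \<in> {F :: 'n set. card F = k}. 1)"
    unfolding elem_sym_def using decay_bounds[OF assms] by (intro sum_mono2[THEN order_trans, OF _ _ _ sum_mono] prod_le_1) auto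
  then show "elem_sym k (decay r) \<le> real (card {F :: 'n set. card F = k})" by simp
qed

lemma exp_transform_pair_sum:
  fixes r :: "real^'n::{finite,linorder}"
  shows "exp_transform (\<Sum>(i, j) | i < j. step i 1 * step j 1) r = elem_sym 2 (decay r)"
  by (simp add: exp_transform_sum case_prod_beta exp_transform_mult elem_sym_two_pairs)

context
  fixes g :: "real^'n::{finite,linorder} \<Rightarrow> real" and \<rho> S
  assumes sys: "difference_system g \<rho> S"
begin

lemma system_S: "orthant_measure S"
  "t \<in> orthant \<Longrightarrow> dint (dirac t * (\<Sum>(i, j) | i < j. step i 1 * step j 1)) g = (\<integral>r. exp (- (r \<bullet> t)) \<partial>S)"
  using sys by (auto simp: difference_system_def)

lemma system_\<rho>: "i \<noteq> j \<Longrightarrow> orthant_measure (\<rho> i j)"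
  "i \<noteq> j \<Longrightarrow> 0 \<le> a \<Longrightarrow> 0 \<le> b \<Longrightarrow> t \<in> orthant \<Longrightarrow>
    dint (dirac t * (step i a * step j b)) g = (\<integral>r. exp (- (r \<bullet> t)) * (incr a (r $ i) * incr b (r $ j)) \<partial>\<rho> i j)"
  using sys by (auto simp: difference_system_def)

lemma system_\<rho>_one:
  "i \<noteq> j \<Longrightarrow> t \<in> orthant \<Longrightarrow> dint (dirac t * (step i 1 * step j 1)) g = (\<integral>r. exp (- (r \<bullet> t)) \<partial>\<rho> i j)"
  using system_\<rho>(2)[of i j 1 1 t] by (simp add: incr_one)

text \<open>
  The same product of unit steps, read in two ways, compares two of the measures \<open>\<rho> i j\<close>.
\<close>

lemma system_swap:
  assumes ij: "i \<noteq> j" and kl: "k \<noteq> l" and y: "Poly_Mapping.keys y \<subseteq> orthant" "Poly_Mapping.keys z \<subseteq> orthant"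
    and eq: "y * (step i 1 * step j 1) = z * (step k 1 * step l 1)"
    and bounds: "\<forall>r\<in>orthant. 0 \<le> exp_transform y r \<and> exp_transform y r \<le> B" "\<forall>r\<in>orthant. 0 \<le> exp_transform z r \<and> exp_transform z r \<le> B'"
    and f: "f \<in> borel_measurable borel"
  shows "(\<integral>r. exp_transform y r * f r \<partial>\<rho> i j) = (\<integral>r. exp_transform z r * f r \<partial>\<rho> k l)"
proof (rule laplace_density_unique(1)[OF system_\<rho>(1)[OF ij] system_\<rho>(1)[OF kl] _ bounds(1) _ bounds(2) _ f])
  fix t :: "(real, 'n) vec" assume t: "t \<in> orthant"
  show "(\<integral>r. exp (- (r \<bullet> t)) * exp_transform y r \<partial>\<rho> i j) = (\<integral>r. exp (- (r \<bullet> t)) * exp_transform z r \<partial>\<rho> k l)"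
    using laplace_action[OF system_\<rho>(1)[OF ij] system_\<rho>_one[OF ij] y(1) t]
      laplace_action[OF system_\<rho>(1)[OF kl] system_\<rho>_one[OF kl] y(2) t] eq by simp
qed measurable

text \<open>
  Both sides represent the unit differences in \<open>i\<close> and \<open>j\<close> followed by the sum over all pairs.  So where
  \<open>elem_sym 2 (decay r)\<close> is positive, \<open>S\<close> determines all the measures \<open>\<rho> i j\<close>.
\<close>

lemma system_to_S:
  assumes ij: "i \<noteq> j" and f: "f \<in> borel_measurable borel"
  shows "(\<integral>r. elem_sym 2 (decay r) * f r \<partial>\<rho> i j) = (\<integral>r. (decay r $ i * decay r $ j) * f r \<partial>S)" (is ?eq)
    "integrable (\<rho> i j) (\<lambda>r. elem_sym 2 (decay r) * f r) \<longleftrightarrow> integrable S (\<lambda>r. (decay r $ i * decay r $ j) * f r)" (is ?int)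
proof -
  let ?Q = "\<Sum>(i, j) | i < j. step i 1 * step j 1 :: (real, 'n) vec dmeasure"
  have Q: "Poly_Mapping.keys ?Q \<subseteq> orthant"
  proof (rule order_trans[OF keys_sum], rule UN_least)
    fix p :: "'n \<times> 'n"
    show "Poly_Mapping.keys (case p of (i, j) \<Rightarrow> step i 1 * step j 1) \<subseteq> (orthant :: (real, 'n) vec set)"
      by (cases p) (simp add: keys_mult_orthant keys_step)
  qed
  have D: "Poly_Mapping.keys (step i 1 * step j 1) \<subseteq> (orthant :: (real, 'n) vec set)" by (simp add: keys_mult_orthant keys_step)
  have eq: "(\<integral>r. exp (- (r \<bullet> t)) * elem_sym 2 (decay r) \<partial>\<rho> i j) = (\<integral>r. exp (- (r \<bullet> t)) * (decay r $ i * decay r $ j) \<partial>S)"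
    if t: "t \<in> orthant" for t
    using laplace_action[OF system_\<rho>(1)[OF ij] system_\<rho>_one[OF ij] Q t] laplace_action[OF system_S(1) system_S(2) D t]
    by (simp add: exp_transform_pair_sum exp_transform_two_steps mult.commute[of ?Q])
  have b1: "\<forall>r\<in>(orthant :: (real, 'n) vec set). 0 \<le> elem_sym 2 (decay r) \<and> elem_sym 2 (decay r) \<le> real (card {F :: 'n set. card F = 2})"
    by (intro ballI conjI elem_sym_decay_bounds)
  have b2: "\<forall>r\<in>(orthant :: (real, 'n) vec set). 0 \<le> decay r $ i * decay r $ j \<and> decay r $ i * decay r $ j \<le> 1"
    using decay_bounds by (auto simp del: decay_nth intro!: mult_le_one)
  have m: "(\<lambda>r :: (real, 'n) vec. elem_sym 2 (decay r)) \<in> borel_measurable borel" "(\<lambda>r :: (real, 'n) vec. decay r $ i * decay r $ j) \<in> borel_measurable borel"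
    by (measurable, unfold decay_nth, measurable)
  show ?eq by (rule laplace_density_unique(1)[OF system_\<rho>(1)[OF ij] system_S(1) m(1) b1 m(2) b2 eq f])
  show ?int by (rule laplace_density_unique(2)[OF system_\<rho>(1)[OF ij] system_S(1) m(1) b1 m(2) b2 eq f])
qed

text \<open>
  A step in direction \<open>l\<close> applied to \<open>\<rho> i j\<close> equals a step in direction \<open>i\<close> applied to \<open>\<rho> l j\<close>, whose transform
  vanishes for \<open>r\<^sub>i = 0\<close>.
\<close>

lemma system_face:
  assumes ij: "i \<noteq> j" and l: "l \<noteq> i" "l \<noteq> j"
  shows "AE r in \<rho> i j. (r $ i = 0 \<longrightarrow> r $ l = 0) \<and> (r $ j = 0 \<longrightarrow> r $ l = 0)"
proof -
  have [measurable_cong]: "sets (\<rho> i j) = sets borel" and orth: "AE r in \<rho> i j. r \<in> orthant"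
    using system_\<rho>(1)[OF ij] by (auto simp: orthant_measure_def)
  have b: "\<forall>r\<in>orthant. 0 \<le> exp_transform (step k 1) r \<and> exp_transform (step k 1) r \<le> 1" for k
    by (auto simp: orthant_def)
  have *: "AE r in \<rho> i j. r $ k = 0 \<longrightarrow> r $ l = 0"
    if eq: "(\<integral>r. exp_transform (step l 1) r * indicator {r. r $ k = 0} r \<partial>\<rho> i j) = (\<integral>r. exp_transform (step k 1) r * indicator {r. r $ k = 0} r \<partial>M)"
    for k M
  proof -
    have "(\<lambda>r. exp_transform (step k 1) r * indicator {r. r $ k = 0} r) = (\<lambda>r. 0 :: real)"
      by (auto simp: indicator_def)
    then have zero: "(\<integral>r. exp_transform (step l 1) r * indicator {r. r $ k = 0} r \<partial>\<rho> i j) = 0"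
      using eq by simp
    have "integrable (\<rho> i j) (\<lambda>r. exp_transform (step l 1) r * indicator {r. r $ k = 0} r)"
      by (rule orthant_measure_integrable[OF system_\<rho>(1)[OF ij], of _ 1]) (auto simp: indicator_def orthant_def)
    moreover have "AE r in \<rho> i j. 0 \<le> exp_transform (step l 1) r * indicator {r. r $ k = 0} r"
      using orth by eventually_elim (auto simp: indicator_def orthant_def)
    ultimately have "AE r in \<rho> i j. exp_transform (step l 1) r * indicator {r. r $ k = 0} r = 0"
      using zero by (simp add: integral_nonneg_eq_0_iff_AE)
    then show ?thesis by eventually_elim (auto simp: indicator_def split: if_splits)
  qed
  have "(\<integral>r. exp_transform (step l 1) r * indicator {r. r $ i = 0} r \<partial>\<rho> i j) = (\<integral>r. exp_transform (step i 1) r * indicator {r. r $ i = 0} r \<partial>\<rho> l j)"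
    by (rule system_swap[OF ij _ keys_step keys_step _ b b]) (use l in \<open>auto simp: mult_ac\<close>)
  then have "AE r in \<rho> i j. r $ i = 0 \<longrightarrow> r $ l = 0" by (rule *)
  moreover have "(\<integral>r. exp_transform (step l 1) r * indicator {r. r $ j = 0} r \<partial>\<rho> i j) = (\<integral>r. exp_transform (step j 1) r * indicator {r. r $ j = 0} r \<partial>\<rho> i l)"
    by (rule system_swap[OF ij _ keys_step keys_step _ b b]) (use l in \<open>auto simp: mult_ac\<close>)
  then have "AE r in \<rho> i j. r $ j = 0 \<longrightarrow> r $ l = 0" by (rule *)
  ultimately show ?thesis by eventually_elim auto
qed

text \<open>
  If \<open>r\<^sub>l > 0\<close> for a third index, then \<open>r\<^sub>i\<close> and \<open>r\<^sub>j\<close> are positive by \<open>system_face\<close>, and \<open>r\<close> lies in \<open>Omega\<close>.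
\<close>

lemma system_off_Omega:
  assumes ij: "i \<noteq> j"
  shows "AE r in \<rho> i j. r \<notin> Omega \<longrightarrow> (\<forall>l. l \<noteq> i \<and> l \<noteq> j \<longrightarrow> r $ l = 0)"
proof -
  have orth: "AE r in \<rho> i j. r \<in> orthant"
    using system_\<rho>(1)[OF ij] by (auto simp: orthant_measure_def)
  have "AE r in \<rho> i j. \<forall>l\<in>UNIV - {i, j}. (r $ i = 0 \<longrightarrow> r $ l = 0) \<and> (r $ j = 0 \<longrightarrow> r $ l = 0)"
  proof (rule AE_finite_allI)
    fix l assume "l \<in> UNIV - {i, j}"
    then show "AE r in \<rho> i j. (r $ i = 0 \<longrightarrow> r $ l = 0) \<and> (r $ j = 0 \<longrightarrow> r $ l = 0)"
      by (intro system_face[OF ij]) auto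
  qed simp
  then show ?thesis
    using orth
  proof eventually_elim
    case (elim r)
    show ?case
    proof (intro impI allI, rule ccontr)
      fix l assume off: "r \<notin> Omega" and l: "l \<noteq> i \<and> l \<noteq> j" and "r $ l \<noteq> 0"
      then have "r $ i \<noteq> 0" "r $ j \<noteq> 0" using elim(1) by auto
      then have "{i, j, l} \<subseteq> {k. 0 < r $ k}" using elim(2) \<open>r $ l \<noteq> 0\<close> by (auto simp: orthant_def less_le)
      then have "card {i, j, l} \<le> card {k. 0 < r $ k}" by (intro card_mono) auto
      moreover have "i \<noteq> l" "j \<noteq> l" using l by auto
      ultimately have "r \<in> Omega" unfolding Omega_iff using elim(2) ij by simp
      then show False using off by blast
    qed
  qed
qed

end

definition weight :: "real^'n::finite \<Rightarrow> real" where
  "weight r = elem_sym 2 (1 + r) / elem_sym 2 r"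

definition edge_function :: "(real^'n::finite) measure \<Rightarrow> 'n \<Rightarrow> 'n \<Rightarrow> real^2 \<Rightarrow> real" where
  "edge_function M i j s = (\<integral>r. indicator (- Omega) r * (incr (s $ 1) (r $ i) * incr (s $ 2) (r $ j)) \<partial>M)"

text \<open>
  The formal measure behind all \<open>\<rho> i j\<close> is \<open>S\<close> divided by \<open>elem_sym 2 (decay r)\<close>; dividing by \<open>weight\<close> as well
  makes it finite and accounts for the factor \<open>weight\<close> in the representation.
\<close>

definition bulk_measure :: "(real^'n::finite) measure \<Rightarrow> (real^'n) measure" where
  "bulk_measure S = density (restrict_space S Omega) (\<lambda>r. ennreal (1 / (elem_sym 2 (decay r) * weight r)))"

lemma borel_measurable_weight [measurable]: "weight \<in> borel_measurable borel"
  unfolding weight_def by measurable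

lemma borel_measurable_base_kernel [measurable]: "(\<lambda>r. base_kernel r t) \<in> borel_measurable borel"
  unfolding base_kernel_def by measurable

lemma weight_bounds:
  assumes "r \<in> Omega"
  shows "0 < weight r" "1 \<le> elem_sym 2 (decay r) * weight r"
proof -
  have r: "r \<in> orthant" using assms by simp
  have p: "0 < elem_sym 2 r" using Omega_elem_sym_pos[OF assms, of 2] by simp
  have b: "elem_sym 2 r \<le> elem_sym 2 (decay r) * elem_sym 2 (1 + r)" by (rule elem_sym_decay_bound[OF r])
  have "0 \<le> elem_sym 2 (decay r)" by (intro elem_sym_nonneg decay_in_orthant r)
  then have "0 < elem_sym 2 (1 + r)" using p b by (smt (verit) mult_nonneg_nonpos)
  then show "0 < weight r" using p by (simp add: weight_def)
  show "1 \<le> elem_sym 2 (decay r) * weight r" using p b by (simp add: weight_def)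
qed

lemma bulk_measure_props:
  fixes S :: "(real^'n::finite) measure"
  assumes S: "orthant_measure S"
  shows "finite_measure (bulk_measure S)" "sets (bulk_measure S) = sets (restrict_space borel Omega)"
    and "h \<in> borel_measurable borel \<Longrightarrow> integrable (bulk_measure S) (\<lambda>r. h r * weight r) \<longleftrightarrow> integrable S (\<lambda>r. indicator Omega r * (h r / elem_sym 2 (decay r)))"
    and "h \<in> borel_measurable borel \<Longrightarrow> (\<integral>r. h r * weight r \<partial>bulk_measure S) = (\<integral>r. indicator Omega r * (h r / elem_sym 2 (decay r)) \<partial>S)"
proof -
  have [measurable_cong]: "sets S = sets borel" and fin: "finite_measure S" using S by (auto simp: orthant_measure_def)
  have sp: "space S = UNIV" using \<open>sets S = sets borel\<close> by (simp add: sets_eq_imp_space_eq)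
  have Om: "Omega \<inter> space S \<in> sets S" by measurable
  have spR: "space (restrict_space S Omega) = Omega" using sp by (simp add: space_restrict_space)
  let ?u = "\<lambda>r :: real^'n. 1 / (elem_sym 2 (decay r) * weight r)"
  have u: "0 \<le> ?u r \<and> ?u r \<le> 1" if "r \<in> Omega" for r :: "real^'n"
    using weight_bounds(2)[OF that] by (auto simp: divide_simps)
  have um: "?u \<in> borel_measurable (restrict_space S Omega)"
    by (rule measurable_restrict_space1) measurable
  show "sets (bulk_measure S) = sets (restrict_space borel Omega)"
    unfolding bulk_measure_def by (simp add: sets_restrict_space \<open>sets S = sets borel\<close>)
  have "emeasure (bulk_measure S) (space (bulk_measure S)) = (\<integral>\<^sup>+ r. ennreal (?u r) * indicator (space (restrict_space S Omega)) r \<partial>restrict_space S Omega)"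
    unfolding bulk_measure_def space_density
    by (rule emeasure_density[OF measurable_compose[OF um measurable_ennreal] sets.top])
  also have "\<dots> = (\<integral>\<^sup>+ r. ennreal (?u r) \<partial>restrict_space S Omega)"
    by (rule nn_integral_cong) simp
  also have "\<dots> \<le> (\<integral>\<^sup>+ r. 1 \<partial>restrict_space S Omega)"
    by (intro nn_integral_mono) (use u spR in auto)
  also have "\<dots> = emeasure S Omega" using Om sp by (simp add: emeasure_restrict_space spR)
  also have "\<dots> < \<infinity>" using fin by (simp add: finite_measure.emeasure_finite less_top[symmetric])
  finally show "finite_measure (bulk_measure S)" by (intro finite_measureI) auto
  show "integrable (bulk_measure S) (\<lambda>r. h r * weight r) \<longleftrightarrow> integrable S (\<lambda>r. indicator Omega r * (h r / elem_sym 2 (decay r)))"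
    and "(\<integral>r. h r * weight r \<partial>bulk_measure S) = (\<integral>r. indicator Omega r * (h r / elem_sym 2 (decay r)) \<partial>S)"
    if h[measurable]: "h \<in> borel_measurable borel"
  proof -
    have hm: "(\<lambda>r. h r * weight r) \<in> borel_measurable (restrict_space S Omega)"
      by (rule measurable_restrict_space1) measurable
    have nn: "AE r in restrict_space S Omega. 0 \<le> ?u r" by (rule AE_I2) (use u spR in auto)
    have eq: "indicator Omega r *\<^sub>R (?u r *\<^sub>R (h r * weight r)) = indicator Omega r * (h r / elem_sym 2 (decay r))" for r
      using weight_bounds(1)[of r] by (auto simp: indicator_def)
    show "integrable (bulk_measure S) (\<lambda>r. h r * weight r) \<longleftrightarrow> integrable S (\<lambda>r. indicator Omega r * (h r / elem_sym 2 (decay r)))"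
      unfolding bulk_measure_def integrable_density[OF hm um nn] integrable_restrict_space[OF Om] eq ..
    show "(\<integral>r. h r * weight r \<partial>bulk_measure S) = (\<integral>r. indicator Omega r * (h r / elem_sym 2 (decay r)) \<partial>S)"
      unfolding bulk_measure_def integral_density[OF hm um nn] integral_restrict_space[OF Om] eq ..
  qed
qed

lemma incr_product_bound:
  assumes "r \<in> orthant" "0 \<le> a" "0 \<le> b"
  shows "0 \<le> incr a (r $ i) * incr b (r $ j)" "incr a (r $ i) * incr b (r $ j) \<le> (a + 1) * (b + 1)"
proof -
  have r: "0 \<le> r $ i" "0 \<le> r $ j" using assms by (auto simp: orthant_def)
  show "0 \<le> incr a (r $ i) * incr b (r $ j)" using r assms by (intro mult_nonneg_nonneg incr_nonneg)
  show "incr a (r $ i) * incr b (r $ j) \<le> (a + 1) * (b + 1)"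
    using r assms by (intro mult_mono incr_le incr_nonneg) auto
qed

lemma damped_incr_bound:
  assumes r: "r \<in> orthant" and t: "t \<in> orthant" and ab: "0 \<le> a" "0 \<le> b"
  shows "\<bar>exp (- (r \<bullet> t)) * (incr a (r $ i) * incr b (r $ j))\<bar> \<le> (a + 1) * (b + 1)"
proof -
  have "exp (- (r \<bullet> t)) * (incr a (r $ i) * incr b (r $ j)) \<le> 1 * ((a + 1) * (b + 1))"
    by (rule mult_mono) (use exp_inner_bounds[OF r t] incr_product_bound[OF r ab] in auto)
  moreover have "0 \<le> exp (- (r \<bullet> t)) * (incr a (r $ i) * incr b (r $ j))"
    by (intro mult_nonneg_nonneg[OF _ incr_product_bound(1)[OF r ab]]) simp
  ultimately show ?thesis by simp
qed

context
  fixes g :: "real^'n::{finite,linorder} \<Rightarrow> real" and \<rho> S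
  assumes sys: "difference_system g \<rho> S"
begin

text \<open>
  On \<open>Omega\<close> the measure \<open>\<rho> i j\<close> is expressed through \<open>S\<close>.  Off \<open>Omega\<close> the damping factor
  \<open>exp (- (r \<bullet> cut {..<i} t))\<close> is almost everywhere \<open>1\<close>, because it involves only coordinates before \<open>i\<close>, which vanish there.
\<close>

lemma system_pair_integral:
  assumes ij: "i < j" and t: "t \<in> orthant"
  defines "J \<equiv> \<lambda>r. indicator Omega r * (exp (- (r \<bullet> cut {..<i} t)) * ((1 - exp (- (r $ i * t $ i))) * (1 - exp (- (r $ j * t $ j)))) / elem_sym 2 (decay r))"
  shows "integrable S J"
    "dint (dirac (cut {..<i} t) * (step i (t $ i) * step j (t $ j))) g = edge_function (\<rho> i j) i j (vector [t $ i, t $ j]) + integral\<^sup>L S J"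
proof -
  have ne: "i \<noteq> j" using ij by simp
  have M: "orthant_measure (\<rho> i j)" by (rule system_\<rho>(1)[OF sys ne])
  have [measurable_cong]: "sets (\<rho> i j) = sets borel" using M by (simp add: orthant_measure_def)
  have t0: "0 \<le> t $ i" "0 \<le> t $ j" using t by (auto simp: orthant_def)
  define c where "c = cut {..<i} t"
  have c: "c \<in> orthant" unfolding c_def by (rule cut_in_orthant[OF t])
  define I where "I r = incr (t $ i) (r $ i) * incr (t $ j) (r $ j)" for r :: "(real, 'n) vec"
  have [measurable]: "I \<in> borel_measurable borel" unfolding I_def by measurable
  define f where "f r = indicator Omega r * (exp (- (r \<bullet> c)) * I r / elem_sym 2 (decay r))" for r
  have fm: "f \<in> borel_measurable borel" unfolding f_def by measurable
  have f1: "(\<lambda>r. elem_sym 2 (decay r) * f r) = (\<lambda>r. indicator Omega r * (exp (- (r \<bullet> c)) * I r))"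
  proof
    fix r :: "(real, 'n) vec"
    show "elem_sym 2 (decay r) * f r = indicator Omega r * (exp (- (r \<bullet> c)) * I r)"
      using Omega_elem_sym_pos(2)[of r 2] by (cases "r \<in> Omega") (auto simp: f_def)
  qed
  have f2: "(\<lambda>r. (decay r $ i * decay r $ j) * f r) = J"
  proof
    fix r :: "(real, 'n) vec"
    have "(decay r $ i * decay r $ j) * I r = (incr (t $ i) (r $ i) * (1 - exp (- (r $ i)))) * (incr (t $ j) (r $ j) * (1 - exp (- (r $ j))))"
      by (simp add: I_def mult_ac)
    also have "\<dots> = (1 - exp (- (r $ i * t $ i))) * (1 - exp (- (r $ j * t $ j)))"
      unfolding incr_mult by (simp add: mult.commute)
    finally have *: "(decay r $ i * decay r $ j) * I r = (1 - exp (- (r $ i * t $ i))) * (1 - exp (- (r $ j * t $ j)))" .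
    have "(decay r $ i * decay r $ j) * f r = indicator Omega r * (exp (- (r \<bullet> c)) * ((decay r $ i * decay r $ j) * I r) / elem_sym 2 (decay r))"
      unfolding f_def by (simp del: decay_nth add: mult_ac)
    then show "(decay r $ i * decay r $ j) * f r = J r" unfolding * J_def c_def .
  qed
  have bound: "\<bar>exp (- (r \<bullet> c)) * I r\<bar> \<le> (t $ i + 1) * (t $ j + 1)" if "r \<in> orthant" for r
    unfolding I_def by (rule damped_incr_bound[OF that c t0])
  have intA: "integrable (\<rho> i j) (\<lambda>r. indicator A r * (exp (- (r \<bullet> c)) * I r))" if A: "A \<in> sets borel" for A
  proof (rule orthant_measure_integrable[OF M, of _ "(t $ i + 1) * (t $ j + 1)"])
    show "(\<lambda>r. indicator A r * (exp (- (r \<bullet> c)) * I r)) \<in> borel_measurable borel" using A by measurable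
    show "\<bar>indicator A r * (exp (- (r \<bullet> c)) * I r)\<bar> \<le> (t $ i + 1) * (t $ j + 1)" if "r \<in> orthant" for r
      using bound[OF that] t0 by (auto simp: indicator_def)
  qed
  show "integrable S J"
    using system_to_S(2)[OF sys ne fm] intA[of Omega] unfolding f1 f2 by simp
  have "dint (dirac c * (step i (t $ i) * step j (t $ j))) g = (\<integral>r. exp (- (r \<bullet> c)) * I r \<partial>\<rho> i j)"
    unfolding I_def by (rule system_\<rho>(2)[OF sys ne t0 c])
  also have "\<dots> = (\<integral>r. indicator (- Omega) r * (exp (- (r \<bullet> c)) * I r) + indicator Omega r * (exp (- (r \<bullet> c)) * I r) \<partial>\<rho> i j)"
    by (intro Bochner_Integration.integral_cong refl) (auto simp: indicator_def)
  also have "\<dots> = (\<integral>r. indicator (- Omega) r * (exp (- (r \<bullet> c)) * I r) \<partial>\<rho> i j) + (\<integral>r. indicator Omega r * (exp (- (r \<bullet> c)) * I r) \<partial>\<rho> i j)"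
    by (intro Bochner_Integration.integral_add intA) auto
  also have "(\<integral>r. indicator Omega r * (exp (- (r \<bullet> c)) * I r) \<partial>\<rho> i j) = integral\<^sup>L S J"
    using system_to_S(1)[OF sys ne fm] unfolding f1 f2 .
  also have "(\<integral>r. indicator (- Omega) r * (exp (- (r \<bullet> c)) * I r) \<partial>\<rho> i j) = edge_function (\<rho> i j) i j (vector [t $ i, t $ j])"
    unfolding edge_function_def
  proof (rule integral_cong_AE)
    show "AE r in \<rho> i j. indicator (- Omega) r * (exp (- (r \<bullet> c)) * I r)
       = indicator (- Omega) r * (incr ((vector [t $ i, t $ j] :: real^2) $ 1) (r $ i) * incr ((vector [t $ i, t $ j] :: real^2) $ 2) (r $ j))"
      using system_off_Omega[OF sys ne]
    proof eventually_elim
      case (elim r)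
      have "r \<bullet> c = 0" if "r \<notin> Omega"
        unfolding inner_vec_def using elim that ij by (intro sum.neutral) (auto simp: c_def cut_def)
      then show ?case by (auto simp: indicator_def I_def)
    qed
  qed measurable
  finally show "dint (dirac (cut {..<i} t) * (step i (t $ i) * step j (t $ j))) g = edge_function (\<rho> i j) i j (vector [t $ i, t $ j]) + integral\<^sup>L S J"
    by (simp add: c_def)
qed

text \<open>
  The integrals over \<open>Omega\<close> from all pairs add up to the integral of \<open>base_kernel\<close>, since \<open>base_kernel\<close> itself has a
  decomposition into pairs.
\<close>

lemma system_represents:
  assumes bdry: "\<forall>t\<in>orthant_bdry 1. g t = 0" and t: "t \<in> orthant"
  shows "integrable (bulk_measure S) (\<lambda>r. base_kernel r t * weight r)"
    "g t = (\<Sum>(i, j) | i < j. edge_function (\<rho> i j) i j (vector [t $ i, t $ j])) + (\<integral>r. base_kernel r t * weight r \<partial>bulk_measure S)"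
proof -
  define J where "J i j r = indicator Omega r * (exp (- (r \<bullet> cut {..<i} t)) * ((1 - exp (- (r $ i * t $ i))) * (1 - exp (- (r $ j * t $ j)))) / elem_sym 2 (decay r))" for i j and r :: "(real, 'n) vec"
  have J: "integrable S (J i j)"
    "dint (dirac (cut {..<i} t) * (step i (t $ i) * step j (t $ j))) g = edge_function (\<rho> i j) i j (vector [t $ i, t $ j]) + integral\<^sup>L S (J i j)"
    if "i < j" for i j
    using system_pair_integral[OF that t] unfolding J_def by auto
  have base: "(\<lambda>r. indicator Omega r * (base_kernel r t / elem_sym 2 (decay r))) = (\<lambda>r. \<Sum>(i, j) | i < j. J i j r)"
    unfolding base_kernel_pair_sum[OF t] J_def by (simp add: sum_divide_distrib sum_distrib_left case_prod_beta)
  have S: "orthant_measure S" by (rule system_S(1)[OF sys])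
  note bulk = bulk_measure_props(3,4)[OF S borel_measurable_base_kernel[of t]]
  have intS: "integrable S (\<lambda>r. \<Sum>(i, j) | i < j. J i j r)"
    by (intro Bochner_Integration.integrable_sum) (use J(1) in auto)
  show "integrable (bulk_measure S) (\<lambda>r. base_kernel r t * weight r)"
    unfolding bulk(1) base by (rule intS)
  have "g t = (\<Sum>(i, j) | i < j. dint (dirac (cut {..<i} t) * (step i (t $ i) * step j (t $ j))) g)"
    by (rule pair_decomposition[OF _ t]) (use bdry in auto)
  also have "\<dots> = (\<Sum>(i, j) | i < j. edge_function (\<rho> i j) i j (vector [t $ i, t $ j])) + (\<Sum>(i, j) | i < j. integral\<^sup>L S (J i j))"
    unfolding sum.distrib[symmetric] by (intro sum.cong refl) (auto simp: J(2))
  also have "(\<Sum>(i, j) | i < j. integral\<^sup>L S (J i j)) = (\<integral>r. (\<Sum>(i, j) | i < j. J i j r) \<partial>S)"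
    unfolding case_prod_beta by (rule Bochner_Integration.integral_sum[symmetric]) (use J(1) in auto)
  also have "\<dots> = (\<integral>r. base_kernel r t * weight r \<partial>bulk_measure S)"
    unfolding bulk(2) base ..
  finally show "g t = (\<Sum>(i, j) | i < j. edge_function (\<rho> i j) i j (vector [t $ i, t $ j])) + (\<integral>r. base_kernel r t * weight r \<partial>bulk_measure S)" .
qed

end


section \<open>Smoothness of the representing integrals, and the representation\<close>

definition exp_jet :: "'n \<Rightarrow> nat \<Rightarrow> real \<Rightarrow> real^'n::finite \<Rightarrow> real" where
  "exp_jet l m t r = (- (r $ l)) ^ m * exp (- (r $ l * t))"

definition incr_slope :: "real \<Rightarrow> real" where
  "incr_slope x = (if x = 0 then 1 else x / (1 - exp (- x)))"

text \<open>
  \<open>incr_slope\<close> is the derivative of \<open>\<lambda>a. incr a x\<close> at \<open>a = 0\<close>; all further derivatives are those of an exponential.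
\<close>

definition incr_jet :: "'n \<Rightarrow> nat \<Rightarrow> real \<Rightarrow> real^'n::finite \<Rightarrow> real" where
  "incr_jet l m t r = (case m of 0 \<Rightarrow> incr t (r $ l) | Suc k \<Rightarrow> incr_slope (r $ l) * ((- (r $ l)) ^ k * exp (- (r $ l * t))))"

definition const_jet :: "nat \<Rightarrow> real \<Rightarrow> real^'n::finite \<Rightarrow> real" where
  "const_jet m t r = (if m = 0 then 1 else 0)"

lemma incr_slope_bounds:
  assumes "0 \<le> x"
  shows "0 \<le> incr_slope x" "incr_slope x \<le> 1 + x"
  using assms decay_bound[OF assms] by (auto simp: incr_slope_def divide_simps mult.commute)

text \<open>
  From \<open>y \<le> exp y\<close> for \<open>y = x a / m\<close>, raised to the power \<open>m\<close>.
\<close>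

lemma power_times_exp_bound:
  assumes a: "0 < a" "a \<le> t" and x: "0 \<le> (x :: real)"
  shows "x ^ m * exp (- (x * t)) \<le> (if m = 0 then 1 else (real m / a) ^ m)"
proof (cases "m = 0")
  case False
  then have m: "0 < real m" by simp
  have "x * a / real m \<le> exp (x * a / real m)"
    using exp_ge_add_one_self[of "x * a / real m"] by linarith
  then have "(x * a / real m) ^ m \<le> exp (x * a / real m) ^ m"
    using x a by (intro power_mono) auto
  also have "exp (x * a / real m) ^ m = exp (x * a)" using m by (simp flip: exp_of_nat_mult)
  finally have "x ^ m * (a / real m) ^ m \<le> exp (x * a)" by (simp add: power_mult_distrib power_divide)
  then have "x ^ m * (a / real m) ^ m * (real m / a) ^ m \<le> exp (x * a) * (real m / a) ^ m"
    using a by (intro mult_right_mono) auto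
  moreover have "(a / real m) ^ m * (real m / a) ^ m = 1" using a m by (simp flip: power_mult_distrib)
  ultimately have "x ^ m \<le> exp (x * a) * (real m / a) ^ m" by (simp add: mult.assoc)
  then have "x ^ m * exp (- (x * t)) \<le> exp (x * a) * (real m / a) ^ m * exp (- (x * t))"
    by (intro mult_right_mono) auto
  also have "\<dots> = (real m / a) ^ m * exp (x * a - x * t)" by (simp add: exp_diff exp_minus field_simps)
  also have "\<dots> \<le> (real m / a) ^ m * 1"
    using a x by (intro mult_left_mono) (auto intro: mult_left_mono)
  finally show ?thesis using False by simp
qed (use a x in auto)

lemma jet_kernel_exp:
  assumes "sets M = sets borel"
  shows "jet_kernel M orthant (exp_jet l)"
  unfolding jet_kernel_def
proof (intro conjI allI ballI impI)
  note [measurable_cong] = assms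
  show "(\<lambda>r. exp_jet l m t r) \<in> borel_measurable M" for m t unfolding exp_jet_def by measurable
  show "((\<lambda>s. exp_jet l m s r) has_real_derivative exp_jet l (Suc m) t r) (at t)" for m t and r :: "real^'a"
    unfolding exp_jet_def by (auto intro!: derivative_eq_intros)
  show "\<exists>C. \<forall>t\<in>{a..b}. \<forall>r\<in>orthant. \<bar>exp_jet l m t r\<bar> \<le> C" if "0 < a" for m and a b :: real
  proof (intro exI ballI)
    fix t and r :: "real^'a" assume "t \<in> {a..b}" "r \<in> orthant"
    then show "\<bar>exp_jet l m t r\<bar> \<le> (if m = 0 then 1 else (real m / a) ^ m)"
      using power_times_exp_bound[OF that, of t "r $ l" m] by (simp add: exp_jet_def abs_mult power_abs orthant_def)
  qed
qed

lemma jet_kernel_incr: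
  assumes "sets M = sets borel"
  shows "jet_kernel M orthant (incr_jet l)"
  unfolding jet_kernel_def
proof (intro conjI allI ballI impI)
  note [measurable_cong] = assms
  have [measurable]: "incr_slope \<in> borel_measurable borel" unfolding incr_slope_def by measurable
  show "(\<lambda>r. incr_jet l m t r) \<in> borel_measurable M" for m t
    unfolding incr_jet_def by (cases m) auto
  show "((\<lambda>s. incr_jet l m s r) has_real_derivative incr_jet l (Suc m) t r) (at t)" for m t and r :: "real^'a"
  proof (cases m)
    case 0
    show ?thesis
    proof (cases "r $ l = 0")
      case True
      then show ?thesis by (simp add: 0 incr_jet_def incr_def incr_slope_def)
    next
      case False
      have "((\<lambda>s. (1 - exp (- (s * r $ l))) / (1 - exp (- (r $ l)))) has_real_derivative (r $ l * exp (- (t * r $ l))) / (1 - exp (- (r $ l)))) (at t)"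
        using False by (auto intro!: derivative_eq_intros)
      then show ?thesis using False by (simp add: 0 incr_jet_def incr_def incr_slope_def mult.commute)
    qed
  next
    case (Suc k)
    show ?thesis unfolding incr_jet_def Suc by (auto intro!: derivative_eq_intros)
  qed
  show "\<exists>C. \<forall>t\<in>{a..b}. \<forall>r\<in>orthant. \<bar>incr_jet l m t r\<bar> \<le> C" if a: "0 < a" for m and a b :: real
  proof (cases m)
    case 0
    show ?thesis
    proof (intro exI ballI)
      fix t and r :: "real^'a" assume "t \<in> {a..b}" "r \<in> orthant"
      then have "0 \<le> incr t (r $ l)" "incr t (r $ l) \<le> t + 1" "t \<le> b"
        using a incr_le[of t "r $ l"] incr_nonneg[of t "r $ l"] by (auto simp: orthant_def)
      then show "\<bar>incr_jet l m t r\<bar> \<le> b + 1" by (simp add: 0 incr_jet_def)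
    qed
  next
    case (Suc k)
    let ?C = "\<lambda>m. if m = 0 then 1 else (real m / a) ^ m"
    show ?thesis
    proof (intro exI ballI)
      fix t and r :: "real^'a" assume t: "t \<in> {a..b}" and r: "r \<in> orthant"
      define x where "x = r $ l"
      have x: "0 \<le> x" using r by (simp add: x_def orthant_def)
      have "\<bar>incr_jet l m t r\<bar> = incr_slope x * (x ^ k * exp (- (x * t)))"
        using x incr_slope_bounds(1)[OF x] by (simp add: Suc incr_jet_def abs_mult power_abs flip: x_def)
      also have "\<dots> \<le> (1 + x) * (x ^ k * exp (- (x * t)))"
        using x incr_slope_bounds(2)[OF x] by (intro mult_right_mono) auto
      also have "\<dots> = x ^ k * exp (- (x * t)) + x ^ Suc k * exp (- (x * t))" by (simp add: algebra_simps)
      also have "\<dots> \<le> ?C k + ?C (Suc k)"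
        using power_times_exp_bound[OF a, of t x k] power_times_exp_bound[OF a, of t x "Suc k"] t x by (intro add_mono) auto
      finally show "\<bar>incr_jet l m t r\<bar> \<le> ?C k + ?C (Suc k)" .
    qed
  qed
qed

lemma jet_kernel_const: "jet_kernel M orthant const_jet"
  unfolding jet_kernel_def const_jet_def by auto

text \<open>
  Differentiating the product of the two increments once in each variable gives a nonnegative multiple of an
  exponential, whose derivatives alternate in sign.
\<close>

lemma bernstein_edge_function:
  fixes M :: "(real^'n::finite) measure"
  assumes M: "orthant_measure M"
  shows "bernstein 2 (edge_function M i j)"
proof -
  define N where "N = density M (\<lambda>r. ennreal (indicator (- Omega) r))"
  have m: "(indicator (- Omega) :: real^'n \<Rightarrow> real) \<in> borel_measurable borel" by measurable
  have b: "\<forall>r\<in>orthant. 0 \<le> (indicator (- Omega) r :: real) \<and> (indicator (- Omega) (r :: real^'n) :: real) \<le> 1" by (auto simp: indicator_def)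
  have N: "orthant_measure N" unfolding N_def by (rule orthant_measure_density(1)[OF M m b])
  then have fin: "finite_measure N" and sets: "sets N = sets borel" and orth: "AE r in N. r \<in> orthant"
    by (simp_all add: orthant_measure_def)
  define \<theta> :: "2 \<Rightarrow> nat \<Rightarrow> real \<Rightarrow> real^'n \<Rightarrow> real" where "\<theta> l = (if l = 1 then incr_jet i else incr_jet j)" for l
  have \<theta>: "jet_kernel N orthant (\<theta> l)" for l using jet_kernel_incr[OF sets] by (simp add: \<theta>_def)
  define F where "F \<alpha> t = (\<integral>r. (\<Prod>l\<in>UNIV. \<theta> l (\<alpha> l) (t $ l) r) \<partial>N)" for \<alpha> and t :: "real^2"
  have fam: "derivative_family F" unfolding F_def by (rule derivative_family_integral[OF fin orth \<theta>])
  have two: "(\<Prod>l\<in>UNIV. h l) = h 1 * h 2" for h :: "2 \<Rightarrow> real" by (simp add: UNIV_2)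
  have F0: "edge_function M i j t = F (\<lambda>_. 0) t" for t
  proof -
    have mm: "(\<lambda>r. incr (t $ 1) (r $ i) * incr (t $ 2) (r $ j)) \<in> borel_measurable borel" by measurable
    show ?thesis
      unfolding edge_function_def F_def N_def orthant_measure_density(2)[OF M m b mm, symmetric]
      by (simp add: two \<theta>_def incr_jet_def)
  qed
  show ?thesis
    unfolding bernstein_def
  proof (intro conjI allI impI)
    show "smooth_on pos_orthant (edge_function M i j)" by (rule derivative_family_smooth[OF fam F0])
    fix A :: "2 set" assume "card A = 2"
    then have A: "A = UNIV" by (intro card_subset_eq) auto
    define h where "h = multi_partial (\<lambda>l. if l \<in> A then 1 else 0) (edge_function M i j)"
    have h: "h t = F (\<lambda>_. 1) t" if "t \<in> pos_orthant" for t
      unfolding h_def A using derivative_family_multi_partial[OF fam F0 that, of "\<lambda>_. 1"] by simp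
    have "completely_monotone h"
      unfolding completely_monotone_def
    proof (intro conjI allI ballI)
      show "smooth_on pos_orthant h" by (rule derivative_family_smooth[OF fam h])
      fix \<beta> :: "2 \<Rightarrow> nat" and t :: "real^2" assume t: "t \<in> pos_orthant"
      have sign: "0 \<le> (-1) ^ b * incr_jet l (Suc b) s r" if "r \<in> orthant" for b l s and r :: "real^'n"
      proof -
        have r: "0 \<le> r $ l" using that by (simp add: orthant_def)
        have "(-1) ^ b * incr_jet l (Suc b) s r = incr_slope (r $ l) * ((r $ l) ^ b * exp (- (r $ l * s)))"
          by (simp add: incr_jet_def mult_ac flip: power_mult_distrib)
        then show ?thesis using r incr_slope_bounds(1)[OF r] by simp
      qed
      have "(-1) ^ (\<Sum>l\<in>UNIV. \<beta> l) * multi_partial \<beta> h t = (-1) ^ (\<Sum>l\<in>UNIV. \<beta> l) * F (\<lambda>l. 1 + \<beta> l) t"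
        using derivative_family_multi_partial[OF fam h t] by simp
      also have "\<dots> = (\<integral>r. (-1) ^ (\<beta> 1 + \<beta> 2) * (incr_jet i (Suc (\<beta> 1)) (t $ 1) r * incr_jet j (Suc (\<beta> 2)) (t $ 2) r) \<partial>N)"
        unfolding F_def by (simp add: two \<theta>_def UNIV_2)
      also have "\<dots> \<ge> 0"
      proof (rule integral_nonneg_AE)
        show "AE r in N. 0 \<le> (-1) ^ (\<beta> 1 + \<beta> 2) * (incr_jet i (Suc (\<beta> 1)) (t $ 1) r * incr_jet j (Suc (\<beta> 2)) (t $ 2) r)"
          using orth
        proof eventually_elim
          case (elim r)
          show ?case using mult_nonneg_nonneg[OF sign[OF elim, of "\<beta> 1" i "t $ 1"] sign[OF elim, of "\<beta> 2" j "t $ 2"]]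
            by (simp add: power_add mult_ac)
        qed
      qed
      finally show "0 \<le> (-1) ^ (\<Sum>l\<in>UNIV. \<beta> l) * multi_partial \<beta> h t" .
    qed
    then show "completely_monotone (multi_partial (\<lambda>l. if l \<in> A then 1 else 0) (edge_function M i j))" by (simp add: h_def)
  qed
qed

lemma edge_function_bdry_one:
  assumes "s \<in> orthant_bdry 1"
  shows "edge_function M i j s = 0"
proof -
  have s: "s \<in> orthant" "card {i. 0 < s $ i} \<le> 1" using assms by (auto simp: orthant_bdry_def)
  have "s $ 1 = 0 \<or> s $ 2 = 0"
  proof (rule ccontr)
    assume "\<not> (s $ 1 = 0 \<or> s $ 2 = 0)"
    then have "{1, 2} \<subseteq> {i. 0 < s $ i}" using s(1) by (auto simp: orthant_def less_le)
    then have "card {1, 2 :: 2} \<le> card {i. 0 < s $ i}" by (intro card_mono) auto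
    then show False using s(2) by simp
  qed
  then show ?thesis by (auto simp: edge_function_def)
qed

lemma represents_iff:
  "represents \<psi> \<eta> g \<longleftrightarrow>
     (\<forall>i j. i < j \<longrightarrow> bernstein 2 (\<psi> i j) \<and> (\<forall>s\<in>orthant_bdry 1. \<psi> i j s = 0)) \<and>
     finite_measure \<eta> \<and> sets \<eta> = sets (restrict_space borel Omega) \<and>
     (\<forall>t\<in>orthant. integrable \<eta> (\<lambda>r. base_kernel r t * weight r) \<and>
        g t = (\<Sum>(i, j) | i < j. \<psi> i j (vector [t $ i, t $ j])) + (\<integral>r. base_kernel r t * weight r \<partial>\<eta>))"
  by (simp add: represents_def Let_def base_kernel_def weight_def)

text \<open>
  The part of \<open>\<rho> i j\<close> outside \<open>Omega\<close> gives \<open>\<psi> i j\<close>, and \<open>S\<close>, rescaled, becomes \<open>\<eta>\<close>.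
\<close>

theorem represents_if_difference_system:
  fixes g :: "real^'n::{finite,linorder} \<Rightarrow> real"
  assumes sys: "difference_system g \<rho> S" and bdry: "\<forall>t\<in>orthant_bdry 1. g t = 0"
  shows "represents (\<lambda>i j. edge_function (\<rho> i j) i j) (bulk_measure S) g"
  unfolding represents_iff
proof (intro conjI allI impI ballI)
  fix i j :: 'n assume "i < j"
  then have ij: "i \<noteq> j" by simp
  show "bernstein 2 (edge_function (\<rho> i j) i j)" by (rule bernstein_edge_function[OF system_\<rho>(1)[OF sys ij]])
  show "edge_function (\<rho> i j) i j s = 0" if "s \<in> orthant_bdry 1" for s by (rule edge_function_bdry_one[OF that])
next
  note bulk = bulk_measure_props(1,2)[OF system_S(1)[OF sys]]
  show "finite_measure (bulk_measure S)" "sets (bulk_measure S) = sets (restrict_space borel Omega)" by (rule bulk)+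
  fix t :: "(real, 'n) vec" assume t: "t \<in> orthant"
  show "integrable (bulk_measure S) (\<lambda>r. base_kernel r t * weight r)"
    "g t = (\<Sum>(i, j) | i < j. edge_function (\<rho> i j) i j (vector [t $ i, t $ j])) + (\<integral>r. base_kernel r t * weight r \<partial>bulk_measure S)"
    by (rule system_represents[OF sys bdry t])+
qed

text \<open>
  Each term of the pair decomposition is an integral of a product of one-variable kernels: exponentials in the
  coordinates before \<open>i\<close>, increments in \<open>i\<close> and \<open>j\<close>, and constants elsewhere.
\<close>

lemma system_smooth:
  fixes g :: "real^'n::{finite,linorder} \<Rightarrow> real"
  assumes sys: "difference_system g \<rho> S" and bdry: "\<forall>t\<in>orthant_bdry 1. g t = 0"
  shows "smooth_on pos_orthant g"
proof -
  define \<theta> :: "'n \<times> 'n \<Rightarrow> 'n \<Rightarrow> nat \<Rightarrow> real \<Rightarrow> (real, 'n) vec \<Rightarrow> real" where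
    "\<theta> = (\<lambda>(i, j) l. if l < i then exp_jet l else if l = i then incr_jet i else if l = j then incr_jet j else const_jet)"
  define F where "F p \<alpha> t = (\<integral>r. (\<Prod>l\<in>UNIV. \<theta> p l (\<alpha> l) (t $ l) r) \<partial>\<rho> (fst p) (snd p))" for p \<alpha> and t :: "(real, 'n) vec"
  have fam: "derivative_family (\<lambda>\<alpha> t. \<Sum>p\<in>{(i, j). i < j}. F p \<alpha> t)"
  proof (rule derivative_family_sum)
    fix p :: "'n \<times> 'n" assume "p \<in> {(i, j). i < j}"
    then have M: "orthant_measure (\<rho> (fst p) (snd p))" using system_\<rho>(1)[OF sys] by auto
    then have fin: "finite_measure (\<rho> (fst p) (snd p))" and sets: "sets (\<rho> (fst p) (snd p)) = sets borel" and orth: "AE r in \<rho> (fst p) (snd p). r \<in> orthant"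
      by (simp_all add: orthant_measure_def)
    have "jet_kernel (\<rho> (fst p) (snd p)) orthant (\<theta> p l)" for l
      using jet_kernel_exp[OF sets] jet_kernel_incr[OF sets] jet_kernel_const by (auto simp: \<theta>_def split: prod.split)
    then show "derivative_family (F p)" unfolding F_def by (rule derivative_family_integral[OF fin orth])
  qed
  have "g t = (\<Sum>p\<in>{(i, j). i < j}. F p (\<lambda>_. 0) t)" if "t \<in> pos_orthant" for t
  proof -
    have t: "t \<in> orthant" using pos_orthant_subset[OF that] .
    have "g t = (\<Sum>(i, j) | i < j. dint (dirac (cut {..<i} t) * (step i (t $ i) * step j (t $ j))) g)"
      by (rule pair_decomposition[OF _ t]) (use bdry in auto)
    also have "\<dots> = (\<Sum>p\<in>{(i, j). i < j}. F p (\<lambda>_. 0) t)"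
    proof (intro sum.cong refl, clarify)
      fix i j :: 'n assume ij: "i < j"
      have prod: "(\<Prod>l\<in>UNIV. \<theta> (i, j) l 0 (t $ l) r) = exp (- (r \<bullet> cut {..<i} t)) * (incr (t $ i) (r $ i) * incr (t $ j) (r $ j))" for r
      proof -
        have "(\<Prod>l\<in>UNIV. \<theta> (i, j) l 0 (t $ l) r)
          = (\<Prod>l\<in>UNIV. exp (- (r $ l * cut {..<i} t $ l)) * ((if l = i then incr (t $ i) (r $ i) else 1) * (if l = j then incr (t $ j) (r $ j) else 1)))"
          using ij by (intro prod.cong refl) (auto simp: \<theta>_def exp_jet_def incr_jet_def const_jet_def cut_def)
        then show ?thesis by (simp add: prod.distrib exp_inner_eq_prod)
      qed
      show "dint (dirac (cut {..<i} t) * (step i (t $ i) * step j (t $ j))) g = F (i, j) (\<lambda>_. 0) t"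
        unfolding F_def prod fst_conv snd_conv
        by (rule system_\<rho>(2)[OF sys]) (use ij t cut_in_orthant[OF t] in \<open>auto simp: orthant_def\<close>)
    qed
    finally show ?thesis .
  qed
  then show ?thesis by (rule derivative_family_smooth[OF fam])
qed


section \<open>Energies of the representing kernels\<close>

lemma dist_energy_add: "dist_energy d (\<lambda>t. f t + h t) \<mu> = dist_energy d f \<mu> + dist_energy d h \<mu>"
  by (simp add: dist_energy_def dint_fun_add)

lemma dist_energy_diff: "dist_energy d (\<lambda>t. f t - h t) \<mu> = dist_energy d f \<mu> - dist_energy d h \<mu>"
  by (simp add: dist_energy_def dint_fun_diff)

lemma dist_energy_sum: "dist_energy d (\<lambda>t. \<Sum>a\<in>I. f a t) \<mu> = (\<Sum>a\<in>I. dist_energy d (f a) \<mu>)"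
  by (simp add: dist_energy_def dint_fun_sum)

lemma dist_energy_mult: "dist_energy d (\<lambda>t. c * f t) \<mu> = c * dist_energy d f \<mu>"
  by (simp add: dist_energy_def dint_fun_mult)

lemma dist_energy_cong:
  assumes "\<And>t. t \<in> orthant \<Longrightarrow> f t = h t"
  shows "dist_energy d f \<mu> = dist_energy d h \<mu>"
  unfolding dist_energy_def by (intro dint_cong assms sqdists_in_orthant)

lemma dist_energy_integral:
  assumes "\<And>t. t \<in> orthant \<Longrightarrow> integrable M (\<lambda>r. k r t)"
  shows "dist_energy d (\<lambda>t. \<integral>r. k r t \<partial>M) \<mu> = (\<integral>r. dist_energy d (k r) \<mu> \<partial>M)"
  using assms[OF sqdists_in_orthant] unfolding dist_energy_eq_sum
  by (simp add: Bochner_Integration.integral_sum)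

lemma dist_energy_gaussian:
  assumes "r \<in> orthant"
  shows "0 \<le> dist_energy d (\<lambda>t. exp (- (r \<bullet> t))) \<mu>"
  unfolding dist_energy_eq_sum
  using psd_kernel_gaussian[OF assms, of d] by (auto simp: psd_kernel_def)

lemma dist_energy_coordinate:
  fixes \<mu> :: "('n::finite \<Rightarrow> nat \<Rightarrow> real) dmeasure"
  assumes \<mu>: "\<mu> \<in> M_space 2 (\<lambda>_. Rd d)"
  shows "dist_energy d (\<lambda>t. f (t $ i)) \<mu> = 0"
proof -
  have "dint \<mu> (\<lambda>u. f (sqdists d u v $ i)) = 0" for v
    unfolding sqdists_nth using M_space_two_annihilates[OF \<mu>, of "\<lambda>x. f (\<Sum>l<d. (x l - v i l)\<^sup>2)" i] .
  then show ?thesis by (simp add: dist_energy_def) (simp add: dint_def)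
qed

lemma dist_energy_base_kernel:
  fixes \<mu> :: "('n::finite \<Rightarrow> nat \<Rightarrow> real) dmeasure"
  assumes \<mu>: "\<mu> \<in> M_space 2 (\<lambda>_. Rd d)" and r: "r \<in> orthant"
  shows "0 \<le> dist_energy d (base_kernel r) \<mu>"
proof -
  have "dist_energy d (base_kernel r) \<mu> = dist_energy d (\<lambda>t. exp (- (r \<bullet> t))) \<mu>
     - (\<Sum>i\<in>UNIV. dist_energy d (\<lambda>t. exp (- (r $ i * t $ i))) \<mu>) + dist_energy d (\<lambda>t. real CARD('n) - 1) \<mu>"
    unfolding base_kernel_def add_diff_eq[symmetric] dist_energy_add dist_energy_diff dist_energy_sum ..
  also have "\<dots> = dist_energy d (\<lambda>t. exp (- (r \<bullet> t))) \<mu>"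
    using dist_energy_coordinate[OF \<mu>, of "\<lambda>x. exp (- (r $ _ * x))"] dist_energy_coordinate[OF \<mu>, of "\<lambda>_. real CARD('n) - 1"] by simp
  finally show ?thesis using dist_energy_gaussian[OF r] by simp
qed

text \<open>
  For \<open>a, b > 0\<close> the kernel is a positive multiple of a Gaussian plus functions of one coordinate, whose energy is
  zero.  The remaining cases are limits.
\<close>

lemma dist_energy_incr:
  fixes \<mu> :: "('n::finite \<Rightarrow> nat \<Rightarrow> real) dmeasure"
  assumes \<mu>: "\<mu> \<in> M_space 2 (\<lambda>_. Rd d)" and ij: "i \<noteq> j" and ab: "0 \<le> a" "0 \<le> b"
  shows "0 \<le> dist_energy d (\<lambda>t. incr (t $ i) a * incr (t $ j) b) \<mu>"
proof -
  have pos: "0 \<le> dist_energy d (\<lambda>t. incr (t $ i) a * incr (t $ j) b) \<mu>" if "0 < a" "0 < b" for a b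
  proof -
    define c where "c = 1 / ((1 - exp (- a)) * (1 - exp (- b)))"
    have c: "0 \<le> c" using that by (simp add: c_def)
    define r :: "real^'n" where "r = axis i a + axis j b"
    have r: "r \<in> orthant" using that by (auto simp: r_def orthant_def axis_def)
    have inner: "r \<bullet> t = a * t $ i + b * t $ j" for t
      unfolding r_def by (simp add: inner_add_left inner_commute[of "axis _ _"] inner_axis mult.commute)
    have "incr (t $ i) a * incr (t $ j) b = c * (exp (- (r \<bullet> t)) - exp (- (t $ i * a)) - exp (- (t $ j * b)) + 1)" for t
    proof -
      have "incr (t $ i) a * incr (t $ j) b = c * ((1 - exp (- (t $ i * a))) * (1 - exp (- (t $ j * b))))"
        using that by (simp add: incr_def c_def)
      also have "(1 - exp (- (t $ i * a))) * (1 - exp (- (t $ j * b))) = exp (- (r \<bullet> t)) - exp (- (t $ i * a)) - exp (- (t $ j * b)) + 1"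
      proof -
        have "exp (- (r \<bullet> t)) = exp (- (t $ i * a)) * exp (- (t $ j * b))" by (simp add: inner mult_exp_exp mult.commute)
        then show ?thesis by (simp add: algebra_simps)
      qed
      finally show ?thesis .
    qed
    then have "dist_energy d (\<lambda>t. incr (t $ i) a * incr (t $ j) b) \<mu>
      = c * (dist_energy d (\<lambda>t. exp (- (r \<bullet> t))) \<mu> - dist_energy d (\<lambda>t. exp (- (t $ i * a))) \<mu> - dist_energy d (\<lambda>t. exp (- (t $ j * b))) \<mu> + dist_energy d (\<lambda>t. 1) \<mu>)"
      by (simp only: dist_energy_mult dist_energy_add dist_energy_diff)
    also have "\<dots> = c * dist_energy d (\<lambda>t. exp (- (r \<bullet> t))) \<mu>"
      using dist_energy_coordinate[OF \<mu>, of "\<lambda>x. exp (- (x * _))"] dist_energy_coordinate[OF \<mu>, of "\<lambda>_. 1"] by simp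
    finally show ?thesis using c dist_energy_gaussian[OF r, of d \<mu>] by simp
  qed
  have "(\<lambda>m. dist_energy d (\<lambda>t. incr (t $ i) (a + 1 / real (Suc m)) * incr (t $ j) (b + 1 / real (Suc m))) \<mu>)
      \<longlonglongrightarrow> dist_energy d (\<lambda>t. incr (t $ i) a * incr (t $ j) b) \<mu>"
    unfolding dist_energy_eq_sum
    by (intro tendsto_intros incr_limit ab) (use sqdists_in_orthant in \<open>auto simp: orthant_def\<close>)
  moreover have "0 \<le> dist_energy d (\<lambda>t. incr (t $ i) (a + 1 / real (Suc m)) * incr (t $ j) (b + 1 / real (Suc m))) \<mu>" for m
    by (rule pos) (use ab in \<open>auto intro!: add_nonneg_pos\<close>)
  ultimately show ?thesis by (intro LIMSEQ_le_const) auto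
qed

text \<open>
  Energies are finite sums, so they can be taken under the integrals of the representation.
\<close>

theorem PDI_if_difference_system:
  fixes g :: "real^'n::{finite,linorder} \<Rightarrow> real"
  assumes sys: "difference_system g \<rho> S" and bdry: "\<forall>t\<in>orthant_bdry 1. g t = 0"
  shows "PDI 2 g"
  unfolding PDI_two_iff
proof (intro allI impI ballI)
  fix d :: nat and \<mu> :: "('n \<Rightarrow> nat \<Rightarrow> real) dmeasure"
  assume "1 \<le> d" and \<mu>: "\<mu> \<in> M_space 2 (\<lambda>_. Rd d)"
  note rep = system_represents[OF sys bdry]
  have "dist_energy d g \<mu> = dist_energy d (\<lambda>t. (\<Sum>(i, j) | i < j. edge_function (\<rho> i j) i j (vector [t $ i, t $ j])) + (\<integral>r. base_kernel r t * weight r \<partial>bulk_measure S)) \<mu>"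
    by (rule dist_energy_cong) (rule rep(2))
  also have "\<dots> = (\<Sum>(i, j) | i < j. dist_energy d (\<lambda>t. edge_function (\<rho> i j) i j (vector [t $ i, t $ j])) \<mu>)
     + dist_energy d (\<lambda>t. \<integral>r. base_kernel r t * weight r \<partial>bulk_measure S) \<mu>"
    unfolding dist_energy_add by (simp add: dist_energy_sum case_prod_beta)
  also have "0 \<le> \<dots>"
  proof (intro add_nonneg_nonneg sum_nonneg)
    fix p :: "'n \<times> 'n" assume p: "p \<in> {(i, j). i < j}"
    obtain i j where ij: "p = (i, j)" "i < j" using p by auto
    have ne: "i \<noteq> j" using ij(2) by simp
    have M: "orthant_measure (\<rho> i j)" by (rule system_\<rho>(1)[OF sys ne])
    have "dist_energy d (\<lambda>t. edge_function (\<rho> i j) i j (vector [t $ i, t $ j])) \<mu>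
      = (\<integral>r. dist_energy d (\<lambda>t. indicator (- Omega) r * (incr (t $ i) (r $ i) * incr (t $ j) (r $ j))) \<mu> \<partial>\<rho> i j)"
      unfolding edge_function_def vector_2
    proof (rule dist_energy_integral)
      fix t :: "(real, 'n) vec" assume t: "t \<in> orthant"
      have t0: "0 \<le> t $ i" "0 \<le> t $ j" using t by (auto simp: orthant_def)
      show "integrable (\<rho> i j) (\<lambda>r. indicator (- Omega) r * (incr (t $ i) (r $ i) * incr (t $ j) (r $ j)))"
      proof (rule orthant_measure_integrable[OF M, of _ "(t $ i + 1) * (t $ j + 1)"])
        show "(\<lambda>r :: (real, 'n) vec. indicator (- Omega) r * (incr (t $ i) (r $ i) * incr (t $ j) (r $ j))) \<in> borel_measurable borel" by measurable
        show "\<bar>indicator (- Omega) r * (incr (t $ i) (r $ i) * incr (t $ j) (r $ j))\<bar> \<le> (t $ i + 1) * (t $ j + 1)" if "r \<in> orthant" for r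
          using incr_product_bound[OF that t0, of i j] t0 by (cases "r \<in> - Omega") (auto simp: abs_of_nonneg)
      qed
    qed
    also have "0 \<le> \<dots>"
    proof (rule integral_nonneg_AE)
      have "AE r in \<rho> i j. r \<in> orthant" using M by (simp add: orthant_measure_def)
      then show "AE r in \<rho> i j. 0 \<le> dist_energy d (\<lambda>t. indicator (- Omega) r * (incr (t $ i) (r $ i) * incr (t $ j) (r $ j))) \<mu>"
        by eventually_elim (auto simp: dist_energy_mult orthant_def intro!: mult_nonneg_nonneg dist_energy_incr[OF \<mu> ne])
    qed
    finally show "0 \<le> (case p of (i, j) \<Rightarrow> dist_energy d (\<lambda>t. edge_function (\<rho> i j) i j (vector [t $ i, t $ j])) \<mu>)"
      using ij by simp
  next
    have "dist_energy d (\<lambda>t. \<integral>r. base_kernel r t * weight r \<partial>bulk_measure S) \<mu> = (\<integral>r. dist_energy d (\<lambda>t. base_kernel r t * weight r) \<mu> \<partial>bulk_measure S)"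
      by (rule dist_energy_integral) (rule rep(1))
    also have "0 \<le> \<dots>"
    proof (rule integral_nonneg_AE, rule AE_I2)
      fix r assume "r \<in> space (bulk_measure S)"
      then have r: "r \<in> Omega"
        using sets_eq_imp_space_eq[OF bulk_measure_props(2)[OF system_S(1)[OF sys]]] by (simp add: space_restrict_space)
      then have "0 \<le> weight r * dist_energy d (base_kernel r) \<mu>"
        using weight_bounds(1)[OF r] dist_energy_base_kernel[OF \<mu>] by simp
      then show "0 \<le> dist_energy d (\<lambda>t. base_kernel r t * weight r) \<mu>"
        by (simp add: dist_energy_mult mult.commute[of "base_kernel r _"])
    qed
    finally show "0 \<le> dist_energy d (\<lambda>t. \<integral>r. base_kernel r t * weight r \<partial>bulk_measure S) \<mu>" .
  qed
  finally show "0 \<le> dist_energy d g \<mu>" .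
qed

section \<open>From the representation back to differences\<close>

text \<open>
  A function that does not depend on the coordinate \<open>k\<close> is annihilated by every step in direction \<open>k\<close>.
\<close>

lemma dint_steps_invariant:
  assumes k: "k \<in> fst ` set L" and f: "\<And>x s. f (axis k s + x) = f x"
  shows "dint (dirac t * steps L) f = 0"
proof -
  obtain s L1 L2 where L: "L = L1 @ (k, s) # L2" using k by (auto simp: in_set_conv_decomp)
  have "steps L = step k s * (steps L1 * steps L2)" by (simp add: L mult_ac)
  moreover have "f (t + (axis k s + x)) = f (t + x)" for x
    using f[of s "t + x"] by (simp add: add_ac)
  ultimately show ?thesis by (simp add: dint_dirac_mult dint_step_mult) (simp add: dint_def)
qed

text \<open>
  Steps in a direction other than \<open>i\<close> and \<open>j\<close> annihilate the lifted function.  If there are none, the steps are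
  steps in the plane, and both directions of the plane occur.
\<close>

lemma lifted_pair_differences:
  fixes \<psi> :: "real^2 \<Rightarrow> real" and t :: "real^'n::finite"
  assumes \<psi>: "bernstein 2 \<psi>" and ij: "i \<noteq> j" and t: "t \<in> pos_orthant" and L: "\<forall>(k, s)\<in>set L. 0 \<le> s"
    and two: "two_coordinates L"
  shows "0 \<le> dint (dirac t * steps L) (\<lambda>t. \<psi> (vector [t $ i, t $ j]))"
proof (cases "fst ` set L \<subseteq> {i, j}")
  case False
  then obtain k where k: "k \<in> fst ` set L" "k \<noteq> i" "k \<noteq> j" by blast
  have "dint (dirac t * steps L) (\<lambda>t. \<psi> (vector [t $ i, t $ j])) = 0"
    by (rule dint_steps_invariant[OF k(1)]) (use k in \<open>simp add: axis_def\<close>)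
  then show ?thesis by simp
next
  case True
  define pr :: "real^'n \<Rightarrow> real^2" where "pr x = vector [x $ i, x $ j]" for x
  define c :: "'n \<Rightarrow> 2" where "c k = (if k = i then 1 else 2)" for k
  have pr_add: "pr (x + y) = pr x + pr y" for x y by (simp add: pr_def vec_eq_iff forall_2)
  have pr_axis: "pr (axis k s) = axis (c k) s" if "k \<in> {i, j}" for k s
    using that ij by (auto simp: pr_def c_def vec_eq_iff forall_2 axis_def)
  have transfer: "dint (steps L) (\<lambda>x. f (pr x)) = dint (steps (map (\<lambda>(k, s). (c k, s)) L)) f"
    if "fst ` set L \<subseteq> {i, j}" for L f
    using that
  proof (induction L arbitrary: f)
    case Nil
    have "pr 0 = 0" by (simp add: pr_def vec_eq_iff forall_2)
    then show ?case by simp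
  next
    case (Cons p L)
    obtain k s where p: "p = (k, s)" by (cases p)
    have "dint (steps (p # L)) (\<lambda>x. f (pr x)) = dint (steps L) (\<lambda>x. f (pr x) - f (axis (c k) s + pr x))"
      using Cons.prems by (simp add: p dint_step_mult pr_add pr_axis)
    also have "\<dots> = dint (steps (map (\<lambda>(k, s). (c k, s)) L)) (\<lambda>x. f x - f (axis (c k) s + x))"
      using Cons by (intro Cons.IH[of "\<lambda>x. f x - f (axis (c k) s + x)"]) auto
    finally show ?case by (simp add: p dint_step_mult)
  qed
  have "dint (dirac t * steps L) (\<lambda>t. \<psi> (pr t)) = dint (dirac (pr t) * steps (map (\<lambda>(k, s). (c k, s)) L)) \<psi>"
    unfolding dint_dirac_mult pr_add using transfer[OF True, of "\<lambda>x. \<psi> (pr t + x)"] .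
  also have "0 \<le> \<dots>"
  proof -
    have "mixed_alternating_pos \<psi>" using \<psi> by (simp add: bernstein_iff_mixed_alternating_pos)
    moreover have "pr t \<in> pos_orthant" using t by (simp add: pr_def pos_orthant_def forall_2)
    moreover have "\<forall>(k, s)\<in>set (map (\<lambda>(k, s). (c k, s)) L). 0 \<le> s" using L by auto
    moreover have "\<exists>k l. k \<noteq> l \<and> k \<in> fst ` set (map (\<lambda>(k, s). (c k, s)) L) \<and> l \<in> fst ` set (map (\<lambda>(k, s). (c k, s)) L)"
    proof -
      have img: "fst ` set (map (\<lambda>(k, s). (c k, s)) L) = c ` (fst ` set L)" by force
      have "i \<in> fst ` set L" "j \<in> fst ` set L" using two True by blast+
      then have "c i \<in> c ` (fst ` set L)" "c j \<in> c ` (fst ` set L)" by blast+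
      moreover have "c i \<noteq> c j" using ij by (simp add: c_def)
      ultimately show ?thesis unfolding img by blast
    qed
    ultimately show ?thesis unfolding mixed_alternating_pos_def by blast
  qed
  finally show ?thesis by (simp add: pr_def)
qed

lemma dint_integral:
  assumes "\<And>t. t \<in> Poly_Mapping.keys y \<Longrightarrow> integrable M (\<lambda>r. k r t)"
  shows "integrable M (\<lambda>r. dint y (k r))" "dint y (\<lambda>t. \<integral>r. k r t \<partial>M) = (\<integral>r. dint y (k r) \<partial>M)"
  using assms unfolding dint_def by (auto simp: Bochner_Integration.integral_sum)

lemma represented_differences:
  fixes g :: "real^'n::{finite,linorder} \<Rightarrow> real"
  assumes rep: "represents \<psi> \<eta> g" and t: "t \<in> orthant" and y: "Poly_Mapping.keys y \<subseteq> orthant"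
    and kernel: "\<And>r. dint (dirac t * y) (base_kernel r) = exp (- (r \<bullet> t)) * exp_transform y r"
  shows "integrable \<eta> (\<lambda>r. exp (- (r \<bullet> t)) * (exp_transform y r * weight r))"
    "dint (dirac t * y) g = (\<Sum>(i, j) | i < j. dint (dirac t * y) (\<lambda>t. \<psi> i j (vector [t $ i, t $ j])))
       + (\<integral>r. exp (- (r \<bullet> t)) * (exp_transform y r * weight r) \<partial>\<eta>)"
proof -
  have keys: "Poly_Mapping.keys (dirac t * y) \<subseteq> orthant"
    by (rule keys_mult_orthant[OF _ y]) (use t in \<open>auto simp: dirac_def\<close>)
  have K: "dint (dirac t * y) (\<lambda>x. base_kernel r x * weight r) = exp (- (r \<bullet> t)) * (exp_transform y r * weight r)" for r
  proof -
    have "dint (dirac t * y) (\<lambda>x. weight r * base_kernel r x) = weight r * (exp (- (r \<bullet> t)) * exp_transform y r)"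
      by (simp only: dint_fun_mult kernel)
    then show ?thesis by (simp only: mult_ac)
  qed
  have int: "integrable \<eta> (\<lambda>r. base_kernel r x * weight r)" if "x \<in> Poly_Mapping.keys (dirac t * y)" for x
    using rep keys that unfolding represents_iff by blast
  show "integrable \<eta> (\<lambda>r. exp (- (r \<bullet> t)) * (exp_transform y r * weight r))"
    using dint_integral(1)[of "dirac t * y" \<eta> "\<lambda>r x. base_kernel r x * weight r", OF int] by (simp only: K)
  have "dint (dirac t * y) g = dint (dirac t * y) (\<lambda>x. (\<Sum>(i, j) | i < j. \<psi> i j (vector [x $ i, x $ j])) + (\<integral>r. base_kernel r x * weight r \<partial>\<eta>))"
    using rep keys unfolding represents_iff by (intro dint_cong) blast
  also have "\<dots> = (\<Sum>(i, j) | i < j. dint (dirac t * y) (\<lambda>t. \<psi> i j (vector [t $ i, t $ j])))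
       + dint (dirac t * y) (\<lambda>x. \<integral>r. base_kernel r x * weight r \<partial>\<eta>)"
    unfolding dint_fun_add by (simp add: dint_fun_sum case_prod_beta)
  also have "dint (dirac t * y) (\<lambda>x. \<integral>r. base_kernel r x * weight r \<partial>\<eta>) = (\<integral>r. exp (- (r \<bullet> t)) * (exp_transform y r * weight r) \<partial>\<eta>)"
    using dint_integral(2)[of "dirac t * y" \<eta> "\<lambda>r x. base_kernel r x * weight r", OF int] by (simp only: K)
  finally show "dint (dirac t * y) g = (\<Sum>(i, j) | i < j. dint (dirac t * y) (\<lambda>t. \<psi> i j (vector [t $ i, t $ j])))
       + (\<integral>r. exp (- (r \<bullet> t)) * (exp_transform y r * weight r) \<partial>\<eta>)" .
qed

lemma exp_transform_steps_nonneg: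
  assumes "r \<in> orthant" "\<forall>(i, s)\<in>set L. 0 \<le> s"
  shows "0 \<le> exp_transform (steps L) r"
  using assms(2)
proof (induction L)
  case (Cons p L)
  then show ?case using assms(1)
    by (cases p) (auto simp: exp_transform_mult orthant_def intro!: mult_nonneg_nonneg)
qed simp

theorem mixed_alternating_if_represents:
  fixes g :: "real^'n::{finite,linorder} \<Rightarrow> real"
  assumes cont: "continuous_on orthant g" and rep: "represents \<psi> \<eta> g"
  shows "mixed_alternating g"
  unfolding mixed_alternating_pos_iff[OF cont, symmetric] mixed_alternating_pos_def
proof (intro ballI allI impI)
  fix t :: "(real, 'n) vec" and L :: "('n \<times> real) list"
  assume t: "t \<in> pos_orthant" and L: "\<forall>(i, s)\<in>set L. 0 \<le> s" and two: "two_coordinates L"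
  have "dint (dirac t * steps L) g = (\<Sum>(i, j) | i < j. dint (dirac t * steps L) (\<lambda>t. \<psi> i j (vector [t $ i, t $ j])))
       + (\<integral>r. exp (- (r \<bullet> t)) * (exp_transform (steps L) r * weight r) \<partial>\<eta>)"
    by (rule represented_differences(2)[OF rep pos_orthant_subset[OF t] keys_steps[OF L] base_kernel_differences[OF two]])
  also have "0 \<le> \<dots>"
  proof (intro add_nonneg_nonneg sum_nonneg)
    fix p :: "'n \<times> 'n" assume "p \<in> {(i, j). i < j}"
    then obtain i j where ij: "p = (i, j)" "i < j" by auto
    have b: "bernstein 2 (\<psi> i j)" using rep ij(2) unfolding represents_iff by blast
    have "0 \<le> dint (dirac t * steps L) (\<lambda>t. \<psi> i j (vector [t $ i, t $ j]))"
      by (rule lifted_pair_differences[OF b _ t L two]) (use ij in simp)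
    then show "0 \<le> (case p of (i, j) \<Rightarrow> dint (dirac t * steps L) (\<lambda>t. \<psi> i j (vector [t $ i, t $ j])))" using ij by simp
  next
    have "sets \<eta> = sets (restrict_space borel Omega)" using rep unfolding represents_iff by blast
    then have sp: "space \<eta> = Omega" by (simp add: sets_eq_imp_space_eq space_restrict_space)
    show "0 \<le> (\<integral>r. exp (- (r \<bullet> t)) * (exp_transform (steps L) r * weight r) \<partial>\<eta>)"
    proof (rule integral_nonneg_AE, rule AE_I2)
      fix r assume "r \<in> space \<eta>"
      then have r: "r \<in> Omega" by (simp only: sp)
      then have "0 \<le> exp_transform (steps L) r" "0 < weight r"
        using exp_transform_steps_nonneg[OF _ L, of r] weight_bounds(1)[OF r] by auto
      then show "0 \<le> exp (- (r \<bullet> t)) * (exp_transform (steps L) r * weight r)" by simp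
    qed
  qed
  finally show "0 \<le> dint (dirac t * steps L) g" .
qed

section \<open>Uniqueness\<close>

text \<open>
  Differences in three different directions annihilate every function of two coordinates, so they isolate the
  integral in the representation; the sum over all triples has a transform that is positive on all of \<open>Omega\<close>.
\<close>

definition triple_steps :: "(real^'n::finite) dmeasure" where
  "triple_steps = (\<Sum>F | card F = 3. \<Prod>k\<in>F. step k 1)"

lemma exp_transform_triple_steps: "exp_transform triple_steps r = elem_sym 3 (decay r)"
  by (simp add: triple_steps_def exp_transform_sum exp_transform_prod elem_sym_def)

lemma prod_steps_list: "finite F \<Longrightarrow> \<exists>L. steps L = (\<Prod>k\<in>F. step k 1) \<and> fst ` set L = F \<and> (\<forall>(i, s)\<in>set L. 0 \<le> s)"
proof (induction F rule: finite_induct)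
  case empty
  show ?case by (intro exI[of _ "[]"]) simp
next
  case (insert k F)
  then obtain L where "steps L = (\<Prod>k\<in>F. step k 1)" "fst ` set L = F" "\<forall>(i, s)\<in>set L. 0 \<le> s" by blast
  then show ?case using insert by (intro exI[of _ "(k, 1) # L"]) auto
qed

lemma triple_obtain:
  assumes "card F = 3"
  obtains k where "k \<in> F" "k \<noteq> i" "k \<noteq> j"
proof -
  have "\<not> F \<subseteq> {i, j}"
  proof
    assume "F \<subseteq> {i, j}"
    then have "card F \<le> card {i, j}" by (intro card_mono) auto
    also have "\<dots> \<le> 2" by (simp add: card_insert_if)
    finally show False using assms by simp
  qed
  then show thesis using that by blast
qed

lemma represented_triple_differences:
  fixes g :: "real^'n::{finite,linorder} \<Rightarrow> real"
  assumes rep: "represents \<psi> \<eta> g" and t: "t \<in> orthant"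
  shows "integrable \<eta> (\<lambda>r. exp (- (r \<bullet> t)) * (elem_sym 3 (decay r) * weight r))"
    "dint (dirac t * triple_steps) g = (\<integral>r. exp (- (r \<bullet> t)) * (elem_sym 3 (decay r) * weight r) \<partial>\<eta>)"
proof -
  have "\<forall>F. \<exists>L. finite F \<longrightarrow> steps L = (\<Prod>k\<in>F. step k 1 :: (real, 'n) vec dmeasure) \<and> fst ` set L = F \<and> (\<forall>(i, s)\<in>set L. 0 \<le> s)"
    using prod_steps_list by blast
  then obtain L where L: "\<And>F. steps (L F) = (\<Prod>k\<in>F. step k 1 :: (real, 'n) vec dmeasure)" "\<And>F. fst ` set (L F) = F" "\<And>F. \<forall>(i, s)\<in>set (L F). 0 \<le> s"
    by (metis finite)
  have triple: "triple_steps = (\<Sum>F | card F = 3. steps (L F))" by (simp only: triple_steps_def L(1))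
  have sum: "dint (dirac t * triple_steps) f = (\<Sum>F | card F = 3. dint (dirac t * steps (L F)) f)" for f :: "(real, 'n) vec \<Rightarrow> real"
    by (simp add: triple sum_distrib_left dint_sum)
  have keys: "Poly_Mapping.keys triple_steps \<subseteq> (orthant :: (real, 'n) vec set)"
    unfolding triple by (rule order_trans[OF keys_sum], rule UN_least, rule keys_steps[OF L(3)])
  have kernel: "dint (dirac t * triple_steps) (base_kernel r) = exp (- (r \<bullet> t)) * exp_transform triple_steps r" for r :: "(real, 'n) vec"
  proof -
    have "dint (dirac t * steps (L F)) (base_kernel r) = exp (- (r \<bullet> t)) * exp_transform (steps (L F)) r" if F: "card F = 3" for F
    proof (rule base_kernel_differences)
      obtain k where "k \<in> F" by (rule triple_obtain[OF F])
      moreover obtain l where "l \<in> F" "l \<noteq> k" by (rule triple_obtain[OF F])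
      ultimately show "\<exists>i j. i \<noteq> j \<and> i \<in> fst ` set (L F) \<and> j \<in> fst ` set (L F)" unfolding L(2) by blast
    qed
    then show ?thesis unfolding sum by (simp add: triple exp_transform_sum sum_distrib_left)
  qed
  note diff = represented_differences[OF rep t keys kernel, unfolded exp_transform_triple_steps]
  show "integrable \<eta> (\<lambda>r. exp (- (r \<bullet> t)) * (elem_sym 3 (decay r) * weight r))" by (rule diff(1))
  have "dint (dirac t * triple_steps) (\<lambda>t. \<psi> i j (vector [t $ i, t $ j])) = 0" for i j
    unfolding sum
  proof (rule sum.neutral, clarify)
    fix F :: "'n set" assume F: "card F = 3"
    obtain k where k: "k \<in> F" "k \<noteq> i" "k \<noteq> j" by (rule triple_obtain[OF F])
    show "dint (dirac t * steps (L F)) (\<lambda>t. \<psi> i j (vector [t $ i, t $ j])) = 0"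
      by (rule dint_steps_invariant[of k]) (use k in \<open>auto simp: L(2) axis_def\<close>)
  qed
  then show "dint (dirac t * triple_steps) g = (\<integral>r. exp (- (r \<bullet> t)) * (elem_sym 3 (decay r) * weight r) \<partial>\<eta>)"
    using diff(2) by (simp add: case_prod_beta)
qed

text \<open>
  The measure \<open>u \<cdot> \<eta>\<close> with \<open>u = elem_sym 3 (decay r) * weight r\<close> is finite and has a Laplace transform
  that depends on \<open>g\<close> only.  Since \<open>u\<close> is positive on \<open>Omega\<close>, \<open>\<eta>\<close> can be recovered from it.
\<close>

lemma represents_measure_unique:
  fixes g :: "real^'n::{finite,linorder} \<Rightarrow> real"
  assumes rep: "represents \<psi> \<eta> g" "represents \<psi>' \<eta>' g"
  shows "\<eta> = \<eta>'"
proof -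
  define u where "u r = elem_sym 3 (decay r) * weight r" for r :: "(real, 'n) vec"
  have [measurable]: "u \<in> borel_measurable borel" unfolding u_def by measurable
  have upos: "0 < u r" if "r \<in> Omega" for r
    unfolding u_def using Omega_elem_sym_pos(2)[OF that, of 3] weight_bounds(1)[OF that] by simp
  define N where "N \<zeta> = distr (density \<zeta> (\<lambda>r. ennreal (u r))) borel (\<lambda>r. r)" for \<zeta> :: "(real, 'n) vec measure"
  have facts: "finite_measure (N \<zeta>)" "AE r in N \<zeta>. r \<in> orthant"
      "\<And>t. t \<in> orthant \<Longrightarrow> (\<integral>r. exp (- (r \<bullet> t)) \<partial>N \<zeta>) = dint (dirac t * triple_steps) g"
      "\<And>A. A \<in> sets \<zeta> \<Longrightarrow> emeasure (density \<zeta> (\<lambda>r. ennreal (u r))) A = emeasure (N \<zeta>) A"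
      "density (density \<zeta> (\<lambda>r. ennreal (u r))) (\<lambda>r. ennreal (1 / u r)) = \<zeta>"
    if r: "represents \<phi> \<zeta> g" for \<phi> \<zeta>
  proof -
    have sets: "sets \<zeta> = sets (restrict_space borel Omega)" using r unfolding represents_iff by blast
    note [measurable_cong] = sets
    have sp: "space \<zeta> = Omega" using sets by (simp add: sets_eq_imp_space_eq space_restrict_space)
    have Om: "Omega \<in> sets (borel :: (real, 'n) vec measure)" by measurable
    have meas: "f \<in> borel_measurable \<zeta>" if "f \<in> borel_measurable borel" for f :: "(real, 'n) vec \<Rightarrow> real"
      using measurable_restrict_space1[OF that, of Omega] by (simp cong: measurable_cong_sets add: sets)
    have um: "u \<in> borel_measurable \<zeta>" by (rule meas) measurable
    have id: "(\<lambda>r. r) \<in> \<zeta> \<rightarrow>\<^sub>M (borel :: (real, 'n) vec measure)"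
      using measurable_restrict_space1[OF measurable_ident[of borel], of Omega] by (simp cong: measurable_cong_sets add: sets id_def)
    then have id': "(\<lambda>r. r) \<in> density \<zeta> (\<lambda>r. ennreal (u r)) \<rightarrow>\<^sub>M (borel :: (real, 'n) vec measure)" by simp
    have nn: "AE r in \<zeta>. 0 \<le> u r" by (rule AE_I2) (use upos sp in \<open>auto intro: less_imp_le\<close>)
    have int: "integrable \<zeta> u"
      using represented_triple_differences(1)[OF r, of 0] by (simp add: u_def[abs_def] orthant_def)
    have "emeasure (density \<zeta> (\<lambda>r. ennreal (u r))) (space \<zeta>) = (\<integral>\<^sup>+ r. ennreal (u r) * indicator (space \<zeta>) r \<partial>\<zeta>)"
      by (rule emeasure_density[OF measurable_compose[OF um measurable_ennreal] sets.top])
    also have "\<dots> = (\<integral>\<^sup>+ r. ennreal (u r) \<partial>\<zeta>)" by (rule nn_integral_cong) simp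
    also have "\<dots> = ennreal (integral\<^sup>L \<zeta> u)" by (rule nn_integral_eq_integral[OF int nn])
    finally have "finite_measure (density \<zeta> (\<lambda>r. ennreal (u r)))" by (intro finite_measureI) simp
    then show "finite_measure (N \<zeta>)" unfolding N_def by (rule finite_measure.finite_measure_distr[OF _ id'])
    show "AE r in N \<zeta>. r \<in> orthant"
      unfolding N_def by (subst AE_distr_iff[OF id']) (auto intro!: AE_I2 simp: sp)
    show "(\<integral>r. exp (- (r \<bullet> t)) \<partial>N \<zeta>) = dint (dirac t * triple_steps) g" if t: "t \<in> orthant" for t
    proof -
      have em: "(\<lambda>r :: (real, 'n) vec. exp (- (r \<bullet> t))) \<in> borel_measurable borel" by measurable
      have "(\<integral>r. exp (- (r \<bullet> t)) \<partial>N \<zeta>) = (\<integral>r. u r *\<^sub>R exp (- (r \<bullet> t)) \<partial>\<zeta>)"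
        unfolding N_def by (subst integral_distr[OF id' em], rule integral_density[OF meas[OF em] um nn])
      also have "\<dots> = (\<integral>r. exp (- (r \<bullet> t)) * (elem_sym 3 (decay r) * weight r) \<partial>\<zeta>)"
        by (simp add: u_def mult.commute)
      finally show ?thesis using represented_triple_differences(2)[OF r t] by simp
    qed
    show "emeasure (density \<zeta> (\<lambda>r. ennreal (u r))) A = emeasure (N \<zeta>) A" if A: "A \<in> sets \<zeta>" for A
    proof -
      have "A \<in> sets borel" "A \<subseteq> Omega" using A Om unfolding sets by (auto simp: sets_restrict_space_iff)
      then show ?thesis unfolding N_def by (subst emeasure_distr[OF id']) (auto simp: sp Int_absorb2)
    qed
    have vm: "(\<lambda>r. ennreal (1 / u r)) \<in> borel_measurable \<zeta>"
      by (rule measurable_compose[OF meas measurable_ennreal]) measurable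
    have "density (density \<zeta> (\<lambda>r. ennreal (u r))) (\<lambda>r. ennreal (1 / u r)) = density \<zeta> (\<lambda>r. ennreal (u r) * ennreal (1 / u r))"
      by (rule density_density_eq[OF measurable_compose[OF um measurable_ennreal] vm])
    also have "\<dots> = density \<zeta> (\<lambda>_. 1)"
    proof (rule density_cong)
      show "AE r in \<zeta>. ennreal (u r) * ennreal (1 / u r) = 1"
      proof (rule AE_I2)
        fix r assume "r \<in> space \<zeta>"
        then have "0 < u r" using upos sp by auto
        then show "ennreal (u r) * ennreal (1 / u r) = 1" by (simp flip: ennreal_mult)
      qed
    qed (use measurable_compose[OF um measurable_ennreal] vm in measurable)
    also have "\<dots> = \<zeta>" by (rule density_1)
    finally show "density (density \<zeta> (\<lambda>r. ennreal (u r))) (\<lambda>r. ennreal (1 / u r)) = \<zeta>" .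
  qed
  have "N \<eta> = N \<eta>'"
  proof (rule laplace_uniqueness)
    show "finite_measure (N \<eta>)" "finite_measure (N \<eta>')" using facts(1)[OF rep(1)] facts(1)[OF rep(2)] .
    show "sets (N \<eta>) = sets borel" "sets (N \<eta>') = sets borel" by (simp_all add: N_def)
    show "AE r in N \<eta>. r \<in> orthant" "AE r in N \<eta>'. r \<in> orthant" using facts(2)[OF rep(1)] facts(2)[OF rep(2)] .
    show "(\<integral>r. exp (- (r \<bullet> t)) \<partial>N \<eta>) = (\<integral>r. exp (- (r \<bullet> t)) \<partial>N \<eta>')" if "t \<in> orthant" for t
      using facts(3)[OF rep(1) that] facts(3)[OF rep(2) that] by simp
  qed
  have s: "sets \<eta> = sets \<eta>'" using rep unfolding represents_iff by simp
  have same: "density \<eta> (\<lambda>r. ennreal (u r)) = density \<eta>' (\<lambda>r. ennreal (u r))"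
  proof (rule measure_eqI)
    fix A assume "A \<in> sets (density \<eta> (\<lambda>r. ennreal (u r)))"
    then have A: "A \<in> sets \<eta>" "A \<in> sets \<eta>'" using s by simp_all
    show "emeasure (density \<eta> (\<lambda>r. ennreal (u r))) A = emeasure (density \<eta>' (\<lambda>r. ennreal (u r))) A"
      unfolding facts(4)[OF rep(1) A(1)] facts(4)[OF rep(2) A(2)] \<open>N \<eta> = N \<eta>'\<close> ..
  qed (simp add: s)
  show ?thesis
    by (rule trans[OF facts(5)[OF rep(1), symmetric] trans[OF arg_cong[OF same, of "\<lambda>M. density M (\<lambda>r. ennreal (1 / u r))"] facts(5)[OF rep(2)]]])
qed

text \<open>
  At a point with only the coordinates \<open>i\<close> and \<open>j\<close> switched on, all other functions \<open>\<psi> k l\<close> are evaluated on an axis.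
\<close>

lemma represents_edge_unique:
  fixes g :: "real^'n::{finite,linorder} \<Rightarrow> real"
  assumes rep: "represents \<psi> \<eta> g" "represents \<psi>' \<eta> g" and ij: "i < j" and s: "s \<in> orthant"
  shows "\<psi> i j s = \<psi>' i j s"
proof -
  define t where "t = axis i (s $ 1) + axis j (s $ 2)"
  have s0: "0 \<le> s $ 1" "0 \<le> s $ 2" using s by (auto simp: orthant_def)
  have t: "t \<in> orthant" using s0 by (auto simp: t_def orthant_def axis_def)
  have tk: "t $ k = 0" if "k \<noteq> i" "k \<noteq> j" for k using that by (simp add: t_def axis_def)
  have tij: "t $ i = s $ 1" "t $ j = s $ 2" using ij by (auto simp: t_def axis_def)
  have sum: "(\<Sum>(k, l) | k < l. \<phi> k l (vector [t $ k, t $ l])) = \<phi> i j s" if r: "represents \<phi> \<eta> g" for \<phi>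
  proof -
    have zero: "\<phi> k l (vector [t $ k, t $ l]) = 0" if kl: "k < l" "(k, l) \<noteq> (i, j)" for k l
    proof -
      have "t $ k = 0 \<or> t $ l = 0" using tk kl ij by (metis less_asym less_irrefl)
      then have "{m. 0 < (vector [t $ k, t $ l] :: real^2) $ m} \<subseteq> {if t $ k = 0 then 2 else 1}"
      proof (intro subsetI)
        fix m assume "m \<in> {m. 0 < (vector [t $ k, t $ l] :: real^2) $ m}"
        then show "m \<in> {if t $ k = 0 then 2 else 1}"
          using exhaust_2[of m] \<open>t $ k = 0 \<or> t $ l = 0\<close> by auto
      qed
      then have "card {m. 0 < (vector [t $ k, t $ l] :: real^2) $ m} \<le> card {if t $ k = 0 then 2 else 1 :: 2}"
        by (intro card_mono) auto
      then have "(vector [t $ k, t $ l] :: real^2) \<in> orthant_bdry 1"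
        using t by (simp add: orthant_bdry_def orthant_def forall_2)
      then show ?thesis using r kl(1) unfolding represents_iff by blast
    qed
    have "(\<Sum>(k, l) | k < l. \<phi> k l (vector [t $ k, t $ l])) = (\<Sum>(k, l)\<in>{(i, j)}. \<phi> k l (vector [t $ k, t $ l]))"
      by (rule sum.mono_neutral_right) (use zero ij in auto)
    moreover have "vector [t $ i, t $ j] = s" by (simp add: vec_eq_iff forall_2 tij)
    ultimately show ?thesis by simp
  qed
  have "g t = \<psi> i j s + (\<integral>r. base_kernel r t * weight r \<partial>\<eta>)" "g t = \<psi>' i j s + (\<integral>r. base_kernel r t * weight r \<partial>\<eta>)"
    using rep t sum[OF rep(1)] sum[OF rep(2)] unfolding represents_iff by auto
  then show ?thesis by simp
qed

theorem theorem6p10: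
  fixes g :: "real^'n::{finite,linorder} \<Rightarrow> real"
  assumes "CARD('n) \<ge> 2"
    and "continuous_on orthant g"
    and "\<forall>t\<in>orthant_bdry 1. g t = 0"
  shows
    "((\<forall>d\<ge>1. \<forall>\<mu> :: 'n \<Rightarrow> (nat \<Rightarrow> real) dmeasure.
          (\<forall>i. \<mu> i \<in> dmeasures_in (Rd d)) \<and> card {i. dmeas (\<mu> i) (Rd d) = 0} \<ge> 2
          \<longrightarrow> dist_energy d g (dprod_meas \<mu>) \<ge> 0)
      \<longleftrightarrow> PDI 2 g) \<and>
     ((\<forall>d\<ge>1. \<forall>P\<in>dprobs_in (Rd_pow d). dist_energy d g (P - dprod_meas (dmarginal P)) \<ge> 0)
      \<longleftrightarrow> PDI 2 g) \<and>
     ((\<exists>\<psi> \<eta>. represents \<psi> \<eta> g) \<longleftrightarrow> PDI 2 g) \<and>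
     (bernstein 2 g \<longleftrightarrow> PDI 2 g) \<and>
     (\<forall>\<psi> \<eta> \<psi>' \<eta>'. represents \<psi> \<eta> g \<and> represents \<psi>' \<eta>' g
          \<longrightarrow> \<eta> = \<eta>' \<and> (\<forall>i j. i < j \<longrightarrow> (\<forall>s\<in>orthant. \<psi> i j s = \<psi>' i j s)))"
    (is "(?products \<longleftrightarrow> _) \<and> (?probs \<longleftrightarrow> _) \<and> (?repr \<longleftrightarrow> _) \<and> (_ \<longleftrightarrow> _) \<and> ?unique")
proof -
  note cont = assms(2) and bdry = assms(3)
  have products_PDI: ?products if "PDI 2 g"
    using that product_in_M_space unfolding PDI_two_iff by blast
  have products_mixed: "mixed_alternating g" if ?products
    by (rule mixed_alternating_if_products) (use that in blast)
  have mixed_PDI: "PDI 2 g" and mixed_repr: ?repr and mixed_smooth: "smooth_on pos_orthant g" if m: "mixed_alternating g"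
  proof -
    obtain \<rho> S where sys: "difference_system g \<rho> S" by (rule difference_system_exists[OF cont m])
    show "PDI 2 g" by (rule PDI_if_difference_system[OF sys bdry])
    show ?repr using represents_if_difference_system[OF sys bdry] by blast
    show "smooth_on pos_orthant g" by (rule system_smooth[OF sys bdry])
  qed
  have PDI_mixed: "PDI 2 g \<longleftrightarrow> mixed_alternating g"
    using products_PDI products_mixed mixed_PDI by blast
  have probs: "?probs \<longleftrightarrow> PDI 2 g"
  proof
    assume ?probs
    then show "PDI 2 g" by (intro PDI_two_if_centred_probs) blast
  next
    assume "PDI 2 g"
    then show ?probs unfolding PDI_two_iff using centred_prob_in_M_space by blast
  qed
  have repr: "?repr \<longleftrightarrow> PDI 2 g"
    unfolding PDI_mixed using mixed_repr mixed_alternating_if_represents[OF cont] by blast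
  have bernstein: "bernstein 2 g \<longleftrightarrow> PDI 2 g"
    unfolding PDI_mixed bernstein_iff_mixed_alternating_pos mixed_alternating_pos_iff[OF cont]
    using mixed_smooth by blast
  have ?unique
    using represents_measure_unique represents_edge_unique by blast
  then show ?thesis
    using products_PDI products_mixed mixed_PDI probs repr bernstein by blast
qed


end
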